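(* Let $s_1,s_2\in\mathbb R$, $0<\vec q<\vec p<\infty$, $\vec r=(r_1,\dots,r_n)\in(0,\infty)^n$, $\vec\alpha_1=(\alpha_1^1,\dots,\alpha_n^1)\in\mathbb R^n$, $\vec\alpha_2=(\alpha_1^2,\dots,\alpha_n^2)\in\mathbb R^n$ and $0<\theta\le\infty$. Assume that $$\alpha_i^1>-\frac1{p_i},\qquad\alpha_i^2>-\frac1{q_i},\qquad i\in\{1,\dots,n\},$$ that $\alpha_i^2\ge\alpha_i^1$ for $i\in\{1,\dots,n-1\}$, and that $$s_1-\frac1{\mathbf p}-\boldsymbol\alpha_1=s_2-\frac1{\mathbf q}-\boldsymbol\alpha_2.$$ (i) If $\alpha_n^2>\alpha_n^1$, then $$\dot E_{\vec q}^{\vec\alpha_2,\vec r}B_{r_n}^{s_2}\hookrightarrow\dot E_{\vec p}^{\vec\alpha_1,\vec r}F_\theta^{s_1}.$$ (ii) If $\alpha_n^2=\alpha_n^1$, then $$\dot E_{\vec q}^{\vec\alpha_2,\vec r}B_\delta^{s_2}\hookrightarrow\dot E_{\vec p}^{\vec\alpha_1,\vec r}F_\theta^{s_1},$$ where $\delta=r_n$ if $r_n\le p_n$ and $\delta=p_n$ if $r_n>p_n$.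
   Context: Conventions: inequalities between vectors are componentwise; sums with exponent $\infty$ are replaced by suprema; $\frac1{\mathbf p}=\sum_i\frac1{p_i}$, $\frac1{\mathbf q}=\sum_i\frac1{q_i}$, $\boldsymbol\alpha_j=\sum_i\alpha_i^j$. $X\hookrightarrow Y$ means $X\subset Y$ with $\|f\|_Y\le C\|f\|_X$ for all $f\in X$. Mixed-norm Herz spaces: for $k\in\mathbb Z$ let $R_k=\{t\in\mathbb R:2^{k-1}\le|t|<2^k\}$. For $0<p,q\le\infty$, $\alpha\in\mathbb R$ and measurable $g$ on $\mathbb R$, $\|g\|_{\dot K_p^{\alpha,q}}=\big(\sum_{k\in\mathbb Z}2^{k\alpha q}\|g\chi_{R_k}\|_{L^p(\mathbb R)}^q\big)^{1/q}$. The space $\dot E_{\vec p}^{\vec\alpha,\vec q}(\mathbb R^n)$ consists of all measurable $f$ on $\mathbb R^n$ with $\|f\|_{\dot E_{\vec p}^{\vec\alpha,\vec q}(\mathbb R^n)}=\big\|\cdots\|f\|_{\dot K_{p_1}^{\alpha_1,q_1}}\cdots\big\|_{\dot K_{p_n}^{\alpha_n,q_n}}<\infty$, where the $\dot K_{p_i}^{\alpha_i,q_i}$-quasi-norm is taken in the variable $x_i$, successively for $i=1,\dots,n$ ($x_1$ innermost). Besov- and Triebel–Lizorkin-type spaces: fix $\Phi,\varphi\in\mathcal S(\mathbb R^n)$ with $\operatorname{supp}\mathcal F\Phi\subset\{|\xi|\le2\}$, $|\mathcal F\Phi(\xi)|\ge c>0$ for $|\xi|\le\frac53$, $\operatorname{supp}\mathcal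 F\varphi\subset\{\frac12\le|\xi|\le2\}$, $|\mathcal F\varphi(\xi)|\ge c>0$ for $\frac35\le|\xi|\le\frac53$. Put $\varphi_0=\Phi$, $\varphi_k=2^{kn}\varphi(2^k\cdot)$ for $k\ge1$. $\dot E_{\vec p}^{\vec\alpha,\vec q}B_\beta^s$ is the set of $f\in\mathcal S'(\mathbb R^n)$ with quasi-norm $\big(\sum_{k\ge0}2^{ks\beta}\|\varphi_k*f\|_{\dot E_{\vec p}^{\vec\alpha,\vec q}(\mathbb R^n)}^\beta\big)^{1/\beta}<\infty$. For $0<\vec p,\vec q<\infty$, $\dot E_{\vec p}^{\vec\alpha,\vec q}F_\beta^s$ is the set of $f\in\mathcal S'(\mathbb R^n)$ with quasi-norm $\big\|\big(\sum_{k\ge0}2^{ks\beta}|\varphi_k*f|^\beta\big)^{1/\beta}\big\|_{\dot E_{\vec p}^{\vec\alpha,\vec q}(\mathbb R^n)}<\infty$. *)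

theory Defs
  imports "HOL-Analysis.Analysis" "HOL-Probability.Essential_Supremum"
begin

text \<open>
  Points of $R^n$ have type \<open>real^'n\<close> with \<open>'n :: {finite, linorder}\<close> and $n$ = \<open>CARD('n)\<close>; the linear
  order on the index type is the order $1, \dots, n$ of the coordinates. Norms take values in
  \<open>ennreal\<close> and are applied to the modulus of a function; membership in a space is finiteness of the norm.
\<close>

type_synonym 'n point = "real ^ 'n"

section \<open>Lebesgue quasi-norms\<close>

text \<open>$x^a$ for $0 < a < \infty$, with $\infty^a = \infty$.\<close>

definition epow :: "ennreal \<Rightarrow> real \<Rightarrow> ennreal" where
  "epow x a = (if x = \<infinity> then \<infinity> else ennreal (enn2real x powr a))"

definition Lp_norm :: "'a measure \<Rightarrow> ennreal \<Rightarrow> ('a \<Rightarrow> ennreal) \<Rightarrow> ennreal" where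
  "Lp_norm M p g =
     (if p = \<infinity> then esssup M g
      else epow (\<integral>\<^sup>+ x. epow (g x) (enn2real p) \<partial>M) (1 / enn2real p))"

text \<open>With respect to counting measure this is the sequence quasi-norm
  $(\sum_k a_k^q)^{1/q}$, respectively $\sup_k a_k$ for $q = \infty$.\<close>

abbreviation lq_norm :: "ennreal \<Rightarrow> ('k \<Rightarrow> ennreal) \<Rightarrow> ennreal" where
  "lq_norm q a \<equiv> Lp_norm (count_space UNIV) q a"

lemma lq_norm_infinity: "lq_norm \<infinity> a = (SUP k. a k)"
proof -
  have "{z. AE k in count_space UNIV. a k \<le> z} = {z. \<forall>k. a k \<le> z}"
    by (simp add: AE_count_space)
  moreover have "Inf {z. \<forall>k. a k \<le> z} = (SUP k. a k)"
    by (rule antisym) (auto intro!: Inf_lower SUP_upper Inf_greatest SUP_least)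
  ultimately show ?thesis
    by (simp add: Lp_norm_def esssup_eq_AE)
qed

section \<open>Mixed-norm Herz spaces\<close>

definition annulus :: "int \<Rightarrow> real set" where
  "annulus k = {t. 2 powi (k - 1) \<le> \<bar>t\<bar> \<and> \<bar>t\<bar> < 2 powi k}"

text \<open>The factor $2^{k\alpha q}$ is written inside the $q$-th power, so that the formula also covers
  $q = \infty$.\<close>

definition herz_norm :: "ennreal \<Rightarrow> real \<Rightarrow> ennreal \<Rightarrow> (real \<Rightarrow> ennreal) \<Rightarrow> ennreal" where
  "herz_norm p \<alpha> q g =
     lq_norm q (\<lambda>k::int. ennreal (2 powr (of_int k * \<alpha>)) *
       Lp_norm lebesgue p (\<lambda>t. g t * indicator (annulus k) t))"

definition upd_coord :: "real^'n \<Rightarrow> 'n \<Rightarrow> real \<Rightarrow> real^'n" where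
  "upd_coord x i t = (\<chi> j. if j = i then t else x $ j)"

primrec iterated_herz ::
  "('n \<Rightarrow> ennreal) \<Rightarrow> ('n \<Rightarrow> real) \<Rightarrow> ('n \<Rightarrow> ennreal) \<Rightarrow> 'n list \<Rightarrow>
   (real^'n \<Rightarrow> ennreal) \<Rightarrow> (real^'n \<Rightarrow> ennreal)" where
  "iterated_herz p \<alpha> q [] g = g"
| "iterated_herz p \<alpha> q (i # js) g =
     iterated_herz p \<alpha> q js (\<lambda>x. herz_norm (p i) (\<alpha> i) (q i) (\<lambda>t. g (upd_coord x i t)))"

text \<open>After all coordinates have been used up the iterated norm is a constant function, which is
  evaluated at the (irrelevant) point 0.\<close>

definition mixed_herz_norm ::
  "('n::{finite,linorder} \<Rightarrow> ennreal) \<Rightarrow> ('n \<Rightarrow> real) \<Rightarrow> ('n \<Rightarrow> ennreal) \<Rightarrow>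
   ('n point \<Rightarrow> ennreal) \<Rightarrow> ennreal" where
  "mixed_herz_norm p \<alpha> q g = iterated_herz p \<alpha> q (sorted_list_of_set UNIV) g 0"

section \<open>Schwartz functions and tempered distributions\<close>

primrec partials :: "'n list \<Rightarrow> (real^'n \<Rightarrow> complex) \<Rightarrow> (real^'n \<Rightarrow> complex)" where
  "partials [] f = f"
| "partials (i # js) f = (\<lambda>x. frechet_derivative (partials js f) (at x) (axis i 1))"

definition schwartz :: "(real^'n \<Rightarrow> complex) set" where
  "schwartz = {f. (\<forall>js x. partials js f differentiable (at x)) \<and>
     (\<forall>N js. bounded (range (\<lambda>x. (1 + norm x) ^ N * norm (partials js f x))))}"

definition schwartz_seminorm :: "nat \<Rightarrow> (real^'n \<Rightarrow> complex) \<Rightarrow> real" where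
  "schwartz_seminorm N f =
     (SUP (js, x) \<in> {js. length js \<le> N} \<times> UNIV. (1 + norm x) ^ N * norm (partials js f x))"

text \<open>Continuity of the functional is expressed by a bound in terms of one of the (increasing)
  seminorms generating the topology of the Schwartz space.\<close>

definition tempered_distributions :: "((real^'n \<Rightarrow> complex) \<Rightarrow> complex) set" where
  "tempered_distributions = {T \<in> extensional schwartz.
     (\<forall>f\<in>schwartz. \<forall>g\<in>schwartz. \<forall>a b. T (\<lambda>x. a * f x + b * g x) = a * T f + b * T g) \<and>
     (\<exists>N C. \<forall>f\<in>schwartz. norm (T f) \<le> C * schwartz_seminorm N f)}"

definition convol ::
  "(real^'n \<Rightarrow> complex) \<Rightarrow> ((real^'n \<Rightarrow> complex) \<Rightarrow> complex) \<Rightarrow> real^'n \<Rightarrow> complex" where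
  "convol \<phi> T x = T (\<lambda>y. \<phi> (x - y))"

definition fourier :: "(real^'n \<Rightarrow> complex) \<Rightarrow> real^'n \<Rightarrow> complex" where
  "fourier f \<xi> = complex_of_real ((2 * pi) powr (- real CARD('n) / 2)) *
     (LINT x|lborel. cis (- (x \<bullet> \<xi>)) * f x)"

section \<open>Besov- and Triebel--Lizorkin-type spaces\<close>

definition admissible :: "(real^'n \<Rightarrow> complex) \<Rightarrow> (real^'n \<Rightarrow> complex) \<Rightarrow> bool" where
  "admissible \<Phi> \<phi> \<longleftrightarrow>
     \<Phi> \<in> schwartz \<and> \<phi> \<in> schwartz \<and>
     closure {\<xi>. fourier \<Phi> \<xi> \<noteq> 0} \<subseteq> {\<xi>. norm \<xi> \<le> 2} \<and>
     (\<exists>c>0. \<forall>\<xi>. norm \<xi> \<le> 5/3 \<longrightarrow> norm (fourier \<Phi> \<xi>) \<ge> c) \<and>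
     closure {\<xi>. fourier \<phi> \<xi> \<noteq> 0} \<subseteq> {\<xi>. 1/2 \<le> norm \<xi> \<and> norm \<xi> \<le> 2} \<and>
     (\<exists>c>0. \<forall>\<xi>. 3/5 \<le> norm \<xi> \<and> norm \<xi> \<le> 5/3 \<longrightarrow> norm (fourier \<phi> \<xi>) \<ge> c)"

definition dyadic ::
  "(real^'n \<Rightarrow> complex) \<Rightarrow> (real^'n \<Rightarrow> complex) \<Rightarrow> nat \<Rightarrow> real^'n \<Rightarrow> complex" where
  "dyadic \<Phi> \<phi> k = (if k = 0 then \<Phi> else (\<lambda>x. 2 ^ (k * CARD('n)) * \<phi> (2 ^ k *\<^sub>R x)))"

definition besov_norm ::
  "('n point \<Rightarrow> complex) \<Rightarrow> ('n point \<Rightarrow> complex) \<Rightarrow>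
   ('n::{finite,linorder} \<Rightarrow> ennreal) \<Rightarrow> ('n \<Rightarrow> real) \<Rightarrow> ('n \<Rightarrow> ennreal) \<Rightarrow> real \<Rightarrow> ennreal \<Rightarrow>
   (('n point \<Rightarrow> complex) \<Rightarrow> complex) \<Rightarrow> ennreal" where
  "besov_norm \<Phi> \<phi> p \<alpha> q s \<beta> f =
     lq_norm \<beta> (\<lambda>k::nat. ennreal (2 powr (real k * s)) *
       mixed_herz_norm p \<alpha> q (\<lambda>x. ennreal (norm (convol (dyadic \<Phi> \<phi> k) f x))))"

definition triebel_norm ::
  "('n point \<Rightarrow> complex) \<Rightarrow> ('n point \<Rightarrow> complex) \<Rightarrow>
   ('n::{finite,linorder} \<Rightarrow> ennreal) \<Rightarrow> ('n \<Rightarrow> real) \<Rightarrow> ('n \<Rightarrow> ennreal) \<Rightarrow> real \<Rightarrow> ennreal \<Rightarrow>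
   (('n point \<Rightarrow> complex) \<Rightarrow> complex) \<Rightarrow> ennreal" where
  "triebel_norm \<Phi> \<phi> p \<alpha> q s \<beta> f =
     mixed_herz_norm p \<alpha> q (\<lambda>x.
       lq_norm \<beta> (\<lambda>k::nat. ennreal (2 powr (real k * s)) *
         ennreal (norm (convol (dyadic \<Phi> \<phi> k) f x))))"

text \<open>The functions \<open>convol (dyadic \<Phi> \<phi> k) f\<close> are smooth, so the measurability required
  of members of the mixed-norm Herz space holds automatically here.\<close>

definition besov_space ::
  "('n point \<Rightarrow> complex) \<Rightarrow> ('n point \<Rightarrow> complex) \<Rightarrow>
   ('n::{finite,linorder} \<Rightarrow> ennreal) \<Rightarrow> ('n \<Rightarrow> real) \<Rightarrow> ('n \<Rightarrow> ennreal) \<Rightarrow> real \<Rightarrow> ennreal \<Rightarrow>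
   (('n point \<Rightarrow> complex) \<Rightarrow> complex) set" where
  "besov_space \<Phi> \<phi> p \<alpha> q s \<beta> =
     {f \<in> tempered_distributions. besov_norm \<Phi> \<phi> p \<alpha> q s \<beta> f < \<infinity>}"

definition triebel_space ::
  "('n point \<Rightarrow> complex) \<Rightarrow> ('n point \<Rightarrow> complex) \<Rightarrow>
   ('n::{finite,linorder} \<Rightarrow> ennreal) \<Rightarrow> ('n \<Rightarrow> real) \<Rightarrow> ('n \<Rightarrow> ennreal) \<Rightarrow> real \<Rightarrow> ennreal \<Rightarrow>
   (('n point \<Rightarrow> complex) \<Rightarrow> complex) set" where
  "triebel_space \<Phi> \<phi> p \<alpha> q s \<beta> =
     {f \<in> tempered_distributions. triebel_norm \<Phi> \<phi> p \<alpha> q s \<beta> f < \<infinity>}"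

definition embeds :: "'a set \<Rightarrow> ('a \<Rightarrow> ennreal) \<Rightarrow> 'a set \<Rightarrow> ('a \<Rightarrow> ennreal) \<Rightarrow> bool" where
  "embeds X NX Y NY \<longleftrightarrow> X \<subseteq> Y \<and> (\<exists>C::real. \<forall>f\<in>X. NY f \<le> ennreal C * NX f)"

text \<open>$\dot E_{\vec q}^{\vec\alpha_2,\vec r} B_\beta^{s_2} \hookrightarrow
  \dot E_{\vec p}^{\vec\alpha_1,\vec r} F_\theta^{s_1}$ (after the common \<open>r\<close>, first the parameters
  of the source, then those of the target); all entries of the exponent vectors are finite, as required for the
  Triebel--Lizorkin-type space.\<close>

definition besov_embeds_triebel ::
  "('n point \<Rightarrow> complex) \<Rightarrow> ('n point \<Rightarrow> complex) \<Rightarrow>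
   ('n::{finite,linorder} \<Rightarrow> real) \<Rightarrow>
   ('n \<Rightarrow> real) \<Rightarrow> ('n \<Rightarrow> real) \<Rightarrow> real \<Rightarrow> ennreal \<Rightarrow>
   ('n \<Rightarrow> real) \<Rightarrow> ('n \<Rightarrow> real) \<Rightarrow> real \<Rightarrow> ennreal \<Rightarrow> bool" where
  "besov_embeds_triebel \<Phi> \<phi> r q \<alpha>2 s2 \<beta> p \<alpha>1 s1 \<theta> \<longleftrightarrow>
     embeds
       (besov_space \<Phi> \<phi> (\<lambda>i. ennreal (q i)) \<alpha>2 (\<lambda>i. ennreal (r i)) s2 \<beta>)
       (besov_norm \<Phi> \<phi> (\<lambda>i. ennreal (q i)) \<alpha>2 (\<lambda>i. ennreal (r i)) s2 \<beta>)
       (triebel_space \<Phi> \<phi> (\<lambda>i. ennreal (p i)) \<alpha>1 (\<lambda>i. ennreal (r i)) s1 \<theta>)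
       (triebel_norm \<Phi> \<phi> (\<lambda>i. ennreal (p i)) \<alpha>1 (\<lambda>i. ennreal (r i)) s1 \<theta>)"

end

theory Submission
  imports Defs "HOL-Probability.Sinc_Integral" "HOL-Probability.Characteristic_Functions"
begin

text \<open>
  Since $\ell^\theta$ norms decrease in $\theta$, one may take $\theta = \eta$ small, and after raising everything
  to the power $\eta$ all exponents are at least 1 and the sum over the frequencies $k$ becomes an $\ell^1$ sum.
  The functions $h_k = |\varphi_k * f|^\eta$ are controlled, in each variable separately, by a sampling formula with
  a rapidly decaying kernel; so $h_k$ is bounded by its convolution with $2^k (1 + 2^k |\cdot|)^{-M}$. This
  property survives taking a Herz norm in one of the other variables.

  Hence the variables can be treated one at a time. In the first $n - 1$ variables the triangle inequality and
  Nikolskii's inequality suffice. In the last one, the contributions to an annulus of radius $2^j$ coming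
  from distant annuli, or from frequencies $k \le -j$, decay geometrically thanks to
  $\alpha^1 > -1/p$ and $\eta (\alpha^2 + 1/q) < 1$; the latter is where the smallness of $\eta$ replaces an upper bound on
  $\alpha^2$. The remaining diagonal part is the Jawerth--Franke embedding, proved by real interpolation between
  $L^q$ and $L^\infty$.
\<close>

section \<open>Powers and norms in the extended nonnegative reals\<close>

text \<open>The sampling formula has to be discrete: for \<open>e <= 1\<close> the
  \<open>e\<close>-th power of a sum is at most the sum of the \<open>e\<close>-th powers, which has
  no analogue for integrals, so a reproducing convolution would not pass from \<open>f\<close> to
  \<open>|f|^e\<close>. The position of the lattice is kept free: averaging over it turns the
  discrete inequality into the convolution bound, and moving it lets the formula survive
  differentiation and the substitution of \<open>X - 2^k y\<close>.

  The constant of the embedding may not depend on the distribution, although the order of the latter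
  does; hence two separate decay estimates for the kernel.

  The distinction between (i) and (ii) arises in the diagonal part of the last variable.
  Interpolation leaves there an \<open>l^P\<close> norm over the frequencies with weights
  \<open>2^(-(A2 - A1)(j + k))\<close>, where \<open>j + k > 0\<close>. If \<open>A1 = A2\<close>
  they are 1 and the source needs a summation exponent at most \<open>P\<close>; if
  \<open>A1 < A2\<close> they are geometric and the supremum over the frequencies is enough. The
  other restriction, by \<open>r_n\<close>, comes from exchanging the norm over annuli with the one
  over frequencies.\<close>

lemma epow_ennreal: "0 \<le> x \<Longrightarrow> epow (ennreal x) a = ennreal (x powr a)"
  by (simp add: epow_def)

lemma epow_top [simp]: "epow top a = top"
  by (simp add: epow_def)

lemma epow_0 [simp]: "epow 0 a = 0"
  by (simp add: epow_def)

lemma epow_1 [simp]: "epow 1 a = 1"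
  by (simp add: epow_def)

lemma epow_one [simp]: "epow x 1 = x"
  by (cases x) (simp_all add: epow_ennreal)

lemma epow_mono: "0 \<le> a \<Longrightarrow> x \<le> y \<Longrightarrow> epow x a \<le> epow y a"
  by (cases x; cases y) (auto simp: epow_ennreal powr_mono2 top_unique)

lemma epow_eq_0_iff [simp]: "epow x a = 0 \<longleftrightarrow> x = 0"
  by (cases x) (auto simp: epow_ennreal ennreal_eq_0_iff)

lemma epow_eq_top_iff [simp]: "epow x a = top \<longleftrightarrow> x = top"
  by (cases x) (auto simp: epow_ennreal)

text \<open>\<open>epow\<close> sends 0 to 0 and top to top for every real exponent, also for 0 and
  for negative ones. This makes the laws for products and for sums of exponents hold
  throughout.\<close>

lemma epow_mult: "epow (x * y) a = epow x a * epow y a"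
proof (cases "x = top \<or> y = top")
  case True
  then show ?thesis
    by (auto simp: ennreal_top_mult ennreal_mult_top)
next
  case False
  then show ?thesis
    by (cases x; cases y) (auto simp: epow_ennreal ennreal_mult[symmetric] powr_mult)
qed

lemma epow_epow: "epow (epow x a) b = epow x (a * b)"
  by (cases x) (auto simp: epow_ennreal powr_powr)

lemma epow_add: "epow x (a + b) = epow x a * epow x b"
  by (cases x) (auto simp: epow_ennreal ennreal_mult[symmetric] powr_add)

lemma epow_le_iff:
  assumes "0 < a"
  shows "epow x a \<le> epow y a \<longleftrightarrow> x \<le> y"
proof
  assume "epow x a \<le> epow y a"
  then have "epow (epow x a) (1 / a) \<le> epow (epow y a) (1 / a)"
    by (rule epow_mono[rotated]) (use assms in simp)
  then show "x \<le> y" using assms by (simp add: epow_epow)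
qed (use assms in \<open>simp add: epow_mono\<close>)

lemma borel_measurable_epow [measurable (raw)]:
  assumes "f \<in> borel_measurable M"
  shows "(\<lambda>x. epow (f x) a) \<in> borel_measurable M"
  unfolding epow_def using assms by measurable

text \<open>Up to the threshold \<open>l\<close> the first summand is enough; beyond it
  \<open>x\<close> is the product of \<open>x^(1-p)\<close> and \<open>x^p\<close>, and the first
  factor is at most \<open>l^(1-p)\<close>.\<close>

lemma le_weighted_epow:
  assumes "0 < l" "1 \<le> p"
  shows "x \<le> ennreal l + ennreal (l powr (1 - p)) * epow x p"
proof (cases x)
  case (real t)
  show ?thesis
  proof (cases "t \<le> l")
    case True
    then have "x \<le> ennreal l" using real by simp
    then show ?thesis by (rule order_trans) simp
  next
    case False
    then have "t powr (1 - p) \<le> l powr (1 - p)"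
      using assms by (intro powr_mono2') auto
    then have "t powr (1 - p) * t powr p \<le> l powr (1 - p) * t powr p"
      by (intro mult_right_mono) auto
    moreover have "t powr (1 - p) * t powr p = t"
      using False assms by (simp add: powr_add[symmetric])
    ultimately have "ennreal t \<le> ennreal (l powr (1 - p)) * ennreal (t powr p)"
      by (simp add: ennreal_mult[symmetric])
    then show ?thesis using real
      by (simp add: epow_ennreal add_increasing)
  qed
next
  case top
  then show ?thesis using assms by (simp add: ennreal_mult_top)
qed

lemma ennreal_pos_realE:
  assumes "x \<noteq> 0" "x \<noteq> top"
  obtains r where "x = ennreal r" "0 < r"
  using assms by (cases x) (auto simp: less_le)

lemma borel_measurable_csum [measurable (raw)]:
  fixes f :: "'a \<Rightarrow> 'k::countable \<Rightarrow> ennreal"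
  assumes "\<And>k. (\<lambda>x. f x k) \<in> borel_measurable M"
  shows "(\<lambda>x. \<integral>\<^sup>+k. f x k \<partial>count_space UNIV) \<in> borel_measurable M"
proof -
  interpret sigma_finite_measure "count_space (UNIV :: 'k set)"
    by (rule sigma_finite_measure_count_space)
  show ?thesis
    by (intro borel_measurable_nn_integral
      measurable_compose_countable'[where f="\<lambda>k z. case_prod f (fst z, k)" and g=snd and I=UNIV, simplified])
      (use assms in auto)
qed

text \<open>Hoelder's inequality up to a factor 2, which spares the exact Young inequality: integrate \<open>f \<le> l + l\<^bsup>1-p\<^esup> f\<^bsup>p\<^esup>\<close> against \<open>w\<close> and
  optimise in \<open>l\<close>.\<close>

lemma nn_integral_weighted_le:
  assumes [measurable]: "w \<in> borel_measurable M" "f \<in> borel_measurable M" and p: "1 \<le> p"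
  shows "(\<integral>\<^sup>+x. w x * f x \<partial>M) \<le>
    2 * (epow (\<integral>\<^sup>+x. w x \<partial>M) (1 - 1/p) * epow (\<integral>\<^sup>+x. w x * epow (f x) p \<partial>M) (1/p))"
proof -
  let ?W = "\<integral>\<^sup>+x. w x \<partial>M" and ?B = "\<integral>\<^sup>+x. w x * epow (f x) p \<partial>M"
  consider "?W = 0" | "?B = 0" | "?W \<noteq> 0" "?B \<noteq> 0" "?W = top \<or> ?B = top"
    | "?W \<noteq> 0" "?B \<noteq> 0" "?W \<noteq> top" "?B \<noteq> top" by blast
  then show ?thesis
  proof cases
    case 1
    then have "AE x in M. w x = 0" by (simp add: nn_integral_0_iff_AE)
    then have "(\<integral>\<^sup>+x. w x * f x \<partial>M) = 0" by (subst nn_integral_0_iff_AE) auto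
    then show ?thesis by simp
  next
    case 2
    then have "AE x in M. w x * epow (f x) p = 0" by (simp add: nn_integral_0_iff_AE)
    then have "(\<integral>\<^sup>+x. w x * f x \<partial>M) = 0" by (subst nn_integral_0_iff_AE) auto
    then show ?thesis by simp
  next
    case 3
    then show ?thesis by (auto simp: ennreal_mult_eq_top_iff ennreal_top_mult ennreal_mult_top)
  next
    case 4
    then obtain W B where W: "?W = ennreal W" "0 < W" and B: "?B = ennreal B" "0 < B"
      by (metis ennreal_pos_realE)
    \<comment> \<open>With this \<open>l\<close> the two terms of the bound coincide; hence the
      factor 2.\<close>
    define l where "l = (B / W) powr (1/p)"
    have l: "0 < l" using W B by (simp add: l_def)
    have "(\<integral>\<^sup>+x. w x * f x \<partial>M) \<le> (\<integral>\<^sup>+x. ennreal l * w x + ennreal (l powr (1-p)) * (w x * epow (f x) p) \<partial>M)"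
    proof (intro nn_integral_mono)
      fix x
      have "w x * f x \<le> w x * (ennreal l + ennreal (l powr (1 - p)) * epow (f x) p)"
        by (intro mult_left_mono le_weighted_epow l p) simp
      then show "w x * f x \<le> ennreal l * w x + ennreal (l powr (1-p)) * (w x * epow (f x) p)"
        by (simp add: distrib_left mult_ac)
    qed
    also have "\<dots> = ennreal l * ?W + ennreal (l powr (1-p)) * ?B"
      by (simp add: nn_integral_add nn_integral_cmult)
    also have "\<dots> = ennreal (l * W + l powr (1-p) * B)"
      using W B l by (simp add: ennreal_mult[symmetric] ennreal_plus[symmetric] del: ennreal_plus)
    also have "l * W = W powr (1 - 1/p) * B powr (1/p)"
      using W B by (simp add: l_def powr_divide powr_diff field_simps)
    also have "l powr (1-p) * B = W powr (1 - 1/p) * B powr (1/p)"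
    proof -
      have "l powr (1-p) = (B / W) powr (1/p - 1)"
        using p by (simp add: l_def powr_powr field_simps)
      also have "\<dots> = B powr (1/p - 1) * W powr (1 - 1/p)"
        using W B by (simp add: powr_divide powr_diff field_simps)
      finally show ?thesis using B by (simp add: powr_diff)
    qed
    also have "ennreal (W powr (1 - 1/p) * B powr (1/p) + W powr (1 - 1/p) * B powr (1/p)) =
      2 * (epow ?W (1 - 1/p) * epow ?B (1/p))"
    proof -
      have "epow ?W (1 - 1/p) * epow ?B (1/p) = ennreal (W powr (1 - 1/p) * B powr (1/p))"
        using W B by (simp add: epow_ennreal ennreal_mult[symmetric])
      then show ?thesis by (simp only:) (metis ennreal_plus mult_2 mult_nonneg_nonneg powr_ge_zero)
    qed
    finally show ?thesis .
  qed
qed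

section \<open>Lebesgue and sequence norms with finite exponents\<close>

definition lpn :: "'a measure \<Rightarrow> real \<Rightarrow> ('a \<Rightarrow> ennreal) \<Rightarrow> ennreal" where
  "lpn M p g = epow (\<integral>\<^sup>+ x. epow (g x) p \<partial>M) (1 / p)"

abbreviation csum :: "('k \<Rightarrow> ennreal) \<Rightarrow> ennreal" where
  "csum f \<equiv> (\<integral>\<^sup>+k. f k \<partial>count_space UNIV)"

abbreviation cln :: "real \<Rightarrow> ('k \<Rightarrow> ennreal) \<Rightarrow> ennreal" where
  "cln p f \<equiv> lpn (count_space UNIV) p f"

lemma Lp_norm_eq_lpn: "0 < p \<Longrightarrow> Lp_norm M (ennreal p) g = lpn M p g"
  by (simp add: Lp_norm_def lpn_def)

lemma lpn_mono: "0 < p \<Longrightarrow> (\<And>x. x \<in> space M \<Longrightarrow> f x \<le> g x) \<Longrightarrow> lpn M p f \<le> lpn M p g"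
  unfolding lpn_def by (intro epow_mono nn_integral_mono) auto

lemma epow_lpn: "0 < p \<Longrightarrow> epow (lpn M p f) p = (\<integral>\<^sup>+x. epow (f x) p \<partial>M)"
  by (simp add: lpn_def epow_epow)

lemma lpn_1 [simp]: "lpn M 1 f = (\<integral>\<^sup>+x. f x \<partial>M)"
  by (simp add: lpn_def)

lemma lpn_cmult:
  assumes [measurable]: "f \<in> borel_measurable M" and "0 < p"
  shows "lpn M p (\<lambda>x. c * f x) = c * lpn M p f"
  using assms by (simp add: lpn_def epow_mult nn_integral_cmult epow_epow)

lemma lpn_rescale: "0 < p \<Longrightarrow> 0 < e \<Longrightarrow> epow (lpn M p f) e = lpn M (p / e) (\<lambda>x. epow (f x) e)"
  by (simp add: lpn_def epow_epow)

text \<open>With \<open>T\<close> the sum of the \<open>a\<close>-th powers, every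
  \<open>epow (f k) a\<close> is at most \<open>T\<close>, so the surplus power \<open>b - a\<close>
  of each term is at most \<open>T\<close> to the power \<open>(b - a) / a\<close>.\<close>

lemma cln_antimono:
  fixes f :: "'k \<Rightarrow> ennreal"
  assumes "0 < a" "a \<le> b"
  shows "cln b f \<le> cln a f"
proof -
  define T where "T = csum (\<lambda>k. epow (f k) a)"
  have le: "epow (f k) a \<le> T" for k
  proof -
    have "epow (f k) a = csum (\<lambda>i. epow (f i) a * indicator {k} i)"
      by (subst nn_integral_indicator_singleton) auto
    also have "\<dots> \<le> T" unfolding T_def by (intro nn_integral_mono) (auto split: split_indicator)
    finally show ?thesis .
  qed
  have "csum (\<lambda>k. epow (f k) b) \<le> csum (\<lambda>k. epow T ((b - a) / a) * epow (f k) a)"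
  proof (intro nn_integral_mono)
    fix k
    have "epow (f k) b = epow (f k) (b - a) * epow (f k) a"
      by (simp add: epow_add[symmetric])
    also have "epow (f k) (b - a) = epow (epow (f k) a) ((b - a) / a)"
      using assms by (simp add: epow_epow)
    also have "\<dots> \<le> epow T ((b - a) / a)"
      using assms le by (intro epow_mono) auto
    finally show "epow (f k) b \<le> epow T ((b - a) / a) * epow (f k) a"
      by (simp add: mult_right_mono)
  qed
  also have "\<dots> = epow T ((b - a) / a) * epow T 1"
    by (simp add: nn_integral_cmult T_def)
  also have "\<dots> = epow T (b / a)"
    using assms by (simp only: epow_add[symmetric]) (simp add: diff_divide_distrib)
  finally have "epow (csum (\<lambda>k. epow (f k) b)) (1 / b) \<le> epow (epow T (b / a)) (1 / b)"
    using assms by (intro epow_mono) auto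
  then show ?thesis using assms by (simp add: lpn_def T_def epow_epow)
qed

lemma cln_ge: "0 < p \<Longrightarrow> f k \<le> cln p f"
proof -
  assume p: "0 < p"
  have "epow (f k) p = csum (\<lambda>i. epow (f i) p * indicator {k} i)"
    by (subst nn_integral_indicator_singleton) auto
  also have "\<dots> \<le> csum (\<lambda>k. epow (f k) p)" by (intro nn_integral_mono) (auto split: split_indicator)
  also have "\<dots> = epow (cln p f) p" by (simp add: epow_lpn p)
  finally show ?thesis using p by (simp add: epow_le_iff)
qed

lemma epow_csum_le:
  assumes "0 < a" "a \<le> 1"
  shows "epow (csum f) a \<le> csum (\<lambda>k. epow (f k) a)"
proof -
  have "cln 1 f \<le> cln a f" by (rule cln_antimono) (use assms in auto)
  then have "epow (csum f) a \<le> epow (cln a f) a" using assms by (intro epow_mono) auto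
  then show ?thesis using assms by (simp add: epow_lpn)
qed

text \<open>Minkowski's inequality up to a factor 2: apply \<open>nn_integral_weighted_le\<close> to the sum over \<open>k\<close>, with the
  weights \<open>lpn M p (f k)\<close>.\<close>

lemma lpn_csum_le:
  fixes f :: "'k::countable \<Rightarrow> 'a \<Rightarrow> ennreal"
  assumes [measurable]: "\<And>k. f k \<in> borel_measurable M" and p: "1 \<le> p"
  shows "lpn M p (\<lambda>x. csum (\<lambda>k. f k x)) \<le> 2 * csum (\<lambda>k. lpn M p (f k))"
proof (cases "csum (\<lambda>k. lpn M p (f k)) = top")
  case True
  then show ?thesis by (simp add: ennreal_mult_top)
next
  case False
  define a where "a k = lpn M p (f k)" for k
  define A where "A = csum a"
  have A: "A \<noteq> top" using False by (simp add: A_def a_def)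
  have afin: "a k \<noteq> top" for k
    using cln_ge[of 1 a k] A by (auto simp: A_def top_unique)
  have int: "(\<integral>\<^sup>+x. epow (f k x) p \<partial>M) = epow (a k) p" for k
    using p by (simp add: a_def epow_lpn)
  \<comment> \<open>\<open>f k\<close> cannot be recovered from its quotient by \<open>a k\<close>
    when \<open>a k = 0\<close>. Such an \<open>f k\<close> vanishes almost everywhere, and since
    there are countably many \<open>k\<close> one null set serves for all.\<close>
  have "AE x in M. \<forall>k. a k = 0 \<longrightarrow> f k x = 0"
  proof (subst AE_all_countable, intro allI)
    fix k
    show "AE x in M. a k = 0 \<longrightarrow> f k x = 0"
    proof (cases "a k = 0")
      case True
      then have "(\<integral>\<^sup>+x. epow (f k x) p \<partial>M) = 0" by (simp add: int)
      then show ?thesis by (simp add: nn_integral_0_iff_AE)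
    qed simp
  qed
  then have ae: "AE x in M. epow (csum (\<lambda>k. f k x)) p \<le>
    epow 2 p * epow A (p - 1) * csum (\<lambda>k. a k * epow (f k x * inverse (a k)) p)"
  proof eventually_elim
    case (elim x)
    have eq: "a k * (f k x * inverse (a k)) = f k x" for k
    proof (cases "a k = 0")
      case False
      then have "a k * inverse (a k) = 1"
        using afin[of k] by (simp add: ennreal_divide_self less_top flip: divide_ennreal_def)
      then show ?thesis by (metis mult.left_commute mult.right_neutral)
    qed (use elim in simp)
    have "csum (\<lambda>k. f k x) = csum (\<lambda>k. a k * (f k x * inverse (a k)))"
      by (simp add: eq)
    also have "\<dots> \<le> 2 * (epow A (1 - 1/p) * epow (csum (\<lambda>k. a k * epow (f k x * inverse (a k)) p)) (1/p))"
      unfolding A_def by (rule nn_integral_weighted_le) (use p in auto)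
    finally have "epow (csum (\<lambda>k. f k x)) p \<le>
      epow (2 * (epow A (1 - 1/p) * epow (csum (\<lambda>k. a k * epow (f k x * inverse (a k)) p)) (1/p))) p"
      using p by (intro epow_mono) auto
    then show ?case using p by (simp add: epow_mult epow_epow algebra_simps)
  qed
  have le1: "(\<integral>\<^sup>+x. epow (f k x * inverse (a k)) p \<partial>M) \<le> 1" for k
  proof -
    have "(\<integral>\<^sup>+x. epow (f k x * inverse (a k)) p \<partial>M) = epow (a k * inverse (a k)) p"
      by (simp add: epow_mult nn_integral_multc int)
    also have "a k * inverse (a k) \<le> 1"
      by (cases "a k = 0") (use afin[of k] in \<open>simp_all add: ennreal_divide_self less_top flip: divide_ennreal_def\<close>)
    then have "epow (a k * inverse (a k)) p \<le> epow 1 p" using p by (intro epow_mono) auto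
    finally show ?thesis by simp
  qed
  have "(\<integral>\<^sup>+x. epow (csum (\<lambda>k. f k x)) p \<partial>M) \<le>
     (\<integral>\<^sup>+x. epow 2 p * epow A (p - 1) * csum (\<lambda>k. a k * epow (f k x * inverse (a k)) p) \<partial>M)"
    by (intro nn_integral_mono_AE ae)
  also have "\<dots> = epow 2 p * epow A (p - 1) * csum (\<lambda>k. a k * (\<integral>\<^sup>+x. epow (f k x * inverse (a k)) p \<partial>M))"
    by (subst nn_integral_cmult) (simp_all add: nn_integral_count_space_nn_integral nn_integral_cmult)
  also have "\<dots> \<le> epow 2 p * epow A (p - 1) * csum (\<lambda>k. a k * 1)"
    by (intro mult_left_mono nn_integral_mono le1) auto
  also have "\<dots> = epow (2 * A) p"
    using epow_add[of A "p - 1" 1] by (simp add: A_def epow_mult mult.assoc)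
  finally have "lpn M p (\<lambda>x. csum (\<lambda>k. f k x)) \<le> epow (epow (2 * A) p) (1 / p)"
    unfolding lpn_def using p by (intro epow_mono) auto
  then show ?thesis using p by (simp add: epow_epow A_def a_def[abs_def])
qed

lemma csum_swap: "csum (\<lambda>i::'i::countable. csum (\<lambda>j::'j::countable. f i j)) = csum (\<lambda>j. csum (\<lambda>i. f i j))"
  by (subst nn_integral_count_space_nn_integral) auto

text \<open>After raising to the power \<open>a\<close> the inner norm is a sum and the outer one an
  \<open>l^(b/a)\<close> norm with \<open>b/a >= 1\<close>, so this is Minkowski's inequality; its
  factor 2 becomes \<open>epow 2 (1 / a)\<close>.\<close>

lemma cln_cln_swap:
  fixes f :: "'i::countable \<Rightarrow> 'j::countable \<Rightarrow> ennreal"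
  assumes "0 < a" "a \<le> b"
  shows "cln b (\<lambda>j. cln a (\<lambda>i. f i j)) \<le> epow 2 (1 / a) * cln a (\<lambda>i. cln b (\<lambda>j. f i j))"
proof -
  have "epow (cln b (\<lambda>j. cln a (\<lambda>i. f i j))) a = cln (b / a) (\<lambda>j. csum (\<lambda>i. epow (f i j) a))"
    using assms by (simp add: lpn_rescale epow_lpn)
  also have "\<dots> \<le> 2 * csum (\<lambda>i. cln (b / a) (\<lambda>j. epow (f i j) a))"
    using assms by (intro lpn_csum_le) auto
  also have "\<dots> = 2 * csum (\<lambda>i. epow (cln b (\<lambda>j. f i j)) a)"
    using assms by (simp add: lpn_rescale)
  also have "\<dots> = epow (epow 2 (1 / a) * cln a (\<lambda>i. cln b (\<lambda>j. f i j))) a"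
    using assms by (simp add: epow_mult epow_epow epow_lpn)
  finally show ?thesis using assms by (simp add: epow_le_iff)
qed

section \<open>Interpolation between $L^Q$ and $L^\infty$\<close>

lemma csum_inj_le:
  fixes g :: "'k \<Rightarrow> ennreal"
  assumes "inj_on h S"
  shows "csum (\<lambda>j. if j \<in> S then g (h j) else 0) \<le> csum g"
proof -
  have "csum (\<lambda>j. if j \<in> S then g (h j) else 0) = csum (\<lambda>j. g (h j) * indicator S j)"
    by (intro nn_integral_cong) (auto split: split_indicator)
  also have "\<dots> = (\<integral>\<^sup>+j. g (h j) \<partial>count_space S)"
    by (subst nn_integral_count_space_indicator) auto
  also have "\<dots> = (\<integral>\<^sup>+i. g i \<partial>count_space (h ` S))"
    by (intro nn_integral_bij_count_space inj_on_imp_bij_betw assms)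
  also have "\<dots> = csum (\<lambda>i. g i * indicator (h ` S) i)"
    by (subst nn_integral_count_space_indicator) auto
  also have "\<dots> \<le> csum g"
    by (intro nn_integral_mono) (auto split: split_indicator)
  finally show ?thesis .
qed

lemma cln_inj_le:
  fixes g :: "'k \<Rightarrow> ennreal"
  assumes "inj_on h S" "0 < p"
  shows "cln p (\<lambda>j. if j \<in> S then g (h j) else 0) \<le> cln p g"
proof -
  have "csum (\<lambda>j. epow (if j \<in> S then g (h j) else 0) p) = csum (\<lambda>j. if j \<in> S then epow (g (h j)) p else 0)"
    by (intro nn_integral_cong) auto
  also have "\<dots> \<le> csum (\<lambda>k. epow (g k) p)" by (rule csum_inj_le[OF assms(1), of "\<lambda>k. epow (g k) p"])
  finally show ?thesis unfolding lpn_def using assms by (intro epow_mono) auto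
qed

text \<open>Young's inequality for sequences: in a convolution the \<open>y d\<close> are translates
  of one sequence, all with norm at most the same \<open>B\<close>.\<close>

lemma cln_weighted_sum_le:
  fixes y :: "'d::countable \<Rightarrow> 'j \<Rightarrow> ennreal"
  assumes "1 \<le> p" "\<And>d. cln p (y d) \<le> B"
  shows "cln p (\<lambda>j. csum (\<lambda>d. c d * y d j)) \<le> 2 * (csum c * B)"
proof -
  have "cln p (\<lambda>j. csum (\<lambda>d. c d * y d j)) \<le> 2 * csum (\<lambda>d. cln p (\<lambda>j. c d * y d j))"
    using assms by (intro lpn_csum_le) auto
  also have "\<dots> = 2 * csum (\<lambda>d. c d * cln p (y d))"
    using assms by (subst lpn_cmult) auto
  also have "\<dots> \<le> 2 * csum (\<lambda>d. c d * B)"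
    using assms by (intro mult_left_mono nn_integral_mono) auto
  finally show ?thesis by (simp add: nn_integral_multc)
qed

text \<open>The summand is comparable to the smaller of \<open>z\<close> and \<open>1/z\<close>.
  Growth by \<open>\<rho>\<close> makes it, up to the factor \<open>\<rho> / (\<rho> - 1)\<close>,
  at most the drop of \<open>1 / (1 + z)\<close> from \<open>k\<close> to \<open>k + 1\<close>, and
  these drops add up to at most 1.\<close>

lemma sum_telescoping_le:
  fixes z :: "nat \<Rightarrow> real"
  assumes "1 < \<rho>" "\<And>k. 0 \<le> z k" "\<And>k. \<rho> * z k \<le> z (Suc k)"
  shows "(\<Sum>k<n. z k / (1 + z k)\<^sup>2) \<le> \<rho> / (\<rho> - 1)"
proof -
  have "(\<rho> - 1) / \<rho> * (z k / (1 + z k)\<^sup>2) \<le> 1 / (1 + z k) - 1 / (1 + z (Suc k))" for k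
  proof -
    have pos: "0 < 1 + z k" "0 < 1 + \<rho> * z k" using assms(1) assms(2)[of k] by (auto intro: add_pos_nonneg)
    have "(\<rho> - 1) / \<rho> * (z k / (1 + z k)\<^sup>2) = (\<rho> - 1) * z k / ((1 + z k) * (\<rho> * (1 + z k)))"
      by (simp add: power2_eq_square)
    also have "\<dots> \<le> (\<rho> - 1) * z k / ((1 + z k) * (1 + \<rho> * z k))"
      using assms(1) assms(2)[of k] pos
      by (intro divide_left_mono mult_left_mono mult_nonneg_nonneg mult_pos_pos) (auto simp: algebra_simps)
    also have "\<dots> = 1 / (1 + z k) - 1 / (1 + \<rho> * z k)"
      using pos by (simp add: field_simps)
    also have "\<dots> \<le> 1 / (1 + z k) - 1 / (1 + z (Suc k))"
      using pos assms(3)[of k] by (intro diff_left_mono divide_left_mono) auto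
    finally show ?thesis .
  qed
  then have "(\<Sum>k<n. (\<rho> - 1) / \<rho> * (z k / (1 + z k)\<^sup>2)) \<le> (\<Sum>k<n. 1 / (1 + z k) - 1 / (1 + z (Suc k)))"
    by (intro sum_mono)
  also have "\<dots> = 1 / (1 + z 0) - 1 / (1 + z n)"
    by (rule sum_lessThan_telescope')
  also have "\<dots> \<le> 1 - 0"
    using assms(2)[of 0] assms(2)[of n] by (intro diff_mono) auto
  finally have "(\<rho> - 1) / \<rho> * (\<Sum>k<n. z k / (1 + z k)\<^sup>2) \<le> 1" by (simp add: sum_distrib_left)
  then show ?thesis using assms(1) by (simp add: field_simps)
qed

lemma csum_nat_le:
  fixes f :: "nat \<Rightarrow> ennreal"
  assumes "\<And>n. (\<Sum>k<n. f k) \<le> B"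
  shows "csum f \<le> B"
  unfolding nn_integral_count_space_nat by (intro suminf_le_const summableI assms)

text \<open>If the bounds \<open>b\<close> grow geometrically, then all but the terms with \<open>b k\<close> near a single
  threshold \<open>M\<close> are negligible.\<close>

lemma epow_csum_le_geometric:
  fixes f b :: "nat \<Rightarrow> ennreal"
  assumes "1 \<le> Q" "Q < P" "0 < e"
    and b: "\<And>k. b k \<noteq> top" "\<And>k. ennreal (2 powr e) * b k \<le> b (Suc k)"
    and f: "\<And>k. f k \<le> b k"
  defines "\<rho> \<equiv> 2 powr (e * min 1 ((P - Q) / Q))"
  shows "epow (csum f) P \<le> epow (ennreal (4 * (\<rho> / (\<rho> - 1)))) P * csum (\<lambda>k. epow (b k) (P - Q) * epow (f k) Q)"
proof -
  \<comment> \<open>Both bounds on \<open>a\<close> are used below: \<open>a <= 1\<close> gives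
    \<open>y <= y^a\<close> for \<open>y <= 1\<close>, and the other one gives
    \<open>y^(-(P-Q)/Q) <= y^(-a)\<close> for \<open>y > 1\<close>.\<close>
  define a where "a = min 1 ((P - Q) / Q)"
  have a: "0 < a" "a \<le> 1" "a \<le> (P - Q) / Q" using assms by (auto simp: a_def)
  have \<rho>: "1 < \<rho>" using a assms by (simp add: \<rho>_def flip: a_def)
  define S where "S = csum (\<lambda>k. epow (b k) (P - Q) * epow (f k) Q)"
  have Sge: "epow (b k) (P - Q) * epow (f k) Q \<le> S" for k
    unfolding S_def by (rule cln_ge[of 1, simplified])
  consider "S = 0" | "S = top" | "S \<noteq> 0" "S \<noteq> top" by blast
  then show ?thesis
  proof cases
    case 1
    have "f k = 0" for k
    proof -
      have "epow (b k) (P - Q) * epow (f k) Q = 0" using Sge[of k] 1 by simp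
      then have "b k = 0 \<or> f k = 0" by simp
      then show ?thesis using f[of k] by auto
    qed
    then show ?thesis by simp
  next
    case 2
    then show ?thesis using \<rho> by (simp add: S_def[symmetric] epow_ennreal ennreal_mult_top)
  next
    case 3
    then obtain s where s: "S = ennreal s" "0 < s" by (rule ennreal_pos_realE)
    \<comment> \<open>Measured in units of \<open>M\<close>, the bound of a single term by the sum
      \<open>S\<close> reads \<open>y^(P-Q) v^Q <= 1\<close>. Together with \<open>v <= y\<close> it
      puts \<open>v\<close> below both \<open>z\<close> and \<open>1/z\<close>.\<close>
    define M where "M = s powr (1 / P)"
    have M: "0 < M" using s by (simp add: M_def)
    define y where "y k = enn2real (b k) / M" for k
    define z where "z k = y k powr a" for k
    have bk: "b k = ennreal (M * y k)" for k using b(1)[of k] M by (simp add: y_def less_top)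
    have y0: "0 \<le> y k" for k using M by (simp add: y_def)
    have z0: "0 \<le> z k" for k by (simp add: z_def)
    have "\<rho> * z k \<le> z (Suc k)" for k
    proof -
      have "2 powr e * (M * y k) \<le> M * y (Suc k)"
        using b(2)[of k] y0 M by (simp add: bk ennreal_mult[symmetric])
      then have "2 powr e * y k \<le> y (Suc k)" using M by (simp add: mult.left_commute)
      then have "(2 powr e * y k) powr a \<le> y (Suc k) powr a"
        using a y0 by (intro powr_mono2) auto
      then show ?thesis using y0 by (simp add: \<rho>_def z_def powr_mult powr_powr flip: a_def)
    qed
    then have tel: "(\<Sum>k<n. z k / (1 + z k)\<^sup>2) \<le> \<rho> / (\<rho> - 1)" for n
      by (intro sum_telescoping_le \<rho> z0)
    have fle: "f k \<le> ennreal (M * (4 * (z k / (1 + z k)\<^sup>2)))" for k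
    proof -
      obtain v where v: "f k = ennreal (M * v)" "0 \<le> v"
      proof -
        have "f k \<noteq> top" using f[of k] b(1)[of k] by (auto simp: top_unique)
        then have "f k = ennreal (M * (enn2real (f k) / M))" using M by (simp add: less_top)
        then show ?thesis using that M by (metis divide_nonneg_pos enn2real_nonneg)
      qed
      have vy: "v \<le> y k" using f[of k] M y0[of k] v by (simp add: bk)
      have "(M * y k) powr (P - Q) * (M * v) powr Q \<le> s"
        using Sge[of k] M y0[of k] v s by (simp add: bk epow_ennreal ennreal_mult[symmetric])
      moreover have "s = M powr P" using s assms by (simp add: M_def powr_powr)
      moreover have "M powr P = M powr (P - Q) * M powr Q" by (simp add: powr_add[symmetric])
      ultimately have "M powr P * (y k powr (P - Q) * v powr Q) \<le> M powr P * 1"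
        using M y0 v by (simp add: powr_mult mult_ac)
      then have prod: "y k powr (P - Q) * v powr Q \<le> 1" using M by simp
      have "v \<le> 4 * (z k / (1 + z k)\<^sup>2)"
      proof (cases "y k \<le> 1")
        case True
        have "y k \<le> z k" unfolding z_def using powr_mono'[of a 1 "y k"] a True y0[of k] by auto
        moreover have "z k \<le> 1" unfolding z_def using a True y0 by (intro powr_le1) auto
        then have "(1 + z k)\<^sup>2 \<le> 2\<^sup>2" using z0 by (intro power_mono) auto
        then have "z k * (1 + z k)\<^sup>2 \<le> z k * 4" using z0 by (intro mult_left_mono) auto
        then have "z k \<le> 4 * (z k / (1 + z k)\<^sup>2)" using z0[of k] by (simp add: pos_le_divide_eq add_pos_nonneg)
        ultimately show ?thesis using vy by simp
      next
        case False
        then have y1: "1 < y k" by simp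
        have z1: "1 \<le> z k" unfolding z_def using a y1 by (simp add: ge_one_powr_ge_zero)
        have "v powr Q \<le> y k powr (Q - P)" using prod y1
          by (simp add: powr_diff field_simps)
        then have "(v powr Q) powr (1 / Q) \<le> (y k powr (Q - P)) powr (1 / Q)"
          using assms by (intro powr_mono2) auto
        then have "v \<le> y k powr ((Q - P) / Q)" using assms v by (simp add: powr_powr)
        also have "\<dots> \<le> y k powr (- a)"
          using a y1 by (intro powr_mono) (auto simp: diff_divide_distrib)
        also have "\<dots> = 1 / z k" by (simp add: z_def powr_minus_divide)
        also have "\<dots> \<le> 4 * (z k / (1 + z k)\<^sup>2)"
        proof -
          have "(1 + z k)\<^sup>2 \<le> (2 * z k)\<^sup>2" using z1 by (intro power_mono) auto
          then show ?thesis using z1 by (simp add: field_simps power2_eq_square)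
        qed
        finally show ?thesis .
      qed
      then show ?thesis unfolding v(1) using M by (intro ennreal_leI mult_left_mono) auto
    qed
    have "csum f \<le> ennreal (M * (4 * (\<rho> / (\<rho> - 1))))"
    proof (rule csum_nat_le)
      fix n
      have "(\<Sum>k<n. f k) \<le> (\<Sum>k<n. ennreal (M * (4 * (z k / (1 + z k)\<^sup>2))))"
        by (intro sum_mono fle)
      also have "\<dots> = ennreal (M * (4 * (\<Sum>k<n. z k / (1 + z k)\<^sup>2)))"
        using M z0 by (subst sum_ennreal) (auto simp: sum_distrib_left)
      also have "\<dots> \<le> ennreal (M * (4 * (\<rho> / (\<rho> - 1))))"
        using M tel by (intro ennreal_leI mult_left_mono) auto
      finally show "(\<Sum>k<n. f k) \<le> ennreal (M * (4 * (\<rho> / (\<rho> - 1))))" .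
    qed
    then have "epow (csum f) P \<le> epow (ennreal (M * (4 * (\<rho> / (\<rho> - 1))))) P"
      using assms by (intro epow_mono) auto
    also have "\<dots> = epow (ennreal (4 * (\<rho> / (\<rho> - 1)))) P * ennreal (M powr P)"
    proof -
      have "ennreal (M * (4 * (\<rho> / (\<rho> - 1)))) = ennreal (4 * (\<rho> / (\<rho> - 1))) * ennreal M"
        using M \<rho> by (subst ennreal_mult[symmetric]) (auto simp: mult_ac)
      then show ?thesis using M by (simp only: epow_mult) (simp add: epow_ennreal)
    qed
    also have "M powr P = s" using s assms by (simp add: M_def powr_powr)
    finally show ?thesis by (simp add: s S_def[symmetric])
  qed
qed

text \<open>The inequality behind the Jawerth--Franke embedding: the assumptions bound \<open>f k\<close> in
  \<open>L\<^bsup>Q\<^esup>\<close> and in \<open>L\<^bsup>\<infinity>\<^esup>\<close>, and \<open>L\<^bsup>P\<^esup>\<close> is a real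
  interpolation space between them.\<close>

lemma interpolation_bound:
  assumes "1 \<le> Q" "Q < P"
  obtains C where "0 < C"
    and "\<And>(M::'a measure) f (a::nat \<Rightarrow> ennreal). (\<And>k. f k \<in> borel_measurable M) \<Longrightarrow>
      (\<And>k x. x \<in> space M \<Longrightarrow> f k x \<le> a k) \<Longrightarrow>
      (\<And>k. (\<integral>\<^sup>+x. epow (f k x) Q \<partial>M) \<le> ennreal (2 powr (- real k)) * epow (a k) Q) \<Longrightarrow>
      lpn M P (\<lambda>x. csum (\<lambda>k. f k x)) \<le> ennreal C * cln P (\<lambda>k. ennreal (2 powr (- real k / P)) * a k)"
proof -
  \<comment> \<open>Half of the rate \<open>1 / P\<close> at which the weights on the right decay.
    The majorant \<open>b\<close> below is allowed to grow by \<open>2^e\<close> per step, and the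
    factor \<open>r = 2^(-e)\<close> is left over for summation.\<close>
  define e where "e = 1 / (2 * P)"
  define \<rho> where "\<rho> = 2 powr (e * min 1 ((P - Q) / Q))"
  have e: "0 < e" using assms by (simp add: e_def)
  have \<rho>: "1 < \<rho>" using assms e by (simp add: \<rho>_def)
  define C1 where "C1 = 4 * (\<rho> / (\<rho> - 1))"
  define r where "r = 2 powr (- e)"
  have r: "0 < r" "r < 1" using e by (auto simp: r_def powr_less_one)
  define C where "C = C1 * (2 * (1 / (1 - r)))"
  have C1: "0 < C1" using \<rho> by (simp add: C1_def)
  have C: "0 < C" using C1 r by (simp add: C_def)
  show ?thesis
  proof (rule that[OF C])
    fix M :: "'a measure" and f and a :: "nat \<Rightarrow> ennreal"
    assume meas [measurable]: "\<And>k. f k \<in> borel_measurable M"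
      and fa: "\<And>k x. x \<in> space M \<Longrightarrow> f k x \<le> a k"
      and fQ: "\<And>k. (\<integral>\<^sup>+x. epow (f k x) Q \<partial>M) \<le> ennreal (2 powr (- real k)) * epow (a k) Q"
    let ?a' = "\<lambda>k. ennreal (2 powr (- real k / P)) * a k"
    show "lpn M P (\<lambda>x. csum (\<lambda>k. f k x)) \<le> ennreal C * cln P ?a'"
    proof (cases "cln P ?a' = top")
      case True
      then show ?thesis using C by (simp add: ennreal_mult_top)
    next
      case False
      have afin: "a k \<noteq> top" for k
        using cln_ge[of P ?a' k] False assms by (auto simp: ennreal_mult_top top_unique)
      \<comment> \<open>A majorant of \<open>a\<close> with the growth that
        \<open>epow_csum_le_geometric\<close> requires. It is the convolution of \<open>a\<close>
        with a geometric sequence, so Young's inequality leads back to \<open>a\<close> at the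
        end.\<close>
      define b where "b k = (\<Sum>d\<le>k. ennreal (2 powr (e * d)) * a (k - d))" for k
      have bSuc: "b (Suc k) = a (Suc k) + ennreal (2 powr e) * b k" for k
      proof -
        have "ennreal (2 powr (e * real (Suc d))) * a (Suc k - Suc d) =
            ennreal (2 powr e) * (ennreal (2 powr (e * d)) * a (k - d))" for d
        proof -
          have "2 powr (e * real (Suc d)) = 2 powr e * 2 powr (e * d)"
            by (simp add: powr_add[symmetric] distrib_left)
          then show ?thesis by (simp add: ennreal_mult mult.assoc)
        qed
        then show ?thesis
          unfolding b_def by (subst sum.atMost_Suc_shift) (simp add: sum_distrib_left)
      qed
      have ab: "a k \<le> b k" for k
        by (cases k) (auto simp: bSuc, simp add: b_def)
      have bfin: "b k \<noteq> top" for k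
        using afin by (auto simp: b_def ennreal_mult_eq_top_iff)
      have "(\<integral>\<^sup>+x. epow (csum (\<lambda>k. f k x)) P \<partial>M) \<le>
        (\<integral>\<^sup>+x. epow (ennreal C1) P * csum (\<lambda>k. epow (b k) (P - Q) * epow (f k x) Q) \<partial>M)"
      proof (intro nn_integral_mono)
        fix x assume x: "x \<in> space M"
        show "epow (csum (\<lambda>k. f k x)) P \<le> epow (ennreal C1) P * csum (\<lambda>k. epow (b k) (P - Q) * epow (f k x) Q)"
          unfolding C1_def \<rho>_def
          by (rule epow_csum_le_geometric[OF assms e bfin])
            (use fa ab x in \<open>auto simp: bSuc intro: order_trans\<close>)
      qed
      also have "\<dots> = epow (ennreal C1) P * csum (\<lambda>k. epow (b k) (P - Q) * (\<integral>\<^sup>+x. epow (f k x) Q \<partial>M))"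
        by (subst nn_integral_cmult) (simp_all add: nn_integral_count_space_nn_integral nn_integral_cmult)
      also have "\<dots> \<le> epow (ennreal C1) P * csum (\<lambda>k. epow (b k) (P - Q) * (ennreal (2 powr (- real k)) * epow (b k) Q))"
      proof (intro mult_left_mono nn_integral_mono)
        fix k
        have "(\<integral>\<^sup>+x. epow (f k x) Q \<partial>M) \<le> ennreal (2 powr (- real k)) * epow (a k) Q" by (rule fQ)
        also have "\<dots> \<le> ennreal (2 powr (- real k)) * epow (b k) Q"
          using assms by (intro mult_left_mono epow_mono ab) auto
        finally show "(\<integral>\<^sup>+x. epow (f k x) Q \<partial>M) \<le> ennreal (2 powr (- real k)) * epow (b k) Q" .
      qed auto
      also have "\<dots> = epow (ennreal C1) P * csum (\<lambda>k. epow (ennreal (2 powr (- real k / P)) * b k) P)"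
      proof -
        have "epow (b k) (P - Q) * (ennreal (2 powr (- real k)) * epow (b k) Q) =
            epow (ennreal (2 powr (- real k / P)) * b k) P" for k
        proof -
          have "epow (ennreal (2 powr (- real k / P)) * b k) P = ennreal (2 powr (- real k)) * epow (b k) P"
            using assms by (simp add: epow_mult epow_ennreal powr_powr)
          also have "epow (b k) P = epow (b k) (P - Q) * epow (b k) Q"
            using epow_add[of "b k" "P - Q" Q] by simp
          finally show ?thesis by (simp only: mult.left_commute)
        qed
        then show ?thesis by simp
      qed
      finally have "lpn M P (\<lambda>x. csum (\<lambda>k. f k x)) \<le>
         epow (epow (ennreal C1) P * csum (\<lambda>k. epow (ennreal (2 powr (- real k / P)) * b k) P)) (1 / P)"
        unfolding lpn_def using assms by (intro epow_mono) auto
      also have "\<dots> = ennreal C1 * cln P (\<lambda>k. ennreal (2 powr (- real k / P)) * b k)"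
        using assms by (simp add: epow_mult epow_epow lpn_def)
      also have "cln P (\<lambda>k. ennreal (2 powr (- real k / P)) * b k) \<le>
         2 * (csum (\<lambda>d. ennreal (r ^ d)) * cln P ?a')"
      proof -
        have eq: "ennreal (2 powr (- real k / P)) * b k =
          csum (\<lambda>d. ennreal (r ^ d) * (if k \<in> {d..} then ?a' (k - d) else 0))" for k
        proof -
          have "csum (\<lambda>d. ennreal (r ^ d) * (if k \<in> {d..} then ?a' (k - d) else 0)) =
            (\<Sum>d\<le>k. ennreal (r ^ d) * (if k \<in> {d..} then ?a' (k - d) else 0))"
            by (rule nn_integral_count_space') auto
          also have "\<dots> = (\<Sum>d\<le>k. ennreal (2 powr (- real k / P)) * (ennreal (2 powr (e * d)) * a (k - d)))"
          proof (intro sum.cong refl)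
            fix d assume d: "d \<in> {..k}"
            have "r ^ d * 2 powr (- real (k - d) / P) = 2 powr (- e * d) * 2 powr (- real (k - d) / P)"
              by (simp add: r_def powr_realpow[symmetric] powr_powr)
            also have "\<dots> = 2 powr (- real k / P) * 2 powr (e * d)"
            proof -
              have "x / P = x * (2 * e)" for x using assms by (simp add: e_def)
              then have "- e * d + - real (k - d) / P = - real k / P + e * d"
                using d by (simp only:) (simp add: of_nat_diff algebra_simps)
              then show ?thesis by (simp only: powr_add[symmetric])
            qed
            finally have rd: "r ^ d * 2 powr (- real (k - d) / P) = 2 powr (- real k / P) * 2 powr (e * d)" .
            then show "ennreal (r ^ d) * (if k \<in> {d..} then ?a' (k - d) else 0) =
              ennreal (2 powr (- real k / P)) * (ennreal (2 powr (e * d)) * a (k - d))"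
            proof -
              have "ennreal (r ^ d) * ennreal (2 powr (- real (k - d) / P)) =
                  ennreal (2 powr (- real k / P)) * ennreal (2 powr (e * d))"
                using rd r by (metis ennreal_mult less_imp_le powr_ge_zero zero_le_power)
              then show ?thesis
                using d by (simp only: if_True atLeast_iff atMost_iff mult.assoc[symmetric])
            qed
          qed
          finally show ?thesis by (simp add: b_def sum_distrib_left)
        qed
        show ?thesis unfolding eq
        proof (rule cln_weighted_sum_le)
          fix d :: nat
          show "cln P (\<lambda>k. if k \<in> {d..} then ?a' (k - d) else 0) \<le> cln P ?a'"
            using assms by (intro cln_inj_le[of "\<lambda>k. k - d" "{d..}" P ?a']) (auto simp: inj_on_def)
        qed (use assms in auto)
      qed
      also have "csum (\<lambda>d. ennreal (r ^ d)) = ennreal (1 / (1 - r))"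
        using r by (simp add: nn_integral_count_space_nat suminf_ennreal2 suminf_geometric summable_geometric)
      also have "ennreal C1 * (2 * (ennreal (1 / (1 - r)) * cln P ?a')) = ennreal C * cln P ?a'"
      proof -
        have "ennreal C = ennreal C1 * (ennreal 2 * ennreal (1 / (1 - r)))"
          unfolding C_def using C1 by (simp only: ennreal_mult' less_imp_le zero_le_numeral)
        then show ?thesis by (simp only: mult.assoc) simp
      qed
      finally show ?thesis by (simp add: mult_left_mono)
    qed
  qed
qed

section \<open>The one-dimensional inequality\<close>

definition tp :: "real \<Rightarrow> ennreal" where
  "tp x = ennreal (2 powr x)"

lemma tp_add: "tp a * tp b = tp (a + b)"
  by (simp add: tp_def ennreal_mult[symmetric] powr_add)

lemma tp_add_left: "tp a * (tp b * x) = tp (a + b) * x"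
  by (simp add: tp_add mult.assoc[symmetric])

lemma tp_0 [simp]: "tp 0 = 1"
  by (simp add: tp_def)

lemma tp_neq [simp]: "tp a \<noteq> 0" "tp a \<noteq> top"
  by (simp_all add: tp_def)

lemma epow_tp: "epow (tp a) b = tp (a * b)"
  by (simp add: tp_def epow_ennreal powr_powr)

lemma tp_mono: "a \<le> b \<Longrightarrow> tp a \<le> tp b"
  by (simp add: tp_def)

text \<open>\<open>herz_norm\<close> for finite exponents, over Borel instead of completed Lebesgue
  measure, so that Borel measurability and Fubini's theorem apply directly.
  \<open>herz_norm_eq_hz\<close> identifies the two.\<close>

definition hz :: "real \<Rightarrow> real \<Rightarrow> real \<Rightarrow> (real \<Rightarrow> ennreal) \<Rightarrow> ennreal" where
  "hz P A R g = cln R (\<lambda>k::int. tp (of_int k * A) * lpn lborel P (\<lambda>t. g t * indicator (annulus k) t))"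

text \<open>\<open>tp k\<close> is the \<open>L^1\<close> normalisation of the dilation by
  \<open>2^k\<close>.\<close>

definition ker :: "real \<Rightarrow> nat \<Rightarrow> real \<Rightarrow> ennreal" where
  "ker M k s = tp k * ennreal ((1 + 2 ^ k * \<bar>s\<bar>) powr (- M))"

lemma borel_measurable_ker [measurable]: "ker M k \<in> borel_measurable borel"
  unfolding ker_def by measurable

lemma annulus_eq: "annulus k = {t. 2 powr (of_int k - 1) \<le> \<bar>t\<bar> \<and> \<bar>t\<bar> < 2 powr (of_int k)}"
proof -
  have "2 powi m = 2 powr real_of_int m" for m :: int by (simp add: powr_real_of_int')
  then show ?thesis by (simp add: annulus_def)
qed

lemma annulus_measurable [measurable]: "annulus k \<in> sets borel"
  unfolding annulus_eq by measurable

lemma emeasure_annulus: "emeasure lborel (annulus k) = tp (of_int k)"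
proof -
  define a where "a = 2 powr (of_int k - 1 :: real)"
  have b: "2 powr (of_int k) = 2 * a" by (simp add: a_def powr_diff)
  have a: "0 < a" by (simp add: a_def)
  have "annulus k = {- (2 * a)<..-a} \<union> {a..<2 * a}"
    unfolding annulus_eq b a_def[symmetric] using a by auto
  moreover have "{- (2 * a)<..-a} \<inter> {a..<2 * a} = {}" using a by auto
  ultimately have "emeasure lborel (annulus k) = emeasure lborel {- (2 * a)<..-a} + emeasure lborel {a..<2 * a}"
    using plus_emeasure[of "{- (2 * a)<..-a}" lborel "{a..<2 * a}"] by simp
  also have "\<dots> = tp (of_int k)" using a by (simp add: tp_def b ennreal_plus[symmetric] del: ennreal_plus)
  finally show ?thesis .
qed

lemma annulus_unique:
  assumes "y \<noteq> 0"
  shows "\<exists>l. \<forall>k. y \<in> annulus k \<longleftrightarrow> k = l"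
proof (intro exI allI)
  fix k
  have "y \<in> annulus k \<longleftrightarrow> of_int k - 1 \<le> log 2 \<bar>y\<bar> \<and> log 2 \<bar>y\<bar> < of_int k"
    using assms by (simp add: annulus_eq le_log_iff log_less_iff)
  then show "y \<in> annulus k \<longleftrightarrow> k = \<lfloor>log 2 \<bar>y\<bar>\<rfloor> + 1"
    by linarith
qed

lemma csum_single: "csum (\<lambda>i. if i = j then f i else 0) = f j"
proof -
  have "csum (\<lambda>i. if i = j then f i else 0) = csum (\<lambda>i. f i * indicator {j} i)"
    by (intro nn_integral_cong) (auto split: split_indicator)
  then show ?thesis by (simp add: nn_integral_indicator_singleton)
qed

lemma nn_integral_csum_annulus:
  assumes [measurable]: "f \<in> borel_measurable borel"
  shows "(\<integral>\<^sup>+y. f y \<partial>lborel) = csum (\<lambda>l. \<integral>\<^sup>+y. f y * indicator (annulus l) y \<partial>lborel)"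
proof -
  have "AE y in lborel. y \<noteq> (0::real)" by (rule AE_lborel_singleton)
  then have "AE y in lborel. f y = csum (\<lambda>l. f y * indicator (annulus l) y)"
  proof eventually_elim
    case (elim y)
    then obtain l where l: "\<And>k. y \<in> annulus k \<longleftrightarrow> k = l" using annulus_unique by blast
    have "csum (\<lambda>k. f y * indicator (annulus k) y) = csum (\<lambda>k. if k = l then f y else 0)"
      by (intro nn_integral_cong) (auto simp: l)
    then show ?case by (simp add: csum_single)
  qed
  then have "(\<integral>\<^sup>+y. f y \<partial>lborel) = (\<integral>\<^sup>+y. csum (\<lambda>l. f y * indicator (annulus l) y) \<partial>lborel)"
    by (rule nn_integral_cong_AE)
  then show ?thesis by (simp add: nn_integral_count_space_nn_integral)
qed

lemma nn_integral_decay_le: "(\<integral>\<^sup>+s. ennreal ((1 + \<bar>s\<bar>) powr (- 2)) \<partial>lborel) \<le> 2"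
proof -
  let ?g = "\<lambda>s::real. ennreal ((1 + \<bar>s\<bar>) powr (- 2))"
  have half: "(\<integral>\<^sup>+s. ?g s * indicator {0..} s \<partial>lborel) = 1"
  proof -
    have "(\<integral>\<^sup>+s. ?g s * indicator {0..} s \<partial>lborel) =
        (\<integral>\<^sup>+s. ennreal (1 / (1 + s)\<^sup>2) * indicator {0..} s \<partial>lborel)"
      by (intro nn_integral_cong) (auto split: split_indicator simp: powr_minus_divide powr_realpow)
    also have "\<dots> = ennreal (0 - (- 1 / (1 + 0)))"
    proof (rule nn_integral_FTC_atLeast[where F="\<lambda>s. - 1 / (1 + s)"])
      show "(\<lambda>x::real. 1 / (1 + x)\<^sup>2) \<in> borel_measurable borel" by measurable
      show "((\<lambda>s. - 1 / (1 + s)) \<longlongrightarrow> (0::real)) at_top"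
      proof -
        have "filterlim (\<lambda>s::real. 1 + s) at_infinity at_top"
          by (intro filterlim_at_top_imp_at_infinity filterlim_tendsto_add_at_top[OF tendsto_const filterlim_ident])
        from tendsto_minus[OF tendsto_divide_0[OF tendsto_const this, of 1]] show ?thesis by simp
      qed
      fix x :: real assume "0 \<le> x"
      then show "((\<lambda>s. - 1 / (1 + s)) has_real_derivative 1 / (1 + x)\<^sup>2) (at x)"
        by (auto intro!: derivative_eq_intros simp: power2_eq_square)
    qed auto
    finally show ?thesis by simp
  qed
  have "(\<integral>\<^sup>+s. ?g s \<partial>lborel) \<le> (\<integral>\<^sup>+s. ?g s * indicator {0..} s + ?g (- s) * indicator {0..} (- s) \<partial>lborel)"
    by (intro nn_integral_mono) (auto split: split_indicator)
  also have "\<dots> = (\<integral>\<^sup>+s. ?g s * indicator {0..} s \<partial>lborel) + (\<integral>\<^sup>+s. ?g (- s) * indicator {0..} (- s) \<partial>lborel)"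
    by (rule nn_integral_add) measurable
  also have "(\<integral>\<^sup>+s. ?g (- s) * indicator {0..} (- s) \<partial>lborel) = (\<integral>\<^sup>+s. ?g s * indicator {0..} s \<partial>lborel)"
    using nn_integral_real_affine[of "\<lambda>s. ?g s * indicator {0..} s" "-1" 0] by simp
  finally show ?thesis by (simp add: half)
qed

lemma nn_integral_ker_le:
  assumes "2 \<le> M"
  shows "(\<integral>\<^sup>+y. ker M k (t - y) \<partial>lborel) \<le> 2" and "(\<integral>\<^sup>+t. ker M k (t - y) \<partial>lborel) \<le> 2"
proof -
  have le: "ker M k s \<le> tp k * ennreal ((1 + \<bar>2 ^ k * s\<bar>) powr (- 2))" for s
    unfolding ker_def abs_mult using assms by (intro mult_left_mono ennreal_leI) (auto intro!: powr_mono)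
  have base: "(\<integral>\<^sup>+s. ker M k s \<partial>lborel) \<le> 2"
  proof -
    have "(\<integral>\<^sup>+s. ker M k s \<partial>lborel) \<le> (\<integral>\<^sup>+s. tp k * ennreal ((1 + \<bar>2 ^ k * s\<bar>) powr (- 2)) \<partial>lborel)"
      by (intro nn_integral_mono le)
    also have "\<dots> = ennreal \<bar>2 ^ k\<bar> * (\<integral>\<^sup>+s. ennreal ((1 + \<bar>0 + 2 ^ k * s\<bar>) powr (- 2)) \<partial>lborel)"
      by (subst nn_integral_cmult) (auto simp: tp_def powr_realpow)
    also have "\<dots> = (\<integral>\<^sup>+s. ennreal ((1 + \<bar>s\<bar>) powr (- 2)) \<partial>lborel)"
      by (rule nn_integral_real_affine[symmetric]) auto
    finally show ?thesis using nn_integral_decay_le by simp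
  qed
  have "(\<integral>\<^sup>+y. ker M k (t - y) \<partial>lborel) = (\<integral>\<^sup>+s. ker M k s \<partial>lborel)"
    using nn_integral_real_affine[of "ker M k" "-1" t] by simp
  then show "(\<integral>\<^sup>+y. ker M k (t - y) \<partial>lborel) \<le> 2" using base by simp
  have "(\<integral>\<^sup>+t. ker M k (t - y) \<partial>lborel) = (\<integral>\<^sup>+s. ker M k s \<partial>lborel)"
    using nn_integral_real_affine[of "ker M k" "1" "-y"] by simp
  then show "(\<integral>\<^sup>+t. ker M k (t - y) \<partial>lborel) \<le> 2" using base by simp
qed

section \<open>Convolution estimates between two annuli\<close>

definition piece :: "real \<Rightarrow> nat \<Rightarrow> int \<Rightarrow> (real \<Rightarrow> ennreal) \<Rightarrow> real \<Rightarrow> ennreal" where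
  "piece M k l g t = (\<integral>\<^sup>+y. ker M k (t - y) * (g y * indicator (annulus l) y) \<partial>lborel)"

lemma borel_measurable_piece [measurable]:
  assumes [measurable]: "g \<in> borel_measurable borel"
  shows "piece M k l g \<in> borel_measurable borel"
  unfolding piece_def by measurable

text \<open>Adjacent annuli touch, hence the gap of two; the distance is then at least half of the
  inner radius of the outer annulus.\<close>

lemma annulus_separated:
  assumes "u \<in> annulus a" "v \<in> annulus b" "a + 2 \<le> b"
  shows "2 powr (of_int b - 2) \<le> \<bar>u - v\<bar>"
proof -
  have "2 powr (of_int b - 1) \<le> \<bar>v\<bar>" "\<bar>u\<bar> < 2 powr (of_int a)"
    using assms by (auto simp: annulus_eq)
  moreover have "2 powr (of_int a) \<le> 2 powr (of_int b - 2 :: real)" using assms by simp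
  moreover have "2 powr (of_int b - 1 :: real) = 2 * 2 powr (of_int b - 2)"
    by (simp add: powr_diff)
  ultimately show ?thesis by linarith
qed

lemma ker_far_le:
  assumes t: "t \<in> annulus j" and y: "y \<in> annulus l" and "2 \<le> \<bar>l - j\<bar> \<or> j + int k \<le> 0" and "0 \<le> M"
  shows "ker M k (t - y) \<le> tp (k + 2 * M - M * of_int (max 0 (max (j + int k) (l + int k))))"
proof -
  define m where "m = max 0 (max (j + int k) (l + int k))"
  have "2 powr (of_int m - 2) \<le> 1 + 2 ^ k * \<bar>t - y\<bar>"
  \<comment> \<open>Neighbouring annuli with \<open>j + k <= 0\<close> have \<open>m <= 1\<close>
    and so fall under the trivial case. The loss \<open>2 * M\<close> in the exponent pays for this
    case and for the constant \<open>2^(-2)\<close> in the separation.\<close>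
  proof (cases "m \<le> 2")
    case True
    then have "2 powr (of_int m - 2 :: real) \<le> 2 powr 0" by (intro powr_mono) auto
    then show ?thesis by (simp add: add_increasing2)
  next
    case False
    then have far: "2 \<le> \<bar>l - j\<bar>" using assms(3) by (auto simp: m_def)
    have "2 powr (of_int (max j l) - 2) \<le> \<bar>t - y\<bar>"
    proof (cases "j < l")
      case True
      then show ?thesis using annulus_separated[OF t y] far by auto
    next
      case False
      then show ?thesis using annulus_separated[OF y t] far by (auto simp: abs_minus_commute max_def)
    qed
    then have "2 ^ k * 2 powr (of_int (max j l) - 2) \<le> 2 ^ k * \<bar>t - y\<bar>" by simp
    moreover have "m = max j l + int k" using False by (auto simp: m_def)
    then have "2 powr (of_int m - 2 :: real) = 2 ^ k * 2 powr (of_int (max j l) - 2)"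
      by (simp add: powr_realpow[symmetric] powr_add[symmetric] algebra_simps)
    ultimately show ?thesis by linarith
  qed
  then have "(1 + 2 ^ k * \<bar>t - y\<bar>) powr (- M) \<le> (2 powr (of_int m - 2)) powr (- M)"
    using assms by (intro powr_mono2') auto
  also have "\<dots> = 2 powr (2 * M - M * of_int m)" by (simp add: powr_powr algebra_simps)
  finally have "ker M k (t - y) \<le> tp k * tp (2 * M - M * of_int m)"
    unfolding ker_def tp_def[of "2 * M - M * of_int m"] by (intro mult_left_mono ennreal_leI) auto
  then show ?thesis by (simp add: tp_add m_def algebra_simps)
qed

lemma nn_integral_annulus_le:
  assumes [measurable]: "g \<in> borel_measurable borel" and "1 \<le> Q"
  shows "(\<integral>\<^sup>+y. g y * indicator (annulus l) y \<partial>lborel) \<le>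
    2 * (tp (of_int l * (1 - 1/Q)) * lpn lborel Q (\<lambda>y. g y * indicator (annulus l) y))"
proof -
  have "(\<integral>\<^sup>+y. g y * indicator (annulus l) y \<partial>lborel) =
      (\<integral>\<^sup>+y. indicator (annulus l) y * (g y * indicator (annulus l) y) \<partial>lborel)"
    by (intro nn_integral_cong) (auto split: split_indicator)
  also have "\<dots> \<le> 2 * (epow (\<integral>\<^sup>+y. indicator (annulus l) y \<partial>lborel) (1 - 1/Q) *
      epow (\<integral>\<^sup>+y. indicator (annulus l) y * epow (g y * indicator (annulus l) y) Q \<partial>lborel) (1/Q))"
    using assms by (intro nn_integral_weighted_le) auto
  also have "(\<integral>\<^sup>+y. indicator (annulus l) y * epow (g y * indicator (annulus l) y) Q \<partial>lborel) =
      (\<integral>\<^sup>+y. epow (g y * indicator (annulus l) y) Q \<partial>lborel)"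
    by (intro nn_integral_cong) (auto split: split_indicator)
  finally show ?thesis by (simp add: emeasure_annulus epow_tp lpn_def)
qed

lemma piece_far_le:
  assumes [measurable]: "g \<in> borel_measurable borel" and "1 \<le> Q" "0 \<le> M"
    and t: "t \<in> annulus j" and far: "2 \<le> \<bar>l - j\<bar> \<or> j + int k \<le> 0"
  shows "piece M k l g t \<le> 2 * (tp (k + 2 * M - M * of_int (max 0 (max (j + int k) (l + int k))) + of_int l * (1 - 1/Q)) *
     lpn lborel Q (\<lambda>y. g y * indicator (annulus l) y))"
proof -
  let ?c = "tp (k + 2 * M - M * of_int (max 0 (max (j + int k) (l + int k))))"
  have "piece M k l g t \<le> (\<integral>\<^sup>+y. ?c * (g y * indicator (annulus l) y) \<partial>lborel)"
    unfolding piece_def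
  proof (intro nn_integral_mono)
    fix y
    show "ker M k (t - y) * (g y * indicator (annulus l) y) \<le> ?c * (g y * indicator (annulus l) y)"
      using ker_far_le[OF t _ far \<open>0 \<le> M\<close>, of y]
      by (cases "y \<in> annulus l") (auto intro: mult_right_mono)
  qed
  also have "\<dots> = ?c * (\<integral>\<^sup>+y. g y * indicator (annulus l) y \<partial>lborel)"
    by (rule nn_integral_cmult) measurable
  also have "\<dots> \<le> ?c * (2 * (tp (of_int l * (1 - 1/Q)) * lpn lborel Q (\<lambda>y. g y * indicator (annulus l) y)))"
    using assms by (intro mult_left_mono nn_integral_annulus_le) auto
  also have "\<dots> = 2 * (?c * (tp (of_int l * (1 - 1/Q)) * lpn lborel Q (\<lambda>y. g y * indicator (annulus l) y)))"
    by (simp only: mult.left_commute)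
  finally show ?thesis by (simp only: tp_add_left)
qed

lemma two_epow_le: "0 \<le> a \<Longrightarrow> a \<le> 1 \<Longrightarrow> epow 2 a \<le> 2"
proof -
  assume a: "0 \<le> a" "a \<le> 1"
  have "epow (ennreal 2) a = ennreal (2 powr a)" by (rule epow_ennreal) simp
  also have "2 powr a \<le> 2 powr 1" using a by (intro powr_mono) auto
  then have "ennreal (2 powr a) \<le> ennreal 2" by (intro ennreal_leI) simp
  finally show ?thesis by simp
qed

text \<open>Hoelder's inequality for the measure with density \<open>ker\<close>, of mass at most 2.
  The remaining integral gives both endpoints of the interpolation: bounding the kernel by
  \<open>tp k\<close> yields the supremum, and integrating in \<open>t\<close> yields the
  \<open>L^Q\<close> norm.\<close>

lemma piece_Hoelder:
  assumes [measurable]: "g \<in> borel_measurable borel" and Q: "1 \<le> Q" and M: "2 \<le> M"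
  shows "piece M k l g t \<le> 2 * (epow 2 (1 - 1/Q) *
    epow (\<integral>\<^sup>+y. ker M k (t - y) * epow (g y * indicator (annulus l) y) Q \<partial>lborel) (1/Q))"
proof -
  have "piece M k l g t \<le> 2 * (epow (\<integral>\<^sup>+y. ker M k (t - y) \<partial>lborel) (1 - 1/Q) *
      epow (\<integral>\<^sup>+y. ker M k (t - y) * epow (g y * indicator (annulus l) y) Q \<partial>lborel) (1/Q))"
    unfolding piece_def using Q by (intro nn_integral_weighted_le) auto
  also have "\<dots> \<le> 2 * (epow 2 (1 - 1/Q) *
      epow (\<integral>\<^sup>+y. ker M k (t - y) * epow (g y * indicator (annulus l) y) Q \<partial>lborel) (1/Q))"
    using Q M by (intro mult_left_mono mult_right_mono epow_mono nn_integral_ker_le) auto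
  finally show ?thesis .
qed

lemma piece_sup_le:
  assumes [measurable]: "g \<in> borel_measurable borel" and Q: "1 \<le> Q" and M: "2 \<le> M"
  shows "piece M k l g t \<le> 4 * (tp (k / Q) * lpn lborel Q (\<lambda>y. g y * indicator (annulus l) y))"
proof -
  have kle: "ker M k s \<le> tp k * 1" for s
  proof -
    have "(1 + 2 ^ k * \<bar>s\<bar>) powr (- M) \<le> (1 + 2 ^ k * \<bar>s\<bar>) powr 0"
      using M by (intro powr_mono) auto
    moreover have "0 < 1 + 2 ^ k * \<bar>s\<bar>" by (simp add: add_pos_nonneg)
    ultimately show ?thesis
      unfolding ker_def by (intro mult_left_mono) (auto simp: ennreal_le_1)
  qed
  have "piece M k l g t \<le> 2 * (epow 2 (1 - 1/Q) *
    epow (\<integral>\<^sup>+y. ker M k (t - y) * epow (g y * indicator (annulus l) y) Q \<partial>lborel) (1/Q))"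
    by (rule piece_Hoelder) (use assms in auto)
  also have "\<dots> \<le> 2 * (2 * epow (\<integral>\<^sup>+y. tp k * epow (g y * indicator (annulus l) y) Q \<partial>lborel) (1/Q))"
    using Q kle by (intro mult_left_mono mult_mono two_epow_le epow_mono nn_integral_mono mult_right_mono) auto
  also have "(\<integral>\<^sup>+y. tp k * epow (g y * indicator (annulus l) y) Q \<partial>lborel) =
      tp k * (\<integral>\<^sup>+y. epow (g y * indicator (annulus l) y) Q \<partial>lborel)"
    by (rule nn_integral_cmult) measurable
  also have "2 * (2 * epow (tp k * (\<integral>\<^sup>+y. epow (g y * indicator (annulus l) y) Q \<partial>lborel)) (1/Q)) =
      4 * (tp (k / Q) * lpn lborel Q (\<lambda>y. g y * indicator (annulus l) y))"
    by (simp add: epow_mult epow_tp lpn_def mult.assoc[symmetric])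
  finally show ?thesis .
qed

lemma piece_LQ_le:
  assumes [measurable]: "g \<in> borel_measurable borel" and Q: "1 \<le> Q" and M: "2 \<le> M"
  shows "(\<integral>\<^sup>+t. epow (piece M k l g t) Q \<partial>lborel) \<le> epow (4 * lpn lborel Q (\<lambda>y. g y * indicator (annulus l) y)) Q"
proof -
  let ?G = "\<lambda>y. epow (g y * indicator (annulus l) y) Q"
  have "(\<integral>\<^sup>+t. epow (piece M k l g t) Q \<partial>lborel) \<le>
    (\<integral>\<^sup>+t. epow (2 * (epow 2 (1 - 1/Q) * epow (\<integral>\<^sup>+y. ker M k (t - y) * ?G y \<partial>lborel) (1/Q))) Q \<partial>lborel)"
    using Q by (intro nn_integral_mono epow_mono piece_Hoelder M) auto
  also have "\<dots> = (\<integral>\<^sup>+t. epow 2 Q * epow 2 (Q - 1) * (\<integral>\<^sup>+y. ker M k (t - y) * ?G y \<partial>lborel) \<partial>lborel)"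
    using Q by (simp add: epow_mult epow_epow left_diff_distrib mult.assoc)
  also have "\<dots> = epow 2 Q * epow 2 (Q - 1) * (\<integral>\<^sup>+t. (\<integral>\<^sup>+y. ker M k (t - y) * ?G y \<partial>lborel) \<partial>lborel)"
    by (rule nn_integral_cmult) measurable
  also have "(\<integral>\<^sup>+t. (\<integral>\<^sup>+y. ker M k (t - y) * ?G y \<partial>lborel) \<partial>lborel) =
      (\<integral>\<^sup>+y. (\<integral>\<^sup>+t. ker M k (t - y) * ?G y \<partial>lborel) \<partial>lborel)"
    by (rule lborel_pair.Fubini') measurable
  also have "\<dots> = (\<integral>\<^sup>+y. (\<integral>\<^sup>+t. ker M k (t - y) \<partial>lborel) * ?G y \<partial>lborel)"
    by (intro nn_integral_cong nn_integral_multc) measurable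
  also have "\<dots> \<le> (\<integral>\<^sup>+y. 2 * ?G y \<partial>lborel)"
    using M by (intro nn_integral_mono mult_right_mono nn_integral_ker_le) auto
  also have "\<dots> = 2 * (\<integral>\<^sup>+y. ?G y \<partial>lborel)" by (rule nn_integral_cmult) measurable
  finally have "(\<integral>\<^sup>+t. epow (piece M k l g t) Q \<partial>lborel) \<le>
    epow 2 Q * epow 2 (Q - 1) * (2 * (\<integral>\<^sup>+y. ?G y \<partial>lborel))" by (simp add: mult_left_mono)
  also have "\<dots> = epow (2 * 2) Q * (\<integral>\<^sup>+y. ?G y \<partial>lborel)"
    using epow_add[of 2 "Q - 1" 1] by (simp only: epow_mult) (simp add: mult.assoc)
  also have "\<dots> = epow (4 * lpn lborel Q (\<lambda>y. g y * indicator (annulus l) y)) Q"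
    using Q by (simp add: epow_mult epow_lpn)
  finally show ?thesis .
qed

lemma lpn_add_le:
  assumes [measurable]: "f \<in> borel_measurable M" "g \<in> borel_measurable M" and "1 \<le> p"
  shows "lpn M p (\<lambda>x. f x + g x) \<le> 2 * (lpn M p f + lpn M p g)"
proof -
  have "lpn M p (\<lambda>x. csum (\<lambda>b. if b then f x else g x)) \<le> 2 * csum (\<lambda>b. lpn M p (\<lambda>x. if b then f x else g x))"
    using assms by (intro lpn_csum_le) auto
  then show ?thesis by (simp add: nn_integral_count_space_finite UNIV_bool add.commute)
qed

lemma csum_tp_decay:
  assumes "0 < e"
  shows "csum (\<lambda>i::int. tp (- e * \<bar>of_int i\<bar>)) \<noteq> top"
proof -
  define r where "r = 2 powr (- e)"
  have r: "0 < r" "r < 1" using assms by (auto simp: r_def powr_less_one)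
  have r_eq: "tp (- e * real n) = ennreal (r ^ n)" for n
    by (simp add: tp_def r_def powr_realpow[symmetric] powr_powr)
  have fin: "csum (\<lambda>n::nat. tp (- e * real n)) = ennreal (1 / (1 - r))"
    unfolding r_eq using r
    by (simp add: nn_integral_count_space_nat suminf_ennreal2 suminf_geometric summable_geometric)
  have "csum (\<lambda>i::int. tp (- e * \<bar>of_int i\<bar>)) \<le>
    csum (\<lambda>i::int. (if i \<in> {0..} then tp (- e * real (nat i)) else 0) + (if i \<in> {..0} then tp (- e * real (nat (- i))) else 0))"
    by (intro nn_integral_mono) auto
  also have "\<dots> = csum (\<lambda>i::int. if i \<in> {0..} then tp (- e * real (nat i)) else 0) +
      csum (\<lambda>i::int. if i \<in> {..0} then tp (- e * real (nat (- i))) else 0)"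
    by (rule nn_integral_add) auto
  also have "\<dots> \<le> csum (\<lambda>n. tp (- e * real n)) + csum (\<lambda>n. tp (- e * real n))"
    by (intro add_mono csum_inj_le[where g="\<lambda>n. tp (- e * real n)"]) (auto simp: inj_on_def)
  finally show ?thesis unfolding fin by (auto simp: top_unique simp flip: ennreal_plus)
qed

text \<open>A negative number among \<open>J\<close>, \<open>L\<close> decays by its own coefficient
  \<open>\<mu>\<close> or \<open>\<rho>\<close>; a positive one is at most the maximum and is paid
  for by the kernel. The lower bound on \<open>M\<close> covers both payments, with 1/2 to spare for
  each to produce the decay at rate \<open>e\<close>.\<close>

lemma far_exponent_le:
  fixes J L :: real
  assumes "0 < e" "e \<le> \<mu>" "e \<le> \<rho>" "e \<le> 1/2" "\<mu> + \<rho> + 1 \<le> M"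
  shows "J * \<mu> + L * \<rho> - M * max 0 (max J L) \<le> - e * (\<bar>J\<bar> + \<bar>L\<bar>)"
proof -
  define m where "m = max 0 (max J L)"
  have m: "0 \<le> m" "J \<le> m" "L \<le> m" by (auto simp: m_def)
  have max_eq: "m * (\<mu> + \<rho> + 1) \<le> m * M" using assms m by (intro mult_left_mono) auto
  have pos: "x * \<nu> \<le> - e * \<bar>x\<bar> + m * (\<nu> + 1/2)" if "x \<le> m" "e \<le> \<nu>" for x \<nu>
  proof (cases "x \<le> 0")
    case True
    then have "x * \<nu> \<le> x * e" using that by (intro mult_left_mono_neg) auto
    moreover have "0 \<le> m * (\<nu> + 1/2)" using that m assms by (intro mult_nonneg_nonneg) auto
    ultimately show ?thesis using True by (simp add: mult.commute)
  next
    case False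
    have "x * (\<nu> + e) \<le> m * (\<nu> + 1/2)" using False that assms by (intro mult_mono) auto
    then show ?thesis using False by (simp add: algebra_simps)
  qed
  have "J * \<mu> + L * \<rho> \<le> - e * \<bar>J\<bar> + m * (\<mu> + 1/2) + (- e * \<bar>L\<bar> + m * (\<rho> + 1/2))"
    using m assms by (intro add_mono pos) auto
  then show ?thesis using max_eq by (simp add: m_def[symmetric] algebra_simps)
qed

text \<open>These are the parameters after raising to the small power, so \<open>P\<close>,
  \<open>Q\<close>, \<open>R\<close> are at least 1, and \<open>0 < 1 - 1/Q - A2\<close> makes
  functions with finite source norm integrable near the origin. \<open>D\<close> is the summation
  exponent over the frequencies, and \<open>M\<close> the kernel decay demanded by
  \<open>far_exponent_le\<close>.\<close>

locale herz_exponents =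
  fixes P Q R D A1 A2 t1 t2 M :: real
  assumes Q: "1 \<le> Q" and QP: "Q < P" and R: "1 \<le> R" and D: "0 < D" "D \<le> R"
    and D_cases: "D \<le> P \<or> A1 < A2" and A_le: "A1 \<le> A2"
    and A1: "0 < A1 + 1/P" and A2: "0 < 1 - 1/Q - A2"
    and diff_eq: "t1 - 1/P - A1 = t2 - 1/Q - A2"
    and M: "2 \<le> M" "(A1 + 1/P) + (1 - 1/Q - A2) + 1 \<le> M"
begin

definition eps :: real where
  "eps = min (1/2) (min (A1 + 1/P) (1 - 1/Q - A2))"

lemma eps: "0 < eps" "eps \<le> A1 + 1/P" "eps \<le> 1 - 1/Q - A2" "eps \<le> 1/2"
  using A1 A2 unfolding eps_def min_def by auto

lemma P: "1 < P" using Q QP by simp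

text \<open>In the far case the kernel is essentially constant for arguments in the two annuli, and the terms decay
  geometrically in \<open>\<bar>j + k\<bar>\<close> and \<open>\<bar>l + k\<bar>\<close>. There is no such decay in the near case, for which
  \<open>interpolation_bound\<close> is needed.\<close>

definition far :: "int \<Rightarrow> int \<Rightarrow> nat \<Rightarrow> bool" where
  "far j l k \<longleftrightarrow> 2 \<le> \<bar>l - j\<bar> \<or> j + int k \<le> 0"

definition coef :: "(nat \<Rightarrow> real \<Rightarrow> ennreal) \<Rightarrow> nat \<Rightarrow> int \<Rightarrow> ennreal" where
  "coef h k l = tp (of_int l * A2) * lpn lborel Q (\<lambda>t. h k t * indicator (annulus l) t)"

definition far_part :: "(nat \<Rightarrow> real \<Rightarrow> ennreal) \<Rightarrow> int \<Rightarrow> real \<Rightarrow> ennreal" where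
  "far_part h j t = csum (\<lambda>k. csum (\<lambda>l. if far j l k then tp (k * t1) * piece M k l (h k) t else 0)) * indicator (annulus j) t"

definition near_part :: "(nat \<Rightarrow> real \<Rightarrow> ennreal) \<Rightarrow> int \<Rightarrow> int \<Rightarrow> real \<Rightarrow> ennreal" where
  "near_part h j d t = csum (\<lambda>k. if 0 < j + int k then tp (k * t1) * piece M k (j + d) (h k) t else 0) * indicator (annulus j) t"

lemma hz_coef: "hz Q A2 R (h k) = cln R (coef h k)"
  by (simp add: hz_def coef_def[abs_def])

text \<open>The bound of \<open>piece_far_le\<close> does not depend on \<open>t\<close>, so the
  \<open>L^P\<close> norm over the annulus only costs the factor \<open>2^(j/P)\<close>, from its
  measure.\<close>

lemma far_term_le:
  assumes [measurable]: "\<And>k. h k \<in> borel_measurable borel"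
  shows "tp (of_int j * A1) * lpn lborel P (\<lambda>t. (if far j l k then tp (k * t1) * piece M k l (h k) t else 0) * indicator (annulus j) t)
    \<le> 2 * tp (2 * M) * (tp (- eps * \<bar>of_int (j + int k)\<bar>) * (tp (- eps * \<bar>of_int (l + int k)\<bar>) * (tp (k * t2) * coef h k l)))"
    (is "_ * lpn lborel P ?f \<le> ?B")
proof (cases "far j l k")
  case True
  let ?m = "max 0 (max (j + int k) (l + int k))"
  let ?N = "lpn lborel Q (\<lambda>y. h k y * indicator (annulus l) y)"
  let ?e = "k + 2 * M - M * of_int ?m + of_int l * (1 - 1/Q)"
  have "lpn lborel P ?f \<le> lpn lborel P (\<lambda>t. (2 * (tp (k * t1 + ?e) * ?N)) * indicator (annulus j) t)"
  proof (intro lpn_mono)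
    fix t
    have "tp (k * t1) * piece M k l (h k) t \<le> tp (k * t1) * (2 * (tp ?e * ?N))" if "t \<in> annulus j"
      using True that Q M by (intro mult_left_mono piece_far_le[where j=j]) (auto simp: far_def)
    also have "tp (k * t1) * (2 * (tp ?e * ?N)) = 2 * (tp (k * t1 + ?e) * ?N)"
      by (simp only: mult.left_commute[of _ 2] tp_add_left)
    finally show "?f t \<le> (2 * (tp (k * t1 + ?e) * ?N)) * indicator (annulus j) t"
      using True by (auto split: split_indicator)
  qed (use P in auto)
  also have "\<dots> = 2 * (tp (k * t1 + ?e) * ?N) * tp (of_int j / P)"
  proof -
    have "lpn lborel P (indicator (annulus j)) = epow (\<integral>\<^sup>+t. indicator (annulus j) t \<partial>lborel) (1/P)"
    proof -
      have "epow (indicator (annulus j) t) P = indicator (annulus j) t" for t :: real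
        by (auto split: split_indicator)
      then show ?thesis by (simp add: lpn_def)
    qed
    then show ?thesis using P by (subst lpn_cmult) (auto simp: emeasure_annulus epow_tp)
  qed
  finally have "tp (of_int j * A1) * lpn lborel P ?f \<le> tp (of_int j * A1) * (2 * (tp (k * t1 + ?e) * ?N) * tp (of_int j / P))"
    by (intro mult_left_mono) auto
  also have "\<dots> = 2 * (tp (of_int j * A1 + of_int j / P + k * t1 + ?e) * ?N)"
  proof -
    have "tp (of_int j * A1) * (2 * (tp (k * t1 + ?e) * ?N) * tp (of_int j / P)) =
       2 * (tp (of_int j * A1) * (tp (of_int j / P) * (tp (k * t1 + ?e) * ?N)))"
      by (simp only: mult_ac)
    then show ?thesis by (simp only: tp_add_left add.assoc)
  qed
  also have "\<dots> \<le> 2 * (tp (2 * M + (- eps * \<bar>of_int (j + int k)\<bar> + (- eps * \<bar>of_int (l + int k)\<bar> + (k * t2 + of_int l * A2)))) * ?N)"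
  proof -
    \<comment> \<open>Because of \<open>diff_eq\<close>, everything beyond the source weights
      \<open>k * t2 + l * A2\<close> and the constant \<open>2 * M\<close> depends on
      \<open>j + k\<close> and \<open>l + k\<close> alone.\<close>
    define Z where "Z = (of_int (j + int k)) * (A1 + 1/P) + (of_int (l + int k)) * (1 - 1/Q - A2) - M * of_int ?m"
    have "Z \<le> - eps * (\<bar>of_int (j + int k)\<bar> + \<bar>of_int (l + int k)\<bar>)"
      using eps M unfolding Z_def of_int_max of_int_0 by (intro far_exponent_le) auto
    then have "Z \<le> - eps * \<bar>of_int (j + int k)\<bar> + - eps * \<bar>of_int (l + int k)\<bar>"
      by (simp only: distrib_left)
    moreover have "of_int j * A1 + of_int j / P + k * t1 + ?e = 2 * M + k * t2 + of_int l * A2 + Z"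
    proof -
      have "t1 = t2 - 1/Q - A2 + 1/P + A1" using diff_eq by simp
      then show ?thesis unfolding Z_def by (simp only:) (simp add: algebra_simps)
    qed
    ultimately have "of_int j * A1 + of_int j / P + k * t1 + ?e \<le>
        2 * M + (- eps * \<bar>of_int (j + int k)\<bar> + (- eps * \<bar>of_int (l + int k)\<bar> + (k * t2 + of_int l * A2)))"
      by linarith
    then show ?thesis by (intro mult_left_mono mult_right_mono tp_mono) auto
  qed
  also have "\<dots> = ?B" by (simp only: coef_def tp_add_left mult.assoc)
  finally show ?thesis .
qed (use P in \<open>simp add: lpn_def\<close>)

lemma csum_shift_int: "csum (\<lambda>l::int. f (l + c)) = csum f"
  by (rule nn_integral_bij_count_space) (auto intro!: bij_betwI[of _ _ _ "\<lambda>l. l - c"])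

definition decay_sum :: ennreal where
  "decay_sum = csum (\<lambda>i::int. tp (- eps * \<bar>of_int i\<bar>))"

lemma decay_sum: "decay_sum \<noteq> top"
  unfolding decay_sum_def using csum_tp_decay[OF eps(1)] .

text \<open>Reindexed by \<open>i = j + k\<close>, the sum is a superposition of reflected
  translates of \<open>y\<close>, to which Young's inequality applies.\<close>

lemma cln_nat_to_int_convolution_le:
  "cln R (\<lambda>j::int. csum (\<lambda>k::nat. tp (- eps * \<bar>of_int (j + int k)\<bar>) * y k)) \<le> 2 * (decay_sum * cln R y)"
proof -
  let ?y = "\<lambda>i j. if j \<in> {..i} then y (nat (i - j)) else 0"
  have "cln R (\<lambda>j::int. csum (\<lambda>k::nat. tp (- eps * \<bar>of_int (j + int k)\<bar>) * y k)) \<le>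
     cln R (\<lambda>j::int. csum (\<lambda>i. tp (- eps * \<bar>of_int i\<bar>) * ?y i j))"
  proof (intro lpn_mono)
    fix j :: int
    have "csum (\<lambda>k. if k \<in> (UNIV::nat set) then tp (- eps * \<bar>of_int (j + int k)\<bar>) * ?y (j + int k) j else 0) \<le>
       csum (\<lambda>i. tp (- eps * \<bar>of_int i\<bar>) * ?y i j)"
      by (rule csum_inj_le[where g="\<lambda>i. tp (- eps * \<bar>of_int i\<bar>) * ?y i j"]) (auto simp: inj_on_def)
    then show "csum (\<lambda>k::nat. tp (- eps * \<bar>of_int (j + int k)\<bar>) * y k) \<le> csum (\<lambda>i. tp (- eps * \<bar>of_int i\<bar>) * ?y i j)"
      by simp
  qed (use R in auto)
  also have "\<dots> \<le> 2 * (csum (\<lambda>i::int. tp (- eps * \<bar>of_int i\<bar>)) * cln R y)"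
    using R by (intro cln_weighted_sum_le cln_inj_le) (auto simp: inj_on_def)
  finally show ?thesis by (simp add: decay_sum_def)
qed

lemma far_part_le:
  assumes [measurable]: "\<And>k. h k \<in> borel_measurable borel"
  shows "cln R (\<lambda>j. tp (of_int j * A1) * lpn lborel P (far_part h j)) \<le>
    16 * tp (2 * M) * decay_sum * decay_sum * cln D (\<lambda>k. tp (k * t2) * hz Q A2 R (h k))"
proof -
  let ?y = "\<lambda>k. tp (k * t2) * hz Q A2 R (h k)"
  let ?f = "\<lambda>j k l t. (if far j l k then tp (k * t1) * piece M k l (h k) t else 0) * indicator (annulus j) t"
  have le: "tp (of_int j * A1) * lpn lborel P (far_part h j) \<le>
     8 * tp (2 * M) * decay_sum * csum (\<lambda>k. tp (- eps * \<bar>of_int (j + int k)\<bar>) * ?y k)" for j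
  proof -
    have fp: "far_part h j = (\<lambda>t. csum (\<lambda>k. csum (\<lambda>l. ?f j k l t)))"
      unfolding far_part_def[abs_def] by (simp add: nn_integral_multc)
    have "tp (of_int j * A1) * lpn lborel P (far_part h j) \<le> tp (of_int j * A1) * (2 * csum (\<lambda>k. lpn lborel P (\<lambda>t. csum (\<lambda>l. ?f j k l t))))"
      unfolding fp using P by (intro mult_left_mono lpn_csum_le) auto
    also have "\<dots> \<le> tp (of_int j * A1) * (2 * csum (\<lambda>k. 2 * csum (\<lambda>l. lpn lborel P (?f j k l))))"
      using P by (intro mult_left_mono nn_integral_mono lpn_csum_le) auto
    also have "\<dots> = 4 * csum (\<lambda>k. csum (\<lambda>l. tp (of_int j * A1) * lpn lborel P (?f j k l)))"
    proof -
      have "tp a * (2 * (2 * x)) = (2 * 2) * (tp a * x)" for a x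
        by (simp only: mult_ac)
      then have "tp a * (2 * (2 * x)) = 4 * (tp a * x)" for a x by simp
      then show ?thesis by (simp only: nn_integral_cmult[OF borel_measurable_count_space])
    qed
    also have "\<dots> \<le> 4 * csum (\<lambda>k. csum (\<lambda>l. 2 * tp (2 * M) * (tp (- eps * \<bar>of_int (j + int k)\<bar>) * (tp (- eps * \<bar>of_int (l + int k)\<bar>) * ?y k))))"
    proof (intro mult_left_mono nn_integral_mono)
      fix k l
      have "tp (of_int j * A1) * lpn lborel P (?f j k l) \<le> 2 * tp (2 * M) * (tp (- eps * \<bar>of_int (j + int k)\<bar>) * (tp (- eps * \<bar>of_int (l + int k)\<bar>) * (tp (k * t2) * coef h k l)))"
        by (rule far_term_le) measurable
      \<comment> \<open>Thanks to the summable factor in \<open>l + k\<close>, a bound for the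
        largest of the coefficients is enough.\<close>
      also have "coef h k l \<le> hz Q A2 R (h k)"
        unfolding hz_coef using R by (intro cln_ge) auto
      finally show "tp (of_int j * A1) * lpn lborel P (?f j k l) \<le> 2 * tp (2 * M) * (tp (- eps * \<bar>of_int (j + int k)\<bar>) * (tp (- eps * \<bar>of_int (l + int k)\<bar>) * ?y k))"
        by (simp add: mult_left_mono)
    qed auto
    also have "\<dots> = 4 * csum (\<lambda>k. 2 * tp (2 * M) * (tp (- eps * \<bar>of_int (j + int k)\<bar>) * (decay_sum * ?y k)))"
    proof -
      have "csum (\<lambda>l. tp (- eps * \<bar>of_int (l + int k)\<bar>)) = decay_sum" for k
        unfolding decay_sum_def by (rule csum_shift_int)
      then show ?thesis
        by (simp only: nn_integral_cmult[OF borel_measurable_count_space] nn_integral_multc[OF borel_measurable_count_space])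
    qed
    also have "\<dots> = 4 * csum (\<lambda>k. 2 * tp (2 * M) * decay_sum * (tp (- eps * \<bar>of_int (j + int k)\<bar>) * ?y k))"
      by (simp only: mult_ac)
    also have "\<dots> = 8 * tp (2 * M) * decay_sum * csum (\<lambda>k. tp (- eps * \<bar>of_int (j + int k)\<bar>) * ?y k)"
      by (subst nn_integral_cmult) (auto simp: mult.assoc[symmetric])
    finally show ?thesis .
  qed
  have "cln R (\<lambda>j. tp (of_int j * A1) * lpn lborel P (far_part h j)) \<le>
    cln R (\<lambda>j. 8 * tp (2 * M) * decay_sum * csum (\<lambda>k. tp (- eps * \<bar>of_int (j + int k)\<bar>) * ?y k))"
    using R le by (intro lpn_mono) auto
  also have "\<dots> = 8 * tp (2 * M) * decay_sum * cln R (\<lambda>j. csum (\<lambda>k. tp (- eps * \<bar>of_int (j + int k)\<bar>) * ?y k))"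
    using R by (intro lpn_cmult) auto
  also have "\<dots> \<le> 8 * tp (2 * M) * decay_sum * (2 * (decay_sum * cln R ?y))"
    by (intro mult_left_mono cln_nat_to_int_convolution_le) auto
  \<comment> \<open>\<open>D <= R\<close> enters here, and once more in the near part, where two
    sums are exchanged.\<close>
  also have "\<dots> \<le> 8 * tp (2 * M) * decay_sum * (2 * (decay_sum * cln D ?y))"
    using D by (intro mult_left_mono cln_antimono) auto
  also have "\<dots> = (8 * 2) * tp (2 * M) * decay_sum * decay_sum * cln D ?y"
    by (simp only: mult_ac)
  finally show ?thesis by simp
qed

definition near_const :: ennreal where
  "near_const = (if D \<le> P then 1 else csum (\<lambda>i::int. tp (- (A2 - A1) * \<bar>of_int i\<bar>)))"

lemma near_const: "near_const \<noteq> top"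
  using D_cases csum_tp_decay[of "A2 - A1"] by (auto simp: near_const_def)

text \<open>For \<open>D <= P\<close> the weights are at most 1 and \<open>l^D\<close> embeds into
  \<open>l^P\<close>. Otherwise \<open>A1 < A2\<close>; then the weights are geometric in
  \<open>j + k > 0\<close>, hence bounded in \<open>l^P\<close> uniformly in \<open>j\<close>, and
  the supremum of \<open>x\<close> suffices.\<close>

lemma near_sequence_le:
  "cln P (\<lambda>k::nat. if 0 < j + int k then tp (- (A2 - A1) * of_int (j + int k)) * x k else 0) \<le> near_const * cln D x"
    (is "cln P ?f \<le> _")
proof (cases "D \<le> P")
  case True
  have "?f k \<le> x k" for k
  proof -
    have "tp (- (A2 - A1) * of_int (j + int k)) * x k \<le> tp 0 * x k" if "0 < j + int k"
      using that A_le by (intro mult_right_mono tp_mono) (auto simp: mult_le_0_iff)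
    then show ?thesis by simp
  qed
  then have "cln P ?f \<le> cln P x" using P by (intro lpn_mono) auto
  also have "\<dots> \<le> cln D x" using True D by (intro cln_antimono) auto
  finally show ?thesis using True by (simp add: near_const_def)
next
  case False
  let ?w = "\<lambda>k. if 0 < j + int k then tp (- (A2 - A1) * of_int (j + int k)) else 0"
  have "cln P ?w \<le> cln 1 ?w" using P by (intro cln_antimono) auto
  also have "cln 1 ?w \<le> csum (\<lambda>k. if k \<in> (UNIV :: nat set) then tp (- (A2 - A1) * \<bar>of_int (j + int k)\<bar>) else 0)"
    by (auto intro!: nn_integral_mono)
  also have "\<dots> \<le> csum (\<lambda>i::int. tp (- (A2 - A1) * \<bar>of_int i\<bar>))"
    by (rule csum_inj_le[where g="\<lambda>i::int. tp (- (A2 - A1) * \<bar>of_int i\<bar>)"]) (auto simp: inj_on_def)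
  finally have w: "cln P ?w \<le> near_const" using False by (simp add: near_const_def)
  have "cln P ?f \<le> cln P (\<lambda>k. cln D x * ?w k)"
    using P D by (intro lpn_mono) (auto simp: mult.commute intro: mult_right_mono cln_ge)
  also have "\<dots> = cln D x * cln P ?w" using P by (intro lpn_cmult) auto
  also have "\<dots> \<le> cln D x * near_const" by (intro mult_left_mono w) simp
  finally show ?thesis by (simp only: mult.commute)
qed

lemma cln_shift_int:
  "0 < p \<Longrightarrow> cln p (\<lambda>j::int. f (j + d)) = cln p f"
  unfolding lpn_def using csum_shift_int[of "\<lambda>l. epow (f l) p" d] by simp

lemma near_part_bound:
  "\<exists>C. C \<noteq> top \<and> (\<forall>h d. (\<forall>k. h k \<in> borel_measurable borel) \<longrightarrow> \<bar>d\<bar> \<le> 1 \<longrightarrow>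
    cln R (\<lambda>j. tp (of_int j * A1) * lpn lborel P (near_part h j d)) \<le> C * cln D (\<lambda>k. tp (k * t2) * hz Q A2 R (h k)))"
proof -
  obtain C0 where C0: "0 < C0" "\<And>f (a::nat \<Rightarrow> ennreal). (\<And>k. f k \<in> borel_measurable lborel) \<Longrightarrow>
     (\<And>k x. f k x \<le> a k) \<Longrightarrow>
     (\<And>k. (\<integral>\<^sup>+x. epow (f k x) Q \<partial>(lborel :: real measure)) \<le> ennreal (2 powr (- real k)) * epow (a k) Q) \<Longrightarrow>
     lpn lborel P (\<lambda>x. csum (\<lambda>k. f k x)) \<le> ennreal C0 * cln P (\<lambda>k. ennreal (2 powr (- real k / P)) * a k)"
    by (rule interpolation_bound[OF Q QP, where 'a=real]) auto
  \<comment> \<open>The 4 comes from \<open>piece_sup_le\<close>; \<open>tp \<bar>A2\<bar>\<close>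
    compensates the change of the weight \<open>2^(l * A2)\<close> between \<open>l = j\<close> and
    \<open>l = j + d\<close>.\<close>
  define K where "K = ennreal C0 * (4 * tp \<bar>A2\<bar>) * near_const"
  show ?thesis
  proof (intro exI[of _ "K * epow 2 (1 / D)"] conjI allI impI)
    show "K * epow 2 (1 / D) \<noteq> top"
      using near_const by (simp add: K_def ennreal_mult_eq_top_iff)
    fix h :: "nat \<Rightarrow> real \<Rightarrow> ennreal" and d :: int
    assume h: "\<forall>k. h k \<in> borel_measurable borel" and d: "\<bar>d\<bar> \<le> 1"
    note [measurable] = h[rule_format]
    have le: "tp (of_int j * A1) * lpn lborel P (near_part h j d) \<le>
      K * cln D (\<lambda>k. tp (k * t2) * coef h k (j + d))" for j
    proof -
      let ?N = "\<lambda>k. lpn lborel Q (\<lambda>y. h k y * indicator (annulus (j + d)) y)"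
      let ?f = "\<lambda>k t. (if 0 < j + int k then tp (k * t1) * piece M k (j + d) (h k) t else 0) * indicator (annulus j) t"
      \<comment> \<open>This is the supremum bound. The \<open>L^Q\<close> bound of
        \<open>piece_LQ_le\<close> is smaller by \<open>2^(-k/Q)\<close>, which is the normalisation
        that \<open>interpolation_bound\<close> asks for.\<close>
      let ?a = "\<lambda>k. if 0 < j + int k then 4 * (tp (k * t1 + k / Q) * ?N k) else 0"
      have np: "near_part h j d = (\<lambda>t. csum (\<lambda>k. ?f k t))"
        unfolding near_part_def[abs_def] by (simp add: nn_integral_multc)
      have fa: "?f k t \<le> ?a k" for k t
      proof -
        have "tp (k * t1) * piece M k (j + d) (h k) t \<le> tp (k * t1) * (4 * (tp (k / Q) * ?N k))"
          using Q M by (intro mult_left_mono piece_sup_le) auto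
        also have "\<dots> = 4 * (tp (k * t1 + k / Q) * ?N k)"
          by (simp only: mult.left_commute[of _ 4] tp_add_left)
        finally show ?thesis by (auto split: split_indicator)
      qed
      have fQ: "(\<integral>\<^sup>+t. epow (?f k t) Q \<partial>lborel) \<le> ennreal (2 powr (- real k)) * epow (?a k) Q" for k
      proof (cases "0 < j + int k")
        case True
        have "(\<integral>\<^sup>+t. epow (?f k t) Q \<partial>lborel) \<le> (\<integral>\<^sup>+t. tp (k * t1 * Q) * epow (piece M k (j + d) (h k) t) Q \<partial>lborel)"
          using Q by (intro nn_integral_mono) (auto simp: epow_mult epow_tp split: split_indicator)
        also have "\<dots> = tp (k * t1 * Q) * (\<integral>\<^sup>+t. epow (piece M k (j + d) (h k) t) Q \<partial>lborel)"
          by (rule nn_integral_cmult) measurable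
        also have "\<dots> \<le> tp (k * t1 * Q) * epow (4 * ?N k) Q"
          using Q M by (intro mult_left_mono piece_LQ_le) auto
        also have "k * t1 * Q = - real k + (k * t1 + k / Q) * Q" using Q by (simp add: field_simps)
        also have "tp (- real k + (k * t1 + k / Q) * Q) * epow (4 * ?N k) Q = tp (- real k) * epow (4 * (tp (k * t1 + k / Q) * ?N k)) Q"
        proof -
          have "tp (a + b * Q) * epow (4 * N) Q = tp a * epow (4 * (tp b * N)) Q" for a b N
            by (simp only: epow_mult tp_add[symmetric] epow_tp mult_ac)
          then show ?thesis .
        qed
        finally show ?thesis using True by (simp add: tp_def)
      qed simp
      have "tp (of_int j * A1) * lpn lborel P (near_part h j d) \<le>
         tp (of_int j * A1) * (ennreal C0 * cln P (\<lambda>k. ennreal (2 powr (- real k / P)) * ?a k))"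
        unfolding np by (intro mult_left_mono C0(2) fa fQ) auto
      also have "\<dots> = ennreal C0 * cln P (\<lambda>k. tp (of_int j * A1) * (tp (- real k / P) * ?a k))"
        using P by (simp add: lpn_cmult tp_def mult.left_commute)
      also have "(\<lambda>k. tp (of_int j * A1) * (tp (- real k / P) * ?a k)) =
        (\<lambda>k. (4 * tp (- of_int d * A2)) * (if 0 < j + int k then tp (- (A2 - A1) * of_int (j + int k)) * (tp (k * t2) * coef h k (j + d)) else 0))"
      proof
        fix k
        have "t1 = t2 - 1/Q - A2 + 1/P + A1" using diff_eq by simp
        then have "of_int j * A1 + (- real k / P + (k * t1 + k / Q)) = - of_int d * A2 + (- (A2 - A1) * of_int (j + int k) + (k * t2 + of_int (j + d) * A2))"
          by (simp only:) (simp add: algebra_simps)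
        then have "tp (of_int j * A1) * (tp (- real k / P) * (tp (k * t1 + k / Q) * ?N k)) =
          tp (- of_int d * A2) * (tp (- (A2 - A1) * of_int (j + int k)) * (tp (k * t2) * (tp (of_int (j + d) * A2) * ?N k)))"
          by (simp only: tp_add_left)
        then show "tp (of_int j * A1) * (tp (- real k / P) * ?a k) = (4 * tp (- of_int d * A2)) * (if 0 < j + int k then tp (- (A2 - A1) * of_int (j + int k)) * (tp (k * t2) * coef h k (j + d)) else 0)"
          by (simp only: coef_def mult.left_commute[of _ 4] mult.assoc mult_zero_right if_distrib[of "\<lambda>x. _ * x"] cong: if_cong)
      qed
      also have "cln P (\<lambda>k. (4 * tp (- of_int d * A2)) * (if 0 < j + int k then tp (- (A2 - A1) * of_int (j + int k)) * (tp (k * t2) * coef h k (j + d)) else 0)) =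
        (4 * tp (- of_int d * A2)) * cln P (\<lambda>k. if 0 < j + int k then tp (- (A2 - A1) * of_int (j + int k)) * (tp (k * t2) * coef h k (j + d)) else 0)"
        using P by (intro lpn_cmult) auto
      also have "ennreal C0 * \<dots> \<le> ennreal C0 * ((4 * tp \<bar>A2\<bar>) * (near_const * cln D (\<lambda>k. tp (k * t2) * coef h k (j + d))))"
      proof (intro mult_left_mono mult_mono near_sequence_le tp_mono)
        have "d = -1 \<or> d = 0 \<or> d = 1" using d by auto
        then show "- of_int d * A2 \<le> \<bar>A2\<bar>" by auto
      qed auto
      also have "\<dots> = K * cln D (\<lambda>k. tp (k * t2) * coef h k (j + d))" by (simp only: K_def mult.assoc)
      finally show ?thesis .
    qed
    have "cln R (\<lambda>j. tp (of_int j * A1) * lpn lborel P (near_part h j d)) \<le>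
        cln R (\<lambda>j. K * cln D (\<lambda>k. tp (k * t2) * coef h k (j + d)))"
      using R le by (intro lpn_mono) auto
    also have "\<dots> = K * cln R (\<lambda>j. cln D (\<lambda>k. tp (k * t2) * coef h k (j + d)))"
      using R by (intro lpn_cmult) auto
    \<comment> \<open>As \<open>D <= R\<close>, the norm over annuli may move inside the one over
      frequencies, where it is the Herz norm up to a translation by \<open>d\<close>.\<close>
    also have "\<dots> \<le> K * (epow 2 (1 / D) * cln D (\<lambda>k. cln R (\<lambda>j. tp (k * t2) * coef h k (j + d))))"
      using D by (intro mult_left_mono cln_cln_swap) auto
    also have "(\<lambda>k. cln R (\<lambda>j. tp (k * t2) * coef h k (j + d))) = (\<lambda>k. tp (k * t2) * hz Q A2 R (h k))"
      using R by (simp add: lpn_cmult hz_coef cln_shift_int)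
    finally show "cln R (\<lambda>j. tp (of_int j * A1) * lpn lborel P (near_part h j d)) \<le>
      K * epow 2 (1 / D) * cln D (\<lambda>k. tp (k * t2) * hz Q A2 R (h k))" by (simp only: mult.assoc)
  qed
qed

text \<open>A term that is not \<open>far\<close> has \<open>j + k > 0\<close> and
  \<open>l = j + d\<close> with \<open>d\<close> equal to -1, 0 or 1, so only three near parts
  occur.\<close>

lemma decompose_le:
  assumes [measurable]: "\<And>k. h k \<in> borel_measurable borel"
    and h: "\<And>k t. h k t \<le> C0 * (\<integral>\<^sup>+y. ker M k (t - y) * h k y \<partial>lborel)"
  shows "csum (\<lambda>k. tp (k * t1) * h k t) * indicator (annulus j) t \<le>
    C0 * (far_part h j t + csum (\<lambda>d. if d \<in> {-1, 0, 1} then near_part h j d t else 0))"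
proof -
  let ?X = "\<lambda>k l. tp (k * t1) * piece M k l (h k) t"
  have "tp (k * t1) * h k t \<le> C0 * csum (?X k)" for k
  proof -
    have "(\<integral>\<^sup>+y. ker M k (t - y) * h k y \<partial>lborel) = csum (\<lambda>l. piece M k l (h k) t)"
      unfolding piece_def by (subst nn_integral_csum_annulus) (auto simp: mult.assoc)
    then have "tp (k * t1) * h k t \<le> tp (k * t1) * (C0 * csum (\<lambda>l. piece M k l (h k) t))"
      using h[of k t] by (intro mult_left_mono) auto
    then show ?thesis by (simp add: nn_integral_cmult mult.left_commute)
  qed
  then have "csum (\<lambda>k. tp (k * t1) * h k t) \<le> C0 * csum (\<lambda>k. csum (?X k))"
    by (subst nn_integral_cmult[symmetric]) (auto intro!: nn_integral_mono)
  also have "csum (\<lambda>k. csum (?X k)) = csum (\<lambda>k. csum (\<lambda>l. if far j l k then ?X k l else 0)) +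
      csum (\<lambda>k. csum (\<lambda>l. if \<not> far j l k then ?X k l else 0))"
  proof -
    have "csum (?X k) = csum (\<lambda>l. (if far j l k then ?X k l else 0) + (if \<not> far j l k then ?X k l else 0))" for k
      by (intro nn_integral_cong) auto
    then show ?thesis by (simp add: nn_integral_add)
  qed
  also have "csum (\<lambda>k. csum (\<lambda>l. if \<not> far j l k then ?X k l else 0)) =
      csum (\<lambda>k. csum (\<lambda>d. if d \<in> {-1, 0, 1} then (if 0 < j + int k then ?X k (j + d) else 0) else 0))"
  proof (rule nn_integral_cong)
    fix k
    have "csum (\<lambda>l. if \<not> far j l k then ?X k l else 0) = csum (\<lambda>d. if \<not> far j (d + j) k then ?X k (d + j) else 0)"
      by (rule csum_shift_int[symmetric])
    also have "\<dots> = csum (\<lambda>d. if d \<in> {-1, 0, 1} then (if 0 < j + int k then ?X k (j + d) else 0) else 0)"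
      by (intro nn_integral_cong) (auto simp: far_def add.commute)
    finally show "csum (\<lambda>l. if \<not> far j l k then ?X k l else 0) = \<dots>" .
  qed
  also have "\<dots> = csum (\<lambda>d. if d \<in> {-1, 0, 1} then csum (\<lambda>k. if 0 < j + int k then ?X k (j + d) else 0) else 0)"
    by (subst csum_swap) (intro nn_integral_cong, auto)
  finally have "csum (\<lambda>k. tp (k * t1) * h k t) * indicator (annulus j) t \<le>
     C0 * (csum (\<lambda>k. csum (\<lambda>l. if far j l k then ?X k l else 0)) +
      csum (\<lambda>d. if d \<in> {-1, 0, 1} then csum (\<lambda>k. if 0 < j + int k then ?X k (j + d) else 0) else 0)) * indicator (annulus j) t"
    by (intro mult_right_mono) auto
  then show ?thesis
    by (cases "t \<in> annulus j") (simp_all add: far_part_def near_part_def cong: if_cong)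
qed

text \<open>The decomposition is inserted first into the \<open>L^P\<close> norm on an annulus and
  then into the \<open>l^R\<close> norm over the annuli. As \<open>P\<close> and \<open>R\<close>
  are at least 1, Minkowski's inequality separates the far part and the three near parts.\<close>

theorem herz_sum_le:
  assumes C0: "C0 \<noteq> top"
  shows "\<exists>C. C \<noteq> top \<and> (\<forall>h :: nat \<Rightarrow> real \<Rightarrow> ennreal. (\<forall>k. h k \<in> borel_measurable borel) \<longrightarrow>
    (\<forall>k t. h k t \<le> C0 * (\<integral>\<^sup>+y. ker M k (t - y) * h k y \<partial>lborel)) \<longrightarrow>
    hz P A1 R (\<lambda>t. csum (\<lambda>k. tp (k * t1) * h k t)) \<le> C * cln D (\<lambda>k. tp (k * t2) * hz Q A2 R (h k)))"
proof -
  obtain Kn where Kn: "Kn \<noteq> top" "\<And>h d. (\<And>k. h k \<in> borel_measurable borel) \<Longrightarrow> \<bar>d\<bar> \<le> 1 \<Longrightarrow>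
    cln R (\<lambda>j. tp (of_int j * A1) * lpn lborel P (near_part h j d)) \<le> Kn * cln D (\<lambda>k. tp (k * t2) * hz Q A2 R (h k))"
    using near_part_bound by blast
  define Kf where "Kf = 16 * tp (2 * M) * decay_sum * decay_sum"
  have Kf: "Kf \<noteq> top" using decay_sum by (simp add: Kf_def ennreal_mult_eq_top_iff)
  define C where "C = (2 * C0) * (2 * (Kf + 4 * (csum (\<lambda>d::int. if d \<in> {-1, 0, 1} then 1 else 0) * Kn)))"
  have csum3: "csum (\<lambda>d::int. if d \<in> {-1, 0, 1} then 1 else 0) \<noteq> top"
  proof -
    have "csum (\<lambda>d::int. if d \<in> {-1, 0, 1} then 1 else 0) = csum (indicator {-1, 0, 1 :: int})"
      by (intro nn_integral_cong) (auto split: split_indicator)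
    then show ?thesis by simp
  qed
  show ?thesis
  proof (intro exI[of _ C] conjI allI impI)
    show "C \<noteq> top" using C0 Kf Kn(1) csum3 by (simp add: C_def ennreal_mult_eq_top_iff)
    fix h :: "nat \<Rightarrow> real \<Rightarrow> ennreal"
    assume h: "\<forall>k. h k \<in> borel_measurable borel"
      and hk: "\<forall>k t. h k t \<le> C0 * (\<integral>\<^sup>+y. ker M k (t - y) * h k y \<partial>lborel)"
    note [measurable] = h[rule_format]
    define B where "B = cln D (\<lambda>k. tp (k * t2) * hz Q A2 R (h k))"
    let ?n = "\<lambda>d j t. if d \<in> {-1, 0, 1} then near_part h j d t else 0"
    have [measurable]: "far_part h j \<in> borel_measurable borel" for j
      unfolding far_part_def by measurable
    have [measurable]: "near_part h j d \<in> borel_measurable borel" for j d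
      unfolding near_part_def by measurable
    have le: "tp (of_int j * A1) * lpn lborel P (\<lambda>t. csum (\<lambda>k. tp (k * t1) * h k t) * indicator (annulus j) t) \<le>
      (2 * C0) * (tp (of_int j * A1) * lpn lborel P (far_part h j) + 2 * csum (\<lambda>d. tp (of_int j * A1) * lpn lborel P (?n d j)))" for j
    proof -
      have "lpn lborel P (\<lambda>t. csum (\<lambda>k. tp (k * t1) * h k t) * indicator (annulus j) t) \<le>
        lpn lborel P (\<lambda>t. C0 * (far_part h j t + csum (\<lambda>d. ?n d j t)))"
        using P hk by (intro lpn_mono decompose_le) auto
      also have "\<dots> = C0 * lpn lborel P (\<lambda>t. far_part h j t + csum (\<lambda>d. ?n d j t))"
        using P by (intro lpn_cmult) auto
      also have "\<dots> \<le> C0 * (2 * (lpn lborel P (far_part h j) + lpn lborel P (\<lambda>t. csum (\<lambda>d. ?n d j t))))"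
        using P by (intro mult_left_mono lpn_add_le) auto
      also have "\<dots> \<le> C0 * (2 * (lpn lborel P (far_part h j) + 2 * csum (\<lambda>d. lpn lborel P (?n d j))))"
        using P by (intro mult_left_mono add_left_mono lpn_csum_le) auto
      finally have "tp (of_int j * A1) * lpn lborel P (\<lambda>t. csum (\<lambda>k. tp (k * t1) * h k t) * indicator (annulus j) t) \<le>
        tp (of_int j * A1) * (C0 * (2 * (lpn lborel P (far_part h j) + 2 * csum (\<lambda>d. lpn lborel P (?n d j)))))"
        by (intro mult_left_mono) auto
      also have "\<dots> = (2 * C0) * (tp (of_int j * A1) * lpn lborel P (far_part h j) + 2 * (tp (of_int j * A1) * csum (\<lambda>d. lpn lborel P (?n d j))))"
        by (simp only: distrib_left mult_ac)
      finally show ?thesis by (simp only: nn_integral_cmult[OF borel_measurable_count_space])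
    qed
    have "hz P A1 R (\<lambda>t. csum (\<lambda>k. tp (k * t1) * h k t)) \<le>
      cln R (\<lambda>j. (2 * C0) * (tp (of_int j * A1) * lpn lborel P (far_part h j) + 2 * csum (\<lambda>d. tp (of_int j * A1) * lpn lborel P (?n d j))))"
      unfolding hz_def using R le by (intro lpn_mono) auto
    also have "\<dots> = (2 * C0) * cln R (\<lambda>j. tp (of_int j * A1) * lpn lborel P (far_part h j) + 2 * csum (\<lambda>d. tp (of_int j * A1) * lpn lborel P (?n d j)))"
      using R by (intro lpn_cmult) auto
    also have "\<dots> \<le> (2 * C0) * (2 * (cln R (\<lambda>j. tp (of_int j * A1) * lpn lborel P (far_part h j)) +
         cln R (\<lambda>j. 2 * csum (\<lambda>d. tp (of_int j * A1) * lpn lborel P (?n d j)))))"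
      using R by (intro mult_left_mono lpn_add_le) auto
    also have "cln R (\<lambda>j. 2 * csum (\<lambda>d. tp (of_int j * A1) * lpn lborel P (?n d j))) =
        2 * cln R (\<lambda>j. csum (\<lambda>d. tp (of_int j * A1) * lpn lborel P (?n d j)))"
      using R by (intro lpn_cmult) auto
    also have "cln R (\<lambda>j. csum (\<lambda>d. tp (of_int j * A1) * lpn lborel P (?n d j))) \<le>
        2 * csum (\<lambda>d. cln R (\<lambda>j. tp (of_int j * A1) * lpn lborel P (?n d j)))"
      using R by (intro lpn_csum_le) auto
    also have "csum (\<lambda>d. cln R (\<lambda>j. tp (of_int j * A1) * lpn lborel P (?n d j))) \<le>
        csum (\<lambda>d::int. (if d \<in> {-1, 0, 1} then 1 else 0) * (Kn * B))"
    proof (intro nn_integral_mono)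
      fix d :: int
      show "cln R (\<lambda>j. tp (of_int j * A1) * lpn lborel P (?n d j)) \<le> (if d \<in> {-1, 0, 1} then 1 else 0) * (Kn * B)"
      proof (cases "d \<in> {-1, 0, 1}")
        case True
        then have "\<bar>d\<bar> \<le> 1" by auto
        then show ?thesis using True Kn(2)[of h d] by (simp add: B_def)
      qed (use R P in \<open>simp add: lpn_def\<close>)
    qed
    also have "\<dots> = csum (\<lambda>d::int. if d \<in> {-1, 0, 1} then 1 else 0) * (Kn * B)"
      by (rule nn_integral_multc) simp
    also have "cln R (\<lambda>j. tp (of_int j * A1) * lpn lborel P (far_part h j)) \<le> Kf * B"
      unfolding Kf_def B_def by (rule far_part_le) measurable
    finally have "hz P A1 R (\<lambda>t. csum (\<lambda>k. tp (k * t1) * h k t)) \<le>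
      (2 * C0) * (2 * (Kf * B + 2 * (2 * (csum (\<lambda>d::int. if d \<in> {-1, 0, 1} then 1 else 0) * (Kn * B)))))"
      by (simp add: mult_left_mono add_mono)
    also have "\<dots> = (2 * C0) * (2 * (Kf * B + (2 * 2) * (csum (\<lambda>d::int. if d \<in> {-1, 0, 1} then 1 else 0) * (Kn * B))))"
      by (simp only: mult.assoc)
    also have "\<dots> = C * B"
      by (simp only: C_def distrib_right mult.assoc) simp
    finally show "hz P A1 R (\<lambda>t. csum (\<lambda>k. tp (k * t1) * h k t)) \<le> C * cln D (\<lambda>k. tp (k * t2) * hz Q A2 R (h k))"
      by (simp add: B_def)
  qed
qed

end

section \<open>Iterated Herz norms\<close>

lemma hz_mono: "0 < P \<Longrightarrow> 0 < R \<Longrightarrow> (\<And>t. f t \<le> g t) \<Longrightarrow> hz P A R f \<le> hz P A R g"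
  unfolding hz_def by (intro lpn_mono mult_left_mono mult_right_mono) auto

lemma hz_0: "hz P A R (\<lambda>t. 0) = 0"
  by (simp add: hz_def lpn_def)

lemma hz_cmult:
  assumes [measurable]: "g \<in> borel_measurable borel" and "0 < P" "0 < R"
  shows "hz P A R (\<lambda>t. c * g t) = c * hz P A R g"
proof -
  have "lpn lborel P (\<lambda>t. c * g t * indicator (annulus k) t) = c * lpn lborel P (\<lambda>t. g t * indicator (annulus k) t)" for k
    using assms by (subst lpn_cmult[symmetric]) (auto simp: mult.assoc)
  then have "hz P A R (\<lambda>t. c * g t) = cln R (\<lambda>k. c * (tp (of_int k * A) * lpn lborel P (\<lambda>t. g t * indicator (annulus k) t)))"
    by (simp add: hz_def mult.left_commute)
  also have "\<dots> = c * hz P A R g"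
    unfolding hz_def using assms by (intro lpn_cmult) auto
  finally show ?thesis .
qed

text \<open>Divides the exponents by \<open>e\<close> while multiplying the weights by
  \<open>e\<close>; this is how small exponents are raised to at least 1.\<close>

lemma hz_rescale:
  assumes "0 < P" "0 < R" "0 < e"
  shows "epow (hz P A R g) e = hz (P / e) (A * e) (R / e) (\<lambda>t. epow (g t) e)"
proof -
  have ind: "epow (indicator S t) e = indicator S t" for S :: "real set" and t
    by (auto split: split_indicator)
  show ?thesis
    using assms by (simp add: hz_def lpn_rescale epow_mult epow_tp ind mult.assoc)
qed

text \<open>Minkowski's inequality twice, in \<open>L^P\<close> and in \<open>l^R\<close>, with a
  factor 2 each time.\<close>

lemma hz_csum_le:
  fixes f :: "'k::countable \<Rightarrow> real \<Rightarrow> ennreal"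
  assumes [measurable]: "\<And>k. f k \<in> borel_measurable borel" and "1 \<le> P" "1 \<le> R"
  shows "hz P A R (\<lambda>t. csum (\<lambda>k. f k t)) \<le> 4 * csum (\<lambda>k. hz P A R (f k))"
proof -
  let ?N = "\<lambda>j k. lpn lborel P (\<lambda>t. f k t * indicator (annulus j) t)"
  have le: "tp (of_int j * A) * lpn lborel P (\<lambda>t. csum (\<lambda>k. f k t) * indicator (annulus j) t) \<le>
      2 * csum (\<lambda>k. tp (of_int j * A) * ?N j k)" for j
  proof -
    have "lpn lborel P (\<lambda>t. csum (\<lambda>k. f k t) * indicator (annulus j) t) =
        lpn lborel P (\<lambda>t. csum (\<lambda>k. f k t * indicator (annulus j) t))"
      by (simp add: nn_integral_multc)
    also have "\<dots> \<le> 2 * csum (?N j)" using assms by (intro lpn_csum_le) auto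
    finally have "tp (of_int j * A) * lpn lborel P (\<lambda>t. csum (\<lambda>k. f k t) * indicator (annulus j) t) \<le>
      tp (of_int j * A) * (2 * csum (?N j))" by (intro mult_left_mono) auto
    then show ?thesis by (simp add: nn_integral_cmult mult.left_commute)
  qed
  have "hz P A R (\<lambda>t. csum (\<lambda>k. f k t)) \<le> cln R (\<lambda>j. 2 * csum (\<lambda>k. tp (of_int j * A) * ?N j k))"
    unfolding hz_def using assms le by (intro lpn_mono) auto
  also have "\<dots> = 2 * cln R (\<lambda>j. csum (\<lambda>k. tp (of_int j * A) * ?N j k))"
    using assms by (intro lpn_cmult) auto
  also have "\<dots> \<le> 2 * (2 * csum (\<lambda>k. hz P A R (f k)))"
    unfolding hz_def using assms by (intro mult_left_mono lpn_csum_le) auto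
  finally show ?thesis by (simp add: mult.assoc[symmetric])
qed

lemma herz_norm_eq_hz:
  "0 < p \<Longrightarrow> 0 < q \<Longrightarrow> herz_norm (ennreal p) a (ennreal q) g = hz p a q g"
  by (simp add: herz_norm_def hz_def Lp_norm_eq_lpn tp_def lpn_def[of lebesgue] lpn_def[of lborel] nn_integral_completion)

section \<open>Coordinate updates and successive norms\<close>

lemma upd_coord_nth [simp]: "upd_coord x i t $ j = (if j = i then t else x $ j)"
  by (simp add: upd_coord_def)

lemma upd_coord_simps [simp]:
  "upd_coord (upd_coord x i s) i t = upd_coord x i t"
  "upd_coord x i (x $ i) = x"
  by (auto simp: vec_eq_iff)

lemma upd_coord_commute: "i \<noteq> j \<Longrightarrow> upd_coord (upd_coord x i s) j t = upd_coord (upd_coord x j t) i s"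
  by (auto simp: vec_eq_iff)

lemma borel_measurable_upd_coord [measurable]:
  "(\<lambda>(x :: real^'n, t). upd_coord x i t) \<in> borel_measurable (borel \<Otimes>\<^sub>M borel)"
proof -
  have "continuous_on UNIV (\<lambda>p :: (real^'n) \<times> real. if j = i then snd p else fst p $ j)" for j
    by (cases "j = i") (auto intro!: continuous_intros)
  then have "(\<lambda>p :: (real^'n) \<times> real. upd_coord (fst p) i (snd p)) \<in> borel_measurable borel"
    unfolding upd_coord_def by (intro borel_measurable_continuous_onI continuous_on_vec_lambda)
  then show ?thesis by (simp add: borel_prod case_prod_unfold)
qed

lemma borel_measurable_upd_coord_left [measurable]:
  "(\<lambda>x :: real^'n. upd_coord x i t) \<in> borel_measurable borel"
  using measurable_compose[OF measurable_Pair[OF measurable_ident measurable_const] borel_measurable_upd_coord, of t]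
  by simp

lemma borel_measurable_upd_coord_right [measurable]:
  "(\<lambda>t. upd_coord (x :: real^'n) i t) \<in> borel_measurable borel"
  using measurable_compose[OF measurable_Pair[OF measurable_const measurable_ident] borel_measurable_upd_coord, of x]
  by simp

lemma borel_measurable_hz_upd [measurable]:
  fixes g :: "real^'n \<Rightarrow> ennreal"
  assumes [measurable]: "g \<in> borel_measurable borel"
  shows "(\<lambda>x. hz P A R (\<lambda>t. g (upd_coord x i t))) \<in> borel_measurable borel"
proof -
  have [measurable]: "(\<lambda>p. g (upd_coord (fst p) i (snd p))) \<in> borel_measurable (borel \<Otimes>\<^sub>M borel)"
    using measurable_compose[OF borel_measurable_upd_coord assms] by (simp add: case_prod_unfold)
  have [measurable]: "(\<lambda>p. g (upd_coord (fst p) i (snd p))) \<in> borel_measurable (borel \<Otimes>\<^sub>M lborel)"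
    by measurable
  show ?thesis
    unfolding hz_def lpn_def by measurable
qed

primrec ihz :: "('n \<Rightarrow> real) \<Rightarrow> ('n \<Rightarrow> real) \<Rightarrow> ('n \<Rightarrow> real) \<Rightarrow> 'n list \<Rightarrow>
   (real^'n \<Rightarrow> ennreal) \<Rightarrow> (real^'n \<Rightarrow> ennreal)" where
  "ihz P A R [] g = g"
| "ihz P A R (i # js) g = ihz P A R js (\<lambda>x. hz (P i) (A i) (R i) (\<lambda>t. g (upd_coord x i t)))"

lemma iterated_herz_eq_ihz:
  assumes "\<And>i. 0 < p i" "\<And>i. 0 < q i"
  shows "iterated_herz (\<lambda>i. ennreal (p i)) a (\<lambda>i. ennreal (q i)) js g = ihz p a q js g"
  by (induction js arbitrary: g) (simp_all add: assms herz_norm_eq_hz)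

lemma ihz_mono:
  assumes "\<And>i. 0 < P i" "\<And>i. 0 < R i"
  shows "(\<And>x. f x \<le> g x) \<Longrightarrow> ihz P A R js f x \<le> ihz P A R js g x"
proof (induction js arbitrary: f g)
  case (Cons i js)
  show ?case
    unfolding ihz.simps by (intro Cons.IH hz_mono Cons.prems assms)
qed simp

lemma ihz_cmult:
  assumes "\<And>i. 0 < P i" "\<And>i. 0 < R i"
  shows "g \<in> borel_measurable borel \<Longrightarrow> ihz P A R js (\<lambda>x. c * g x) x = c * ihz P A R js g x"
  by (induction js arbitrary: g) (auto simp: assms hz_cmult)

lemma ihz_rescale:
  assumes "\<And>i. 0 < P i" "\<And>i. 0 < R i" "0 < e"
  shows "epow (ihz P A R js g x) e =
    ihz (\<lambda>i. P i / e) (\<lambda>i. A i * e) (\<lambda>i. R i / e) js (\<lambda>x. epow (g x) e) x"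
  by (induction js arbitrary: g) (simp_all add: assms hz_rescale)

text \<open>The discrete sub-mean-value property which functions with spectrum in a ball of radius
  \<open>2\<^bsup>k+1\<^esup>\<close> inherit from the sampling formula in the \<open>i\<close>-th variable.\<close>

definition sampled :: "ennreal \<Rightarrow> real \<Rightarrow> nat \<Rightarrow> 'n \<Rightarrow> (real^'n \<Rightarrow> ennreal) \<Rightarrow> bool" where
  "sampled C M k i h \<longleftrightarrow> (\<forall>x s. h x \<le> C * csum (\<lambda>m::int.
     ennreal ((1 + \<bar>2 ^ k * x $ i - (of_int m + s)\<bar>) powr (- M)) * h (upd_coord x i ((of_int m + s) / 2 ^ k))))"

lemma nn_integral_unit_intervals:
  fixes F :: "real \<Rightarrow> ennreal"
  assumes [measurable]: "F \<in> borel_measurable borel"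
  shows "csum (\<lambda>m::int. \<integral>\<^sup>+s. F (of_int m + s) * indicator {0..<1} s \<partial>lborel) = (\<integral>\<^sup>+u. F u \<partial>lborel)"
proof -
  have "(\<integral>\<^sup>+s. F (of_int m + s) * indicator {0..<1} s \<partial>lborel) =
      (\<integral>\<^sup>+u. F u * indicator {of_int m..<of_int m + 1} u \<partial>lborel)" for m :: int
  proof -
    have "(\<integral>\<^sup>+u. F u * indicator {of_int m..<of_int m + 1} u \<partial>lborel) =
      (\<integral>\<^sup>+s. F (of_int m + s) * indicator {of_int m..<of_int m + 1} (of_int m + s) \<partial>lborel)"
      using nn_integral_real_affine[of "\<lambda>u. F u * indicator {of_int m..<of_int m + 1} u" 1 "of_int m"] by simp
    then show ?thesis by (simp add: indicator_def)
  qed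
  then have "csum (\<lambda>m::int. \<integral>\<^sup>+s. F (of_int m + s) * indicator {0..<1} s \<partial>lborel) =
      (\<integral>\<^sup>+u. csum (\<lambda>m::int. F u * indicator {of_int m..<of_int m + 1} u) \<partial>lborel)"
    by (simp add: nn_integral_count_space_nn_integral)
  also have "\<dots> = (\<integral>\<^sup>+u. F u \<partial>lborel)"
  proof (rule nn_integral_cong)
    fix u
    have "csum (\<lambda>m::int. F u * indicator {of_int m..<of_int m + 1} u) = csum (\<lambda>m. if m = \<lfloor>u\<rfloor> then F u else 0)"
      by (intro nn_integral_cong) (auto simp: indicator_def floor_eq_iff; linarith)
    then show "csum (\<lambda>m::int. F u * indicator {of_int m..<of_int m + 1} u) = F u"
      by (simp add: csum_single)
  qed
  finally show ?thesis .
qed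

text \<open>Averaging over the shift \<open>s\<close> in [0, 1) merges the sum over the lattice and
  the integral over \<open>s\<close> into one integral over the line; the substitution
  \<open>u = 2^k y\<close> then produces \<open>ker\<close>.\<close>

lemma sampled_imp_ker:
  fixes h :: "real^'n \<Rightarrow> ennreal"
  assumes [measurable]: "h \<in> borel_measurable borel" and h: "sampled C M k i h"
  shows "h (upd_coord x i t) \<le> C * (\<integral>\<^sup>+y. ker M k (t - y) * h (upd_coord x i y) \<partial>lborel)"
proof -
  define g where "g t = h (upd_coord x i t)" for t
  have [measurable]: "g \<in> borel_measurable borel" unfolding g_def by measurable
  define F where "F u = ennreal ((1 + \<bar>2 ^ k * t - u\<bar>) powr (- M)) * g (u / 2 ^ k)" for u
  have [measurable]: "F \<in> borel_measurable borel" unfolding F_def by measurable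
  have le: "g t \<le> C * csum (\<lambda>m::int. F (of_int m + s))" for s
    using h[unfolded sampled_def, rule_format, of "upd_coord x i t" s] by (simp add: F_def g_def)
  have "g t = (\<integral>\<^sup>+s. g t * indicator {0..<1::real} s \<partial>lborel)"
    by (simp add: nn_integral_cmult)
  also have "\<dots> \<le> (\<integral>\<^sup>+s. C * csum (\<lambda>m::int. F (of_int m + s) * indicator {0..<1} s) \<partial>lborel)"
    by (intro nn_integral_mono) (use le in \<open>auto split: split_indicator\<close>)
  also have "\<dots> = C * csum (\<lambda>m::int. \<integral>\<^sup>+s. F (of_int m + s) * indicator {0..<1} s \<partial>lborel)"
    by (simp add: nn_integral_cmult nn_integral_count_space_nn_integral)
  also have "\<dots> = C * (\<integral>\<^sup>+u. F u \<partial>lborel)"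
    by (simp add: nn_integral_unit_intervals)
  also have "(\<integral>\<^sup>+u. F u \<partial>lborel) = 2 ^ k * (\<integral>\<^sup>+y. F (2 ^ k * y) \<partial>lborel)"
    using nn_integral_real_affine[of F "2 ^ k" 0] by (simp flip: ennreal_power)
  also have "\<dots> = (\<integral>\<^sup>+y. 2 ^ k * F (2 ^ k * y) \<partial>lborel)"
    by (rule nn_integral_cmult[symmetric]) measurable
  also have "\<dots> = (\<integral>\<^sup>+y. ker M k (t - y) * g y \<partial>lborel)"
  proof (rule nn_integral_cong)
    fix y
    have "(2::ennreal) ^ k = tp k" by (simp add: tp_def powr_realpow flip: ennreal_power)
    moreover have "\<bar>2 ^ k * t - 2 ^ k * y\<bar> = 2 ^ k * \<bar>t - y\<bar>"
      by (simp add: abs_mult flip: right_diff_distrib)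
    ultimately show "2 ^ k * F (2 ^ k * y) = ker M k (t - y) * g y"
      by (simp add: F_def ker_def mult.assoc)
  qed
  finally show ?thesis by (simp add: g_def)
qed

text \<open>The sample points differ from \<open>x\<close> in the coordinate \<open>i\<close> only,
  so the update of another coordinate \<open>l\<close> commutes with sampling. The factor 4 is that
  of \<open>hz_csum_le\<close>.\<close>

lemma sampled_hz:
  fixes h :: "real^'n \<Rightarrow> ennreal"
  assumes [measurable]: "h \<in> borel_measurable borel" and h: "sampled C M k i h" and "l \<noteq> i"
    and P: "1 \<le> P" and R: "1 \<le> R"
  shows "sampled (4 * C) M k i (\<lambda>x. hz P A R (\<lambda>t. h (upd_coord x l t)))"
  unfolding sampled_def
proof (intro allI)
  fix x :: "real^'n" and s
  let ?w = "\<lambda>m::int. ennreal ((1 + \<bar>2 ^ k * x $ i - (of_int m + s)\<bar>) powr (- M))"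
  let ?y = "\<lambda>m::int. upd_coord x i ((of_int m + s) / 2 ^ k)"
  have "hz P A R (\<lambda>t. h (upd_coord x l t)) \<le> hz P A R (\<lambda>t. C * csum (\<lambda>m. ?w m * h (upd_coord (?y m) l t)))"
  proof (intro hz_mono)
    fix t
    show "h (upd_coord x l t) \<le> C * csum (\<lambda>m. ?w m * h (upd_coord (?y m) l t))"
      using h[unfolded sampled_def, rule_format, of "upd_coord x l t" s] \<open>l \<noteq> i\<close>
      by (simp add: upd_coord_commute[of l i])
  qed (use P R in auto)
  also have "\<dots> = C * hz P A R (\<lambda>t. csum (\<lambda>m. ?w m * h (upd_coord (?y m) l t)))"
    using P R by (intro hz_cmult) auto
  also have "\<dots> \<le> C * (4 * csum (\<lambda>m. hz P A R (\<lambda>t. ?w m * h (upd_coord (?y m) l t))))"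
    using P R by (intro mult_left_mono hz_csum_le) auto
  also have "\<dots> = 4 * C * csum (\<lambda>m. ?w m * hz P A R (\<lambda>t. h (upd_coord (?y m) l t)))"
    using P R by (subst hz_cmult) (auto simp: mult_ac)
  finally show "hz P A R (\<lambda>t. h (upd_coord x l t)) \<le>
    4 * C * csum (\<lambda>m. ?w m * hz P A R (\<lambda>t. h (upd_coord (?y m) l t)))" .
qed

locale mixed_exponents =
  fixes P Q R A1 A2 :: "'n::finite \<Rightarrow> real" and M :: real
  assumes Q: "\<And>i. 1 \<le> Q i" and QP: "\<And>i. Q i < P i" and R: "\<And>i. 1 \<le> R i"
    and A1: "\<And>i. 0 < A1 i + 1 / P i" and A2: "\<And>i. 0 < 1 - 1 / Q i - A2 i"
    and M: "2 \<le> M" "\<And>i. (A1 i + 1 / P i) + (1 - 1 / Q i - A2 i) + 1 \<le> M"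
begin

lemma pos: "0 < P i" "0 < Q i" "0 < R i" "1 \<le> P i"
  using Q[of i] QP[of i] R[of i] by auto

lemma hz_sum_bound:
  assumes "0 < D" "D \<le> R i" "D \<le> P i \<or> A1 i < A2 i" "A1 i \<le> A2 i" "C0 \<noteq> top"
    and "t1 - 1 / P i - A1 i = t2 - 1 / Q i - A2 i"
  shows "\<exists>C. C \<noteq> top \<and> (\<forall>h :: nat \<Rightarrow> real^'n \<Rightarrow> ennreal. (\<forall>k. h k \<in> borel_measurable borel) \<longrightarrow>
    (\<forall>k. sampled C0 M k i (h k)) \<longrightarrow>
    (\<forall>x. hz (P i) (A1 i) (R i) (\<lambda>t. csum (\<lambda>k. tp (k * t1) * h k (upd_coord x i t))) \<le>
      C * cln D (\<lambda>k. tp (k * t2) * hz (Q i) (A2 i) (R i) (\<lambda>t. h k (upd_coord x i t)))))"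
proof -
  interpret herz_exponents "P i" "Q i" "R i" D "A1 i" "A2 i" t1 t2 M
    using assms Q QP R A1 A2 M by unfold_locales auto
  obtain C where C: "C \<noteq> top" "\<And>h :: nat \<Rightarrow> real \<Rightarrow> ennreal. (\<And>k. h k \<in> borel_measurable borel) \<Longrightarrow>
    (\<And>k t. h k t \<le> C0 * (\<integral>\<^sup>+y. ker M k (t - y) * h k y \<partial>lborel)) \<Longrightarrow>
    hz (P i) (A1 i) (R i) (\<lambda>t. csum (\<lambda>k. tp (k * t1) * h k t)) \<le> C * cln D (\<lambda>k. tp (k * t2) * hz (Q i) (A2 i) (R i) (h k))"
    using herz_sum_le[OF \<open>C0 \<noteq> top\<close>] by blast
  show ?thesis
  proof (intro exI[of _ C] conjI C(1) allI impI)
    fix h :: "nat \<Rightarrow> real^'n \<Rightarrow> ennreal" and x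
    assume h: "\<forall>k. h k \<in> borel_measurable borel" and s: "\<forall>k. sampled C0 M k i (h k)"
    note [measurable] = h[rule_format]
    show "hz (P i) (A1 i) (R i) (\<lambda>t. csum (\<lambda>k. tp (k * t1) * h k (upd_coord x i t))) \<le>
      C * cln D (\<lambda>k. tp (k * t2) * hz (Q i) (A2 i) (R i) (\<lambda>t. h k (upd_coord x i t)))"
      by (rule C(2)[of "\<lambda>k t. h k (upd_coord x i t)"]) (use s in \<open>auto intro: sampled_imp_ker\<close>)
  qed
qed

text \<open>Nikolskii's inequality in a single variable, as the case of one nonzero summand.\<close>

lemma hz_single_bound:
  assumes "A1 i \<le> A2 i" "C0 \<noteq> top"
  shows "\<exists>C. C \<noteq> top \<and> (\<forall>k. \<forall>h :: real^'n \<Rightarrow> ennreal. h \<in> borel_measurable borel \<longrightarrow>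
    sampled C0 M k i h \<longrightarrow>
    (\<forall>x. hz (P i) (A1 i) (R i) (\<lambda>t. h (upd_coord x i t)) \<le>
      C * (tp (k * (1 / Q i - 1 / P i + A2 i - A1 i)) * hz (Q i) (A2 i) (R i) (\<lambda>t. h (upd_coord x i t)))))"
proof -
  let ?t = "1 / Q i - 1 / P i + A2 i - A1 i"
  have "\<exists>C. C \<noteq> top \<and> (\<forall>h :: nat \<Rightarrow> real^'n \<Rightarrow> ennreal. (\<forall>k. h k \<in> borel_measurable borel) \<longrightarrow>
    (\<forall>k. sampled C0 M k i (h k)) \<longrightarrow>
    (\<forall>x. hz (P i) (A1 i) (R i) (\<lambda>t. csum (\<lambda>k. tp (k * 0) * h k (upd_coord x i t))) \<le>
      C * cln 1 (\<lambda>k. tp (k * ?t) * hz (Q i) (A2 i) (R i) (\<lambda>t. h k (upd_coord x i t)))))"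
    using assms R[of i] pos[of i] by (intro hz_sum_bound) auto
  then obtain C where C: "C \<noteq> top" "\<And>h x. (\<And>k::nat. h k \<in> borel_measurable borel) \<Longrightarrow> (\<And>k. sampled C0 M k i (h k)) \<Longrightarrow>
      hz (P i) (A1 i) (R i) (\<lambda>t. csum (\<lambda>k. h k (upd_coord x i t))) \<le>
      C * csum (\<lambda>k. tp (k * ?t) * hz (Q i) (A2 i) (R i) (\<lambda>t. h k (upd_coord x i t)))"
    by auto
  show ?thesis
  proof (intro exI[of _ C] conjI C(1) allI impI)
    fix k :: nat and h :: "real^'n \<Rightarrow> ennreal" and x
    assume [measurable]: "h \<in> borel_measurable borel" and s: "sampled C0 M k i h"
    let ?h = "\<lambda>j. if j = k then h else (\<lambda>_. 0)"
    have "hz (P i) (A1 i) (R i) (\<lambda>t. csum (\<lambda>j. ?h j (upd_coord x i t))) \<le>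
      C * csum (\<lambda>j. tp (j * ?t) * hz (Q i) (A2 i) (R i) (\<lambda>t. ?h j (upd_coord x i t)))"
      by (rule C(2)) (use s in \<open>auto simp: sampled_def\<close>)
    also have "(\<lambda>t. csum (\<lambda>j. ?h j (upd_coord x i t))) = (\<lambda>t. h (upd_coord x i t))"
      using csum_single[of k "\<lambda>_. h (upd_coord x i _)"] by (simp add: if_distrib[of "\<lambda>f. f _"] csum_single cong: if_cong)
    also have "csum (\<lambda>j. tp (j * ?t) * hz (Q i) (A2 i) (R i) (\<lambda>t. ?h j (upd_coord x i t))) =
      csum (\<lambda>j. if j = k then tp (j * ?t) * hz (Q i) (A2 i) (R i) (\<lambda>t. h (upd_coord x i t)) else 0)"
      by (intro nn_integral_cong) (auto simp: hz_0)
    also have "\<dots> = tp (k * ?t) * hz (Q i) (A2 i) (R i) (\<lambda>t. h (upd_coord x i t))"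
      by (rule csum_single)
    finally show "hz (P i) (A1 i) (R i) (\<lambda>t. h (upd_coord x i t)) \<le>
      C * (tp (k * ?t) * hz (Q i) (A2 i) (R i) (\<lambda>t. h (upd_coord x i t)))" .
  qed
qed

text \<open>The induction removes the innermost variable and replaces each \<open>h k\<close> by its
  Herz norm in that variable. \<open>C0\<close> and \<open>t1\<close> vary in it: the new functions
  are sampled with \<open>4 * C0\<close>, and the Nikolskii factor \<open>2^(k \<sigma>)\<close> is
  absorbed into \<open>t1\<close>. The last variable is the base case.\<close>

theorem ihz_sum_bound:
  fixes n :: 'n
  assumes D: "0 < D" "D \<le> R n" "D \<le> P n \<or> A1 n < A2 n" "A1 n \<le> A2 n"
  shows "C0 \<noteq> top \<Longrightarrow> distinct (js @ [n]) \<Longrightarrow> (\<And>i. i \<in> set js \<Longrightarrow> A1 i \<le> A2 i) \<Longrightarrow>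
    t1 - (\<Sum>i\<leftarrow>js @ [n]. 1 / P i + A1 i) = t2 - (\<Sum>i\<leftarrow>js @ [n]. 1 / Q i + A2 i) \<Longrightarrow>
    \<exists>C. C \<noteq> top \<and> (\<forall>h :: nat \<Rightarrow> real^'n \<Rightarrow> ennreal. (\<forall>k. h k \<in> borel_measurable borel) \<longrightarrow>
      (\<forall>k. \<forall>i\<in>set (js @ [n]). sampled C0 M k i (h k)) \<longrightarrow>
      (\<forall>x. ihz P A1 R (js @ [n]) (\<lambda>x. csum (\<lambda>k. tp (k * t1) * h k x)) x \<le>
        C * cln D (\<lambda>k. tp (k * t2) * ihz Q A2 R (js @ [n]) (h k) x)))"
proof (induction js arbitrary: C0 t1)
  case Nil
  then show ?case using hz_sum_bound[of D n C0 t1 t2] D by (simp add: algebra_simps)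
next
  case (Cons i js)
  define \<sigma> where "\<sigma> = 1 / Q i - 1 / P i + A2 i - A1 i"
  obtain C1 where C1: "C1 \<noteq> top" "\<And>k h x. h \<in> borel_measurable borel \<Longrightarrow> sampled C0 M k i h \<Longrightarrow>
    hz (P i) (A1 i) (R i) (\<lambda>t. h (upd_coord x i t)) \<le>
      C1 * (tp (k * \<sigma>) * hz (Q i) (A2 i) (R i) (\<lambda>t. h (upd_coord x i t)))"
    using hz_single_bound[of i C0] Cons.prems unfolding \<sigma>_def by auto
  have "\<exists>C. C \<noteq> top \<and> (\<forall>h :: nat \<Rightarrow> real^'n \<Rightarrow> ennreal. (\<forall>k. h k \<in> borel_measurable borel) \<longrightarrow>
      (\<forall>k. \<forall>i\<in>set (js @ [n]). sampled (4 * C0) M k i (h k)) \<longrightarrow>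
      (\<forall>x. ihz P A1 R (js @ [n]) (\<lambda>x. csum (\<lambda>k. tp (k * (t1 + \<sigma>)) * h k x)) x \<le>
        C * cln D (\<lambda>k. tp (k * t2) * ihz Q A2 R (js @ [n]) (h k) x)))"
    using Cons.prems by (intro Cons.IH) (auto simp: ennreal_mult_eq_top_iff \<sigma>_def algebra_simps)
  then obtain C2 where C2: "C2 \<noteq> top" "\<And>h x. (\<And>k::nat. h k \<in> borel_measurable borel) \<Longrightarrow>
      (\<And>k i. i \<in> set (js @ [n]) \<Longrightarrow> sampled (4 * C0) M k i (h k)) \<Longrightarrow>
      ihz P A1 R (js @ [n]) (\<lambda>x. csum (\<lambda>k. tp (k * (t1 + \<sigma>)) * h k x)) x \<le>
        C2 * cln D (\<lambda>k. tp (k * t2) * ihz Q A2 R (js @ [n]) (h k) x)"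
    by blast
  show ?case
  proof (intro exI[of _ "4 * C1 * C2"] conjI allI impI)
    show "4 * C1 * C2 \<noteq> top" using C1 C2 by (simp add: ennreal_mult_eq_top_iff)
    fix h :: "nat \<Rightarrow> real^'n \<Rightarrow> ennreal" and x
    assume h: "\<forall>k. h k \<in> borel_measurable borel"
      and s: "\<forall>k. \<forall>i\<in>set ((i # js) @ [n]). sampled C0 M k i (h k)"
    note [measurable] = h[rule_format]
    define G where "G k x = hz (Q i) (A2 i) (R i) (\<lambda>t. h k (upd_coord x i t))" for k x
    have [measurable]: "G k \<in> borel_measurable borel" for k
      unfolding G_def by measurable
    have le: "hz (P i) (A1 i) (R i) (\<lambda>t. csum (\<lambda>k. tp (k * t1) * h k (upd_coord x i t))) \<le>
        4 * C1 * csum (\<lambda>k. tp (k * (t1 + \<sigma>)) * G k x)" for x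
    proof -
      have "hz (P i) (A1 i) (R i) (\<lambda>t. csum (\<lambda>k. tp (k * t1) * h k (upd_coord x i t))) \<le>
          4 * csum (\<lambda>k. hz (P i) (A1 i) (R i) (\<lambda>t. tp (k * t1) * h k (upd_coord x i t)))"
        using R pos by (intro hz_csum_le) auto
      also have "\<dots> = 4 * csum (\<lambda>k. tp (k * t1) * hz (P i) (A1 i) (R i) (\<lambda>t. h k (upd_coord x i t)))"
        using pos by (subst hz_cmult) auto
      also have "\<dots> \<le> 4 * csum (\<lambda>k. tp (k * t1) * (C1 * (tp (k * \<sigma>) * G k x)))"
        unfolding G_def using s by (intro mult_left_mono nn_integral_mono C1(2)) auto
      also have "\<dots> = 4 * csum (\<lambda>k. C1 * (tp (k * (t1 + \<sigma>)) * G k x))"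
        by (simp only: mult.left_commute[of _ C1] tp_add_left distrib_left)
      finally show ?thesis by (simp add: nn_integral_cmult mult.assoc)
    qed
    have "ihz P A1 R ((i # js) @ [n]) (\<lambda>x. csum (\<lambda>k. tp (k * t1) * h k x)) x \<le>
        ihz P A1 R (js @ [n]) (\<lambda>x. 4 * C1 * csum (\<lambda>k. tp (k * (t1 + \<sigma>)) * G k x)) x"
      using pos le by (auto intro!: ihz_mono)
    also have "\<dots> = 4 * C1 * ihz P A1 R (js @ [n]) (\<lambda>x. csum (\<lambda>k. tp (k * (t1 + \<sigma>)) * G k x)) x"
      using pos by (intro ihz_cmult) auto
    also have "\<dots> \<le> 4 * C1 * (C2 * cln D (\<lambda>k. tp (k * t2) * ihz Q A2 R (js @ [n]) (G k) x))"
    proof (intro mult_left_mono C2(2))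
      fix k l assume l: "l \<in> set (js @ [n])"
      then have "i \<noteq> l" using Cons.prems by auto
      then show "sampled (4 * C0) M k l (G k)"
        unfolding G_def using s l Q R by (intro sampled_hz) auto
    qed auto
    finally show "ihz P A1 R ((i # js) @ [n]) (\<lambda>x. csum (\<lambda>k. tp (k * t1) * h k x)) x \<le>
      4 * C1 * C2 * cln D (\<lambda>k. tp (k * t2) * ihz Q A2 R ((i # js) @ [n]) (h k) x)"
      by (simp add: G_def[abs_def] mult.assoc)
  qed
qed

end

section \<open>Sampling of exponentials\<close>

definition csinc :: "real \<Rightarrow> real" where
  "csinc x = (if x = 0 then 1 else sin x / x)"

lemma csinc_0 [simp]: "csinc 0 = 1"
  by (simp add: csinc_def)

lemma borel_measurable_csinc [measurable]: "csinc \<in> borel_measurable borel"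
  unfolding csinc_def[abs_def] by measurable

lemma abs_csinc_le_1: "\<bar>csinc x\<bar> \<le> 1"
  using abs_sin_x_le_abs_x[of x] by (simp add: csinc_def field_simps)

lemma abs_csinc_decay:
  assumes "0 < b"
  shows "\<bar>csinc (b * t)\<bar> * (1 + \<bar>t\<bar>) \<le> 1 + 1 / b"
proof -
  have "\<bar>csinc (b * t)\<bar> * \<bar>t\<bar> \<le> 1 / b"
  proof (cases "t = 0")
    case False
    have "\<bar>sin (b * t)\<bar> / b \<le> 1 / b"
      using assms by (intro divide_right_mono) auto
    then show ?thesis using False assms by (simp add: csinc_def abs_mult field_simps)
  qed (use assms in simp)
  then show ?thesis using abs_csinc_le_1[of "b * t"] by (simp add: distrib_left)
qed

lemma cis_has_vector_derivative:
  "((\<lambda>x. cis (t * x)) has_vector_derivative \<i> * t * cis (t * x)) (at x within S)"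
proof -
  have "((\<lambda>z. exp (\<i> * t * z)) has_field_derivative \<i> * t * exp (\<i> * t * of_real x)) (at (of_real x))"
    by (auto intro!: derivative_eq_intros)
  from has_vector_derivative_real_field[OF this] show ?thesis
    by (simp add: cis_conv_exp mult.assoc)
qed

lemma borel_measurable_cis [measurable]: "cis \<in> borel_measurable borel"
  by (intro borel_measurable_continuous_onI continuous_intros)

lemma borel_measurable_cnj' [measurable]: "cnj \<in> borel_measurable borel"
  by (intro borel_measurable_continuous_onI continuous_intros)

text \<open>As a probability measure, so that constants are integrable and can serve as dominating
  functions. Its characteristic function at \<open>t\<close> is
  \<open>csinc (c * t)\<close>.\<close>

definition uni :: "real \<Rightarrow> real measure" where
  "uni c = uniform_measure lborel {-c..c}"

lemma prob_space_uni: "0 < c \<Longrightarrow> prob_space (uni c)"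
  unfolding uni_def by (intro prob_space_uniform_measure) auto

lemma sets_uni [measurable_cong, simp]: "sets (uni c) = sets borel"
  by (simp add: uni_def)

lemma space_uni [simp]: "space (uni c) = UNIV"
  by (simp add: uni_def)

lemma AE_uni: "0 < c \<Longrightarrow> AE x in uni c. \<bar>x\<bar> \<le> c"
  unfolding uni_def by (rule AE_uniform_measureI) auto

lemma integrable_uni:
  fixes f :: "real \<Rightarrow> complex"
  assumes "0 < c" "f \<in> borel_measurable borel" "\<And>x. \<bar>x\<bar> \<le> c \<Longrightarrow> norm (f x) \<le> K"
  shows "integrable (uni c) f"
proof -
  interpret prob_space "uni c" by (rule prob_space_uni) fact
  show ?thesis
    using AE_uni[OF assms(1)] by (intro integrable_const_bound[of _ K]) (use assms in auto)
qed

lemma norm_integral_uni_le: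
  fixes f :: "real \<Rightarrow> complex"
  assumes "0 < c" "f \<in> borel_measurable borel" "\<And>x. \<bar>x\<bar> \<le> c \<Longrightarrow> norm (f x) \<le> K"
  shows "norm (LINT x|uni c. f x) \<le> K"
proof -
  interpret prob_space "uni c" by (rule prob_space_uni) fact
  have int: "integrable (uni c) f" using assms by (rule integrable_uni)
  have "norm (LINT x|uni c. f x) \<le> (LINT x|uni c. norm (f x))" by (rule integral_norm_bound)
  also have "\<dots> \<le> K"
    using AE_uni[OF assms(1)] by (intro integral_le_const integrable_norm int) (use assms in auto)
  finally show ?thesis .
qed

lemma integral_uni:
  fixes f :: "real \<Rightarrow> complex"
  assumes "0 < c" and [measurable]: "f \<in> borel_measurable borel"
  shows "(LINT x|uni c. f x) = (LINT x|lborel. indicator {-c..c} x *\<^sub>R f x) / complex_of_real (2 * c)"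
proof -
  have "uni c = density lborel (\<lambda>x. ennreal (indicator {-c..c} x / (2 * c)))"
    unfolding uni_def uniform_measure_def using assms
    by (intro density_cong) (auto simp: divide_ennreal ennreal_indicator[symmetric] simp del: ennreal_indicator)
  then have "(LINT x|uni c. f x) = (LINT x|lborel. (indicator {-c..c} x / (2 * c)) *\<^sub>R f x)"
    using assms by (simp add: integral_density)
  also have "\<dots> = (LINT x|lborel. (indicator {-c..c} x *\<^sub>R f x) / complex_of_real (2 * c))"
    by (intro Bochner_Integration.integral_cong) (auto simp: scaleR_conv_of_real field_simps)
  finally show ?thesis by simp
qed

lemma integral_uni_cis:
  assumes "0 < c"
  shows "(LINT x|uni c. cis (t * x)) = complex_of_real (csinc (c * t))"
proof (cases "t = 0")
  case True
  then show ?thesis using assms prob_space.prob_space[OF prob_space_uni[OF assms]] by simp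
next
  case False
  have "((\<lambda>x. cis (t * x) / (\<i> * t)) has_vector_derivative cis (t * x)) (at x within {-c..c})" for x
    using has_vector_derivative_mult_left[OF cis_has_vector_derivative[of t x "{-c..c}"], of "1 / (\<i> * t)"] False
    by (simp add: field_simps)
  then have "(LINT x|lborel. indicator {-c..c} x *\<^sub>R cis (t * x)) = cis (t * c) / (\<i> * t) - cis (t * (- c)) / (\<i> * t)"
    using assms by (intro integral_FTC_atLeastAtMost) (auto intro!: continuous_intros)
  also have "\<dots> = (cis (t * c) - cis (- (t * c))) / (\<i> * t)" by (simp add: diff_divide_distrib)
  also have "cis (t * c) - cis (- (t * c)) = 2 * \<i> * sin (t * c)"
    by (simp add: complex_eq_iff)
  also have "2 * \<i> * complex_of_real (sin (t * c)) / (\<i> * t) = complex_of_real (2 * c) * complex_of_real (csinc (c * t))"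
    using False assms by (simp add: csinc_def field_simps)
  finally show ?thesis using assms by (subst integral_uni) auto
qed

text \<open>Nonnegativity of the mean of \<open>|H - S|^2\<close>, with \<open>S\<close> the Fourier
  sum over \<open>F\<close>: by orthogonality the mixed terms and the square of \<open>S\<close> all
  have the same mean \<open>T\<close>.\<close>

lemma bessel_inequality:
  fixes H :: "real \<Rightarrow> complex" and F :: "int set"
  assumes [measurable]: "H \<in> borel_measurable borel" and K: "\<And>x. \<bar>x\<bar> \<le> pi \<Longrightarrow> norm (H x) \<le> K"
  defines "c \<equiv> \<lambda>m. LINT x|uni pi. H x * cis (- of_int m * x)"
  assumes F: "finite F"
  shows "(\<Sum>m\<in>F. (norm (c m))\<^sup>2) \<le> K\<^sup>2"
proof -
  interpret prob_space "uni pi" by (rule prob_space_uni) simp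
  define T where "T = (\<Sum>m\<in>F. (norm (c m))\<^sup>2)"
  define S where "S x = (\<Sum>m\<in>F. c m * cis (of_int m * x))" for x
  have [measurable]: "S \<in> borel_measurable borel" unfolding S_def by measurable
  define KS where "KS = (\<Sum>m\<in>F. norm (c m))"
  have SK: "norm (S x) \<le> KS" for x
    unfolding S_def KS_def by (rule order_trans[OF norm_sum]) (simp add: norm_mult)
  have K0: "0 \<le> K" using K[of 0] by (auto intro: order_trans[OF norm_ge_zero])
  have int: "integrable (uni pi) (\<lambda>x. H x * cis (a * x))" for a
    by (rule integrable_uni[of _ _ K]) (auto simp: norm_mult K)
  have intS: "integrable (uni pi) (\<lambda>x. S x * cis (a * x))" for a
    by (rule integrable_uni[of _ _ KS]) (auto simp: norm_mult SK)
  have intm: "integrable (uni pi) (\<lambda>x. H x * cis (- (of_int m * x)))"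
    "integrable (uni pi) (\<lambda>x. S x * cis (- (of_int m * x)))" for m :: int
    using int[of "- of_int m"] intS[of "- of_int m"] by simp_all
  have ortho: "(LINT x|uni pi. cis (of_int m * x) * cis (- of_int l * x)) = (if m = l then 1 else 0)" for m l :: int
  proof -
    have "(LINT x|uni pi. cis (of_int m * x) * cis (- of_int l * x)) = (LINT x|uni pi. cis (of_int (m - l) * x))"
      by (simp add: cis_mult algebra_simps)
    also have "\<dots> = complex_of_real (csinc (pi * of_int (m - l)))" by (rule integral_uni_cis) simp
    also have "\<dots> = (if m = l then 1 else 0)"
      by (auto simp: csinc_def sin_times_pi_eq_0 mult.commute[of pi])
    finally show ?thesis .
  qed
  have cS: "(LINT x|uni pi. S x * cis (- of_int l * x)) = c l" if "l \<in> F" for l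
  proof -
    have "(LINT x|uni pi. S x * cis (- of_int l * x)) = (LINT x|uni pi. (\<Sum>m\<in>F. c m * (cis (of_int m * x) * cis (- of_int l * x))))"
      by (simp add: S_def sum_distrib_right mult.assoc)
    also have "\<dots> = (\<Sum>m\<in>F. c m * (LINT x|uni pi. cis (of_int m * x) * cis (- of_int l * x)))"
      by (subst Bochner_Integration.integral_sum)
        (auto intro!: integrable_mult_right integrable_uni[of _ _ 1] simp: norm_mult)
    also have "\<dots> = c l" using that F by (simp only: ortho) (simp add: if_distrib[of "\<lambda>x. _ * x"] sum.delta cong: if_cong)
    finally show ?thesis .
  qed
  have cnjS: "cnj (S x) = (\<Sum>m\<in>F. cnj (c m) * cis (- of_int m * x))" for x
    by (simp add: S_def cis_cnj)
  have TT: "(\<Sum>m\<in>F. cnj (c m) * c m) = of_real T"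
  proof -
    have "cnj z * z = of_real ((norm z)\<^sup>2)" for z by (metis complex_norm_square mult.commute)
    then show ?thesis by (simp only: T_def of_real_sum)
  qed
  have HS: "(LINT x|uni pi. H x * cnj (S x)) = of_real T"
  proof -
    have "(LINT x|uni pi. H x * cnj (S x)) = (LINT x|uni pi. (\<Sum>m\<in>F. cnj (c m) * (H x * cis (- of_int m * x))))"
      by (simp add: cnjS sum_distrib_left mult_ac)
    also have "\<dots> = (\<Sum>m\<in>F. cnj (c m) * c m)"
      using intm by (subst Bochner_Integration.integral_sum) (auto simp: c_def intro!: integrable_mult_right)
    finally show ?thesis by (simp add: TT)
  qed
  have SS: "(LINT x|uni pi. S x * cnj (S x)) = of_real T"
  proof -
    have "(LINT x|uni pi. S x * cnj (S x)) = (LINT x|uni pi. (\<Sum>m\<in>F. cnj (c m) * (S x * cis (- of_int m * x))))"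
      by (simp add: cnjS sum_distrib_left mult_ac)
    also have "\<dots> = (\<Sum>m\<in>F. cnj (c m) * c m)"
      using cS intm by (subst Bochner_Integration.integral_sum) (auto intro!: integrable_mult_right)
    finally show ?thesis by (simp add: TT)
  qed
  have i0: "integrable (uni pi) (\<lambda>x. H x * cnj (S x))"
    by (rule integrable_uni[of _ _ "K * KS"]) (auto simp: norm_mult intro!: mult_mono K SK K0)
  have i1: "integrable (uni pi) (\<lambda>x. S x * cnj (H x))"
    by (rule integrable_uni[of _ _ "KS * K"])
      (auto simp: norm_mult intro!: mult_mono K SK order_trans[OF norm_ge_zero SK])
  have i2: "integrable (uni pi) (\<lambda>x. S x * cnj (S x))"
    by (rule integrable_uni[of _ _ "KS * KS"]) (auto simp: norm_mult intro!: mult_mono SK order_trans[OF norm_ge_zero SK])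
  have i3: "integrable (uni pi) (\<lambda>x. H x * cnj (H x))"
    by (rule integrable_uni[of _ _ "K * K"]) (auto simp: norm_mult intro!: mult_mono K K0)
  have SH: "(LINT x|uni pi. S x * cnj (H x)) = of_real T"
  proof -
    have "(LINT x|uni pi. S x * cnj (H x)) = (LINT x|uni pi. cnj (H x * cnj (S x)))" by (simp add: mult.commute)
    also have "\<dots> = cnj (LINT x|uni pi. H x * cnj (S x))" by (rule integral_bounded_linear[OF bounded_linear_cnj i0])
    finally show ?thesis by (simp add: HS)
  qed
  have "0 \<le> Re (LINT x|uni pi. (H x - S x) * cnj (H x - S x))"
  proof -
    have "integrable (uni pi) (\<lambda>x. (H x - S x) * cnj (H x - S x))"
      using i0 i1 i2 i3 by (simp add: algebra_simps)
    then have "Re (LINT x|uni pi. (H x - S x) * cnj (H x - S x)) = (LINT x|uni pi. Re ((H x - S x) * cnj (H x - S x)))"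
      by (rule integral_Re[symmetric])
    also have "\<dots> = (LINT x|uni pi. (norm (H x - S x))\<^sup>2)"
    proof -
      have "Re (z * cnj z) = (norm z)\<^sup>2" for z by (metis Re_complex_of_real complex_norm_square)
      then show ?thesis by (simp only:)
    qed
    finally show ?thesis by simp
  qed
  also have "(LINT x|uni pi. (H x - S x) * cnj (H x - S x)) =
    (LINT x|uni pi. H x * cnj (H x)) - of_real T"
  proof -
    have "(LINT x|uni pi. (H x - S x) * cnj (H x - S x)) =
      (LINT x|uni pi. H x * cnj (H x) - H x * cnj (S x) - S x * cnj (H x) + S x * cnj (S x))"
      by (simp add: algebra_simps)
    also have "\<dots> = (LINT x|uni pi. H x * cnj (H x)) - of_real T - of_real T + of_real T"
      using i0 i1 i2 i3 by (simp add: HS SH SS)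
    finally show ?thesis by simp
  qed
  finally have "T \<le> Re (LINT x|uni pi. H x * cnj (H x))" by simp
  also have "\<dots> \<le> norm (LINT x|uni pi. H x * cnj (H x))" by (rule complex_Re_le_cmod)
  also have "\<dots> \<le> K\<^sup>2"
    by (rule norm_integral_uni_le) (auto simp: norm_mult power2_eq_square intro!: mult_mono K K0)
  finally show ?thesis by (simp add: T_def)
qed

text \<open>By Bessel's inequality the coefficients at the distinct frequencies \<open>g n\<close>
  are square summable.\<close>

lemma riemann_lebesgue:
  fixes H :: "real \<Rightarrow> complex" and g :: "nat \<Rightarrow> int"
  assumes "H \<in> borel_measurable borel" "\<And>x. \<bar>x\<bar> \<le> pi \<Longrightarrow> norm (H x) \<le> K" "inj g"
  shows "(\<lambda>n. LINT x|uni pi. H x * cis (- of_int (g n) * x)) \<longlonglongrightarrow> 0"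
proof -
  let ?c = "\<lambda>m::int. LINT x|uni pi. H x * cis (- of_int m * x)"
  have "summable (\<lambda>n. (norm (?c (g n)))\<^sup>2)"
  proof (rule summableI_nonneg_bounded)
    fix n
    have "(\<Sum>i<n. (norm (?c (g i)))\<^sup>2) = (\<Sum>m\<in>g ` {..<n}. (norm (?c m))\<^sup>2)"
      using assms(3) by (subst sum.reindex) (auto intro: inj_on_subset)
    also have "\<dots> \<le> K\<^sup>2" using assms(1,2) by (intro bessel_inequality) auto
    finally show "(\<Sum>i<n. (norm (?c (g i)))\<^sup>2) \<le> K\<^sup>2" .
  qed simp
  then have "(\<lambda>n. sqrt ((norm (?c (g n)))\<^sup>2)) \<longlonglongrightarrow> sqrt 0"
    by (intro tendsto_real_sqrt summable_LIMSEQ_zero)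
  then show ?thesis by (simp add: tendsto_norm_zero_iff)
qed


section \<open>The Dirichlet kernel and Shannon's formula\<close>

lemma sum_int_Suc:
  fixes f :: "int \<Rightarrow> complex"
  shows "(\<Sum>m\<in>{- int (Suc L)..int (Suc L)}. f m) = (\<Sum>m\<in>{- int L..int L}. f m) + f (int (Suc L)) + f (- int (Suc L))"
proof -
  have "{- int (Suc L)..int (Suc L)} = insert (int (Suc L)) (insert (- int (Suc L)) {- int L..int L})" by auto
  then show ?thesis by (simp add: algebra_simps)
qed

text \<open>The Dirichlet kernel with its denominator multiplied out, so that the zeros of
  \<open>cis x - 1\<close> need no separate treatment.\<close>

lemma sum_cis_telescoping:
  "(\<Sum>m\<in>{- int L..int L}. cis (of_int m * x)) * (cis x - 1) = cis (of_int (int L + 1) * x) - cis (of_int (- int L) * x)"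
proof (induction L)
  case (Suc L)
  have "cis (of_int m * x) * (cis x - 1) = cis (of_int (m + 1) * x) - cis (of_int m * x)" for m :: int
    by (simp add: right_diff_distrib cis_mult algebra_simps)
  with Suc show ?case by (simp only: sum_int_Suc distrib_right) (simp add: algebra_simps)
qed simp

lemma norm_cis_minus_1: "norm (cis x - 1) = 2 * \<bar>sin (x / 2)\<bar>"
proof -
  have "cis x - 1 = cis (x / 2) * (cis (x / 2) - cis (- (x / 2)))"
    by (simp add: right_diff_distrib cis_mult)
  also have "cis (x / 2) - cis (- (x / 2)) = 2 * \<i> * sin (x / 2)"
    by (simp add: complex_eq_iff)
  finally show ?thesis by (simp add: norm_mult)
qed

lemma norm_cis_diff_le: "norm (cis a - cis b) \<le> \<bar>a - b\<bar>"
proof -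
  have "cis a - cis b = cis b * (cis (a - b) - 1)" by (simp add: right_diff_distrib cis_mult)
  then show ?thesis
    using abs_sin_x_le_abs_x[of "(a - b) / 2"] by (simp add: norm_mult norm_cis_minus_1)
qed

text \<open>\<open>csinc\<close> is continuous and positive on [-a, a] because
  \<open>a < pi\<close>, so its minimum there can be taken as \<open>c\<close>.\<close>

lemma csinc_lower_bound:
  assumes "0 \<le> a" "a < pi"
  obtains c where "0 < c" "\<And>x. \<bar>x\<bar> \<le> a \<Longrightarrow> c * \<bar>x\<bar> \<le> \<bar>sin x\<bar>"
proof -
  have cont: "continuous_on {-a..a} csinc"
    unfolding csinc_def[abs_def] by (intro continuous_at_imp_continuous_on ballI isCont_sinc)
  obtain x0 where x0: "x0 \<in> {-a..a}" "\<And>x. x \<in> {-a..a} \<Longrightarrow> csinc x0 \<le> csinc x"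
    using continuous_attains_inf[OF _ _ cont] assms by auto
  have "0 < csinc x0"
  proof (cases "0 < x0")
    case True
    then show ?thesis using x0(1) assms by (simp add: csinc_def sin_gt_zero)
  next
    case False
    then have "x0 \<noteq> 0 \<Longrightarrow> 0 < sin (- x0)" using x0(1) assms by (intro sin_gt_zero) auto
    then show ?thesis using False by (auto simp: csinc_def divide_neg_neg)
  qed
  moreover have "csinc x0 * \<bar>x\<bar> \<le> \<bar>sin x\<bar>" if "\<bar>x\<bar> \<le> a" for x
  proof (cases "x = 0")
    case False
    have "csinc x0 \<le> csinc x" using that by (intro x0) auto
    also have "\<dots> \<le> \<bar>sin x\<bar> / \<bar>x\<bar>" using False by (simp add: csinc_def flip: abs_divide)
    finally show ?thesis using False by (simp add: field_simps)
  qed simp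
  ultimately show ?thesis by (rule that)
qed

definition spart :: "(real \<Rightarrow> real) \<Rightarrow> nat \<Rightarrow> real \<Rightarrow> real \<Rightarrow> complex" where
  "spart \<psi> L t x = (\<Sum>m\<in>{- int L..int L}. complex_of_real (\<psi> (t - of_int m)) * cis (of_int m * x))"

lemma borel_measurable_spart [measurable]: "spart \<psi> L t \<in> borel_measurable borel"
  unfolding spart_def by measurable

text \<open>The uniform bound makes it possible to integrate the sampling formula over the frequency \<open>x\<close>.\<close>

definition sampling_on :: "real \<Rightarrow> (real \<Rightarrow> real) \<Rightarrow> bool" where
  "sampling_on B \<psi> \<longleftrightarrow> (\<forall>t. (\<exists>K. \<forall>x L. \<bar>x\<bar> \<le> B \<longrightarrow> norm (spart \<psi> L t x) \<le> K) \<and>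
     (\<forall>x. \<bar>x\<bar> \<le> B \<longrightarrow> (\<lambda>L. spart \<psi> L t x) \<longlonglongrightarrow> cis (t * x)))"

text \<open>Shannon's formula. As in Chernoff's proof of the pointwise convergence of Fourier series, the error is
  a difference of two Fourier coefficients of the bounded function \<open>H\<close>.\<close>

lemma sampling_on_csinc: "sampling_on 3 (\<lambda>t. csinc (pi * t))"
  unfolding sampling_on_def
proof (intro allI)
  fix t :: real
  \<comment> \<open>For \<open>|x0| <= 3\<close> and \<open>|x| <= pi\<close> half of the difference
    is at most \<open>(pi + 3) / 2 < pi\<close> in modulus, so the denominator of \<open>H\<close>
    vanishes on the diagonal only, to first order. This fixes the band 3, strictly inside
    [-pi, pi].\<close>
  obtain c where c: "0 < c" "\<And>x. \<bar>x\<bar> \<le> (pi + 3) / 2 \<Longrightarrow> c * \<bar>x\<bar> \<le> \<bar>sin x\<bar>"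
    using csinc_lower_bound[of "(pi + 3) / 2"] pi_gt3 by auto
  define K where "K = \<bar>t\<bar> / c"
  define H where "H x0 x = (if cis (x0 - x) = 1 then 0 else (cis (t * x) - cis (t * x0)) / (cis (x0 - x) - 1))" for x0 x
  have [measurable]: "H x0 \<in> borel_measurable borel" for x0
    unfolding H_def by measurable
  have far: "\<bar>x0 - x\<bar> * c \<le> norm (cis (x0 - x) - 1)" if "\<bar>x0\<bar> \<le> 3" "\<bar>x\<bar> \<le> pi" for x0 x
    using c(2)[of "(x0 - x) / 2"] that by (simp add: norm_cis_minus_1 mult.commute)
  have HK: "norm (H x0 x) \<le> K" if "\<bar>x0\<bar> \<le> 3" "\<bar>x\<bar> \<le> pi" for x0 x
  proof (cases "cis (x0 - x) = 1")
    case False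
    then have pos: "0 < norm (cis (x0 - x) - 1)" by simp
    have "norm (cis (t * x) - cis (t * x0)) \<le> \<bar>t\<bar> * \<bar>x0 - x\<bar>"
      using norm_cis_diff_le[of "t * x" "t * x0"] by (simp add: abs_mult abs_minus_commute flip: right_diff_distrib)
    also have "\<dots> = K * (\<bar>x0 - x\<bar> * c)" using c by (simp add: K_def)
    also have "\<dots> \<le> K * norm (cis (x0 - x) - 1)"
      using far[OF that] c by (intro mult_left_mono) (auto simp: K_def)
    finally show ?thesis using False pos by (simp add: H_def norm_divide pos_divide_le_eq)
  qed (use c in \<open>simp add: H_def K_def\<close>)
  have err: "spart (\<lambda>t. csinc (pi * t)) L t x0 - cis (t * x0) =
      cis (of_int (int L + 1) * x0) * (LINT x|uni pi. H x0 x * cis (- of_int (int L + 1) * x)) -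
      cis (of_int (- int L) * x0) * (LINT x|uni pi. H x0 x * cis (- of_int (- int L) * x))"
    if x0: "\<bar>x0\<bar> \<le> 3" for L x0
  proof -
    let ?D = "\<lambda>x. \<Sum>m\<in>{- int L..int L}. cis (of_int m * (x0 - x))"
    have int: "integrable (uni pi) (\<lambda>x. a * cis (b * x))" for a b
      by (rule integrable_uni[of _ _ "norm a"]) (auto simp: norm_mult)
    \<comment> \<open>The values \<open>csinc (pi * (s - m))\<close> are the Fourier coefficients of
      \<open>cis (s * x)\<close> on [-pi, pi], which makes the partial sum of the sampling series an
      integral against the Dirichlet kernel.\<close>
    have D: "(LINT x|uni pi. cis (s * x) * ?D x) = (\<Sum>m\<in>{- int L..int L}. complex_of_real (csinc (pi * (s - of_int m))) * cis (of_int m * x0))" for s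
    proof -
      have "(LINT x|uni pi. cis (s * x) * ?D x) = (LINT x|uni pi. (\<Sum>m\<in>{- int L..int L}. cis (of_int m * x0) * cis ((s - of_int m) * x)))"
        by (simp add: sum_distrib_left cis_mult algebra_simps)
      also have "\<dots> = (\<Sum>m\<in>{- int L..int L}. cis (of_int m * x0) * (LINT x|uni pi. cis ((s - of_int m) * x)))"
        using int by (subst Bochner_Integration.integral_sum) auto
      finally show ?thesis by (simp only: integral_uni_cis[OF pi_gt_zero] mult.commute[of "cis _"])
    qed
    have intD: "integrable (uni pi) (\<lambda>x. cis (s * x) * ?D x)" for s
    proof -
      have "(\<lambda>x. cis (s * x) * ?D x) = (\<lambda>x. (\<Sum>m\<in>{- int L..int L}. cis (of_int m * x0) * cis ((s - of_int m) * x)))"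
        by (simp add: sum_distrib_left cis_mult algebra_simps)
      then show ?thesis using int by simp
    qed
    have D0: "(LINT x|uni pi. ?D x) = 1"
    proof -
      have "(LINT x|uni pi. ?D x) = (\<Sum>m\<in>{- int L..int L}. complex_of_real (csinc (pi * (0 - of_int m))) * cis (of_int m * x0))"
        using D[of 0] by simp
      also have "\<dots> = (\<Sum>m\<in>{- int L..int L}. if m = 0 then 1 else 0)"
        by (intro sum.cong) (auto simp: csinc_def sin_times_pi_eq_0 mult.commute[of pi])
      finally show ?thesis by simp
    qed
    have "spart (\<lambda>t. csinc (pi * t)) L t x0 - cis (t * x0) = (LINT x|uni pi. cis (t * x) * ?D x) - cis (t * x0) * (LINT x|uni pi. ?D x)"
      by (simp only: D D0) (simp add: spart_def)
    also have "\<dots> = (LINT x|uni pi. cis (t * x) * ?D x - cis (t * x0) * ?D x)"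
      using intD[of t] intD[of 0] by simp
    also have "\<dots> = (LINT x|uni pi. cis (of_int (int L + 1) * x0) * (H x0 x * cis (- of_int (int L + 1) * x)) -
        cis (of_int (- int L) * x0) * (H x0 x * cis (- of_int (- int L) * x)))"
    proof (rule integral_cong_AE)
      have "AE x in uni pi. \<bar>x\<bar> \<le> pi" by (rule AE_uni) simp
      then show "AE x in uni pi. cis (t * x) * ?D x - cis (t * x0) * ?D x =
        cis (of_int (int L + 1) * x0) * (H x0 x * cis (- of_int (int L + 1) * x)) -
        cis (of_int (- int L) * x0) * (H x0 x * cis (- of_int (- int L) * x))"
      proof eventually_elim
        case (elim x)
        have eq: "cis (t * x) - cis (t * x0) = H x0 x * (cis (x0 - x) - 1)"
        proof (cases "cis (x0 - x) = 1")
          case True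
          then have "\<bar>x0 - x\<bar> * c \<le> 0" using far[OF x0 elim] by simp
          then have "x0 = x" using c(1) by (simp add: mult_le_0_iff)
          then show ?thesis by (simp add: H_def)
        qed (simp add: H_def)
        have "cis (t * x) * ?D x - cis (t * x0) * ?D x = H x0 x * (?D x * (cis (x0 - x) - 1))"
          by (simp only: left_diff_distrib[symmetric] eq) (simp only: mult_ac)
        also have "?D x * (cis (x0 - x) - 1) = cis (of_int (int L + 1) * (x0 - x)) - cis (of_int (- int L) * (x0 - x))"
          by (rule sum_cis_telescoping)
        finally have "cis (t * x) * ?D x - cis (t * x0) * ?D x = H x0 x * (cis (of_int (int L + 1) * (x0 - x)) - cis (of_int (- int L) * (x0 - x)))" .
        moreover have "cis (of_int m * (x0 - x)) = cis (of_int m * x0) * cis (- of_int m * x)" for m :: int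
          by (simp add: cis_mult algebra_simps)
        ultimately show ?case by (simp only: right_diff_distrib mult.left_commute[of "H x0 x"])
      qed
    qed measurable
    also have "\<dots> = cis (of_int (int L + 1) * x0) * (LINT x|uni pi. H x0 x * cis (- of_int (int L + 1) * x)) -
      cis (of_int (- int L) * x0) * (LINT x|uni pi. H x0 x * cis (- of_int (- int L) * x))"
    proof -
      have "integrable (uni pi) (\<lambda>x. a * (H x0 x * cis (s * x)))" for a s
        by (intro integrable_mult_right integrable_uni[of _ _ K]) (auto simp: norm_mult HK x0)
      then show ?thesis by (subst Bochner_Integration.integral_diff) auto
    qed
    finally show ?thesis .
  qed
  have coef_le: "norm (LINT x|uni pi. H x0 x * cis (- of_int m * x)) \<le> K" if "\<bar>x0\<bar> \<le> 3" for x0 and m :: int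
    by (rule norm_integral_uni_le) (auto simp: norm_mult HK that)
  have "norm (spart (\<lambda>t. csinc (pi * t)) L t x0) \<le> 1 + 2 * K" if x0: "\<bar>x0\<bar> \<le> 3" for x0 L
  proof -
    have "norm (spart (\<lambda>t. csinc (pi * t)) L t x0 - cis (t * x0)) \<le> K + K"
      unfolding err[OF x0] by (rule order_trans[OF norm_triangle_ineq4])
        (intro add_mono, simp_all only: norm_mult norm_cis mult_1_left coef_le[OF x0])
    then show ?thesis
      using norm_triangle_ineq2[of "spart (\<lambda>t. csinc (pi * t)) L t x0" "cis (t * x0)"] by simp
  qed
  moreover have "(\<lambda>L. spart (\<lambda>t. csinc (pi * t)) L t x0) \<longlonglongrightarrow> cis (t * x0)" if x0: "\<bar>x0\<bar> \<le> 3" for x0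
  proof -
    have RL: "(\<lambda>L. cis (of_int (g L) * x0) * (LINT x|uni pi. H x0 x * cis (- of_int (g L) * x))) \<longlonglongrightarrow> 0" if "inj g" for g :: "nat \<Rightarrow> int"
    proof -
      have "(\<lambda>L. norm (LINT x|uni pi. H x0 x * cis (- of_int (g L) * x))) \<longlonglongrightarrow> 0"
        by (rule tendsto_norm_zero, rule riemann_lebesgue[of "H x0" K g]) (measurable, rule HK[OF x0], assumption, rule that)
      then have "(\<lambda>L. norm (cis (of_int (g L) * x0) * (LINT x|uni pi. H x0 x * cis (- of_int (g L) * x)))) \<longlonglongrightarrow> 0"
        by (simp only: norm_mult norm_cis mult_1_left)
      then show ?thesis by (rule tendsto_norm_zero_cancel)
    qed
    have "(\<lambda>L. spart (\<lambda>t. csinc (pi * t)) L t x0 - cis (t * x0)) \<longlonglongrightarrow> 0 - 0"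
      unfolding err[OF x0]
      by (intro tendsto_diff RL[of "\<lambda>L. int L + 1"] RL[of "\<lambda>L. - int L"]) (auto simp: inj_on_def)
    then show ?thesis by (simp add: LIM_zero_iff)
  qed
  ultimately show "(\<exists>K. \<forall>x L. \<bar>x\<bar> \<le> 3 \<longrightarrow> norm (spart (\<lambda>t. csinc (pi * t)) L t x) \<le> K) \<and>
     (\<forall>x. \<bar>x\<bar> \<le> 3 \<longrightarrow> (\<lambda>L. spart (\<lambda>t. csinc (pi * t)) L t x) \<longlonglongrightarrow> cis (t * x))"
    by blast
qed

text \<open>\<open>csinc (b * t)\<close> is the mean of \<open>cis (t * v)\<close> over
  \<open>|v| <= b\<close>. So the new partial sum is the mean of \<open>cis (t * v)\<close> times
  the old one at \<open>x - v\<close>, whose limit \<open>cis (t * v) * cis (t * (x - v))\<close> is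
  \<open>cis (t * x)\<close> for each \<open>v\<close>. The band shrinks by \<open>b\<close> because
  \<open>x - v\<close> must lie in the old one.\<close>

lemma sampling_on_mult_csinc:
  assumes \<psi>: "sampling_on B \<psi>" and b: "0 < b"
  shows "sampling_on (B - b) (\<lambda>t. \<psi> t * csinc (b * t))"
  unfolding sampling_on_def
proof (intro allI)
  fix t
  interpret prob_space "uni b" by (rule prob_space_uni) fact
  obtain K where K: "\<And>x L. \<bar>x\<bar> \<le> B \<Longrightarrow> norm (spart \<psi> L t x) \<le> K"
    using \<psi> unfolding sampling_on_def by meson
  have eq: "spart (\<lambda>t. \<psi> t * csinc (b * t)) L t x = (LINT v|uni b. cis (t * v) * spart \<psi> L t (x - v))" for L x
  proof -
    have "(LINT v|uni b. cis (t * v) * spart \<psi> L t (x - v)) =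
      (LINT v|uni b. (\<Sum>m\<in>{- int L..int L}. (complex_of_real (\<psi> (t - of_int m)) * cis (of_int m * x)) * cis ((t - of_int m) * v)))"
    proof (intro Bochner_Integration.integral_cong refl)
      fix v
      have "cis (t * v) * cis (of_int m * (x - v)) = cis (of_int m * x) * cis ((t - of_int m) * v)" for m :: int
        by (simp add: cis_mult algebra_simps)
      then show "cis (t * v) * spart \<psi> L t (x - v) =
          (\<Sum>m\<in>{- int L..int L}. (complex_of_real (\<psi> (t - of_int m)) * cis (of_int m * x)) * cis ((t - of_int m) * v))"
        by (simp only: spart_def sum_distrib_left mult.left_commute[of "cis (t * v)"] mult.assoc)
    qed
    also have "\<dots> = (\<Sum>m\<in>{- int L..int L}. (complex_of_real (\<psi> (t - of_int m)) * cis (of_int m * x)) * (LINT v|uni b. cis ((t - of_int m) * v)))"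
      using b by (subst Bochner_Integration.integral_sum)
        (auto intro!: integrable_mult_right integrable_uni[of _ _ 1])
    finally show ?thesis by (simp only: integral_uni_cis[OF b]) (simp only: spart_def of_real_mult mult_ac)
  qed
  have "norm (spart (\<lambda>t. \<psi> t * csinc (b * t)) L t x) \<le> K" if "\<bar>x\<bar> \<le> B - b" for L x
    unfolding eq using b that by (intro norm_integral_uni_le) (auto simp: norm_mult intro!: K)
  moreover have "(\<lambda>L. spart (\<lambda>t. \<psi> t * csinc (b * t)) L t x) \<longlonglongrightarrow> cis (t * x)" if x: "\<bar>x\<bar> \<le> B - b" for x
  proof -
    have "(\<lambda>L. LINT v|uni b. cis (t * v) * spart \<psi> L t (x - v)) \<longlonglongrightarrow> (LINT v|uni b. cis (t * x))"
    proof (rule integral_dominated_convergence[where w="\<lambda>_. K"])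
      show "AE v in uni b. (\<lambda>L. cis (t * v) * spart \<psi> L t (x - v)) \<longlonglongrightarrow> cis (t * x)"
        using AE_uni[OF b]
      proof eventually_elim
        case (elim v)
        then have "(\<lambda>L. spart \<psi> L t (x - v)) \<longlonglongrightarrow> cis (t * (x - v))"
          using \<psi> x unfolding sampling_on_def by auto
        then have "(\<lambda>L. cis (t * v) * spart \<psi> L t (x - v)) \<longlonglongrightarrow> cis (t * v) * cis (t * (x - v))"
          by (intro tendsto_intros)
        then show ?case by (simp add: cis_mult algebra_simps)
      qed
      show "AE v in uni b. norm (cis (t * v) * spart \<psi> L t (x - v)) \<le> K" for L
        using AE_uni[OF b] by eventually_elim (use x in \<open>auto simp: norm_mult intro!: K\<close>)
    qed auto
    then show ?thesis using prob_space by (simp add: eq)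
  qed
  ultimately show "(\<exists>K. \<forall>x L. \<bar>x\<bar> \<le> B - b \<longrightarrow> norm (spart (\<lambda>t. \<psi> t * csinc (b * t)) L t x) \<le> K) \<and>
     (\<forall>x. \<bar>x\<bar> \<le> B - b \<longrightarrow> (\<lambda>L. spart (\<lambda>t. \<psi> t * csinc (b * t)) L t x) \<longlonglongrightarrow> cis (t * x))"
    by blast
qed

lemma sampling_on_mult_csinc_power:
  assumes "sampling_on B \<psi>" "0 < b"
  shows "sampling_on (B - of_nat N * b) (\<lambda>t. \<psi> t * csinc (b * t) ^ N)"
proof (induction N)
  case (Suc N)
  from sampling_on_mult_csinc[OF Suc assms(2)] show ?case
    by (simp add: algebra_simps)
qed (use assms in simp)

text \<open>The first $M$ factors give a fixed decay; the remaining ones make the kernel decay as fast as a given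
  tempered distribution requires, without affecting the first estimate.\<close>

theorem sampling_kernel_exists:
  fixes M :: nat
  shows "\<exists>C>0. \<forall>N::nat. \<exists>\<psi> C'. \<psi> \<in> borel_measurable borel \<and> sampling_on 2 \<psi> \<and>
     (\<forall>t. \<bar>\<psi> t\<bar> * (1 + \<bar>t\<bar>) ^ M \<le> C) \<and> (\<forall>t. \<bar>\<psi> t\<bar> * (1 + \<bar>t\<bar>) ^ N \<le> C')"
proof -
  \<comment> \<open>The \<open>M\<close> factors with \<open>b\<close> use up at most 1/2 of the
    band, and so do the \<open>N\<close> factors with \<open>b'\<close> below; of the band 3 in
    Shannon's formula at least 2 remains.\<close>
  define b where "b = 1 / (2 * (real M + 1))"
  have b: "0 < b" "real M * b \<le> 1 / 2" by (auto simp: b_def field_simps)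
  define C where "C = (1 + 1 / b) ^ M"
  show ?thesis
  proof (intro exI[of _ C] conjI allI)
    show "0 < C" using b by (simp add: C_def add_pos_nonneg)
    fix N :: nat
    define b' where "b' = 1 / (2 * (real N + 1))"
    have b': "0 < b'" "real N * b' \<le> 1 / 2" by (auto simp: b'_def field_simps)
    define \<psi> where "\<psi> t = csinc (pi * t) * csinc (b * t) ^ M * csinc (b' * t) ^ N" for t
    have meas: "\<psi> \<in> borel_measurable borel" unfolding \<psi>_def by measurable
    have pow: "\<bar>csinc (d * t)\<bar> ^ n * (1 + \<bar>t\<bar>) ^ n \<le> (1 + 1 / d) ^ n" if "0 < d" for d t n
      using abs_csinc_decay[OF that, of t] by (simp add: power_mono flip: power_mult_distrib)
    have le1: "\<bar>csinc u\<bar> ^ n \<le> 1" for u n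
      using abs_csinc_le_1[of u] by (simp add: power_le_one)
    have mono: "sampling_on B \<psi>" if "sampling_on B' \<psi>" "B \<le> B'" for B B' \<psi>
      using that unfolding sampling_on_def by (meson order_trans)
    have "sampling_on (3 - real M * b - real N * b') \<psi>"
      unfolding \<psi>_def by (intro sampling_on_mult_csinc_power sampling_on_csinc b b')
    then have samp: "sampling_on 2 \<psi>" by (rule mono) (use b b' in linarith)
    have "\<bar>\<psi> t\<bar> * (1 + \<bar>t\<bar>) ^ M \<le> C" for t
    proof -
      have "\<bar>\<psi> t\<bar> * (1 + \<bar>t\<bar>) ^ M = \<bar>csinc (pi * t)\<bar> * \<bar>csinc (b' * t)\<bar> ^ N * (\<bar>csinc (b * t)\<bar> ^ M * (1 + \<bar>t\<bar>) ^ M)"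
        by (simp add: \<psi>_def abs_mult power_abs mult_ac)
      also have "\<dots> \<le> 1 * 1 * C"
        unfolding C_def using b by (intro mult_mono le1 pow abs_csinc_le_1 mult_nonneg_nonneg) auto
      finally show ?thesis by simp
    qed
    moreover have "\<bar>\<psi> t\<bar> * (1 + \<bar>t\<bar>) ^ N \<le> (1 + 1 / b') ^ N" for t
    proof -
      have "\<bar>\<psi> t\<bar> * (1 + \<bar>t\<bar>) ^ N = \<bar>csinc (pi * t)\<bar> * \<bar>csinc (b * t)\<bar> ^ M * (\<bar>csinc (b' * t)\<bar> ^ N * (1 + \<bar>t\<bar>) ^ N)"
        by (simp add: \<psi>_def abs_mult power_abs mult_ac)
      also have "\<dots> \<le> 1 * 1 * (1 + 1 / b') ^ N"
        using b' by (intro mult_mono le1 pow abs_csinc_le_1 mult_nonneg_nonneg) auto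
      finally show ?thesis by simp
    qed
    ultimately show "\<exists>\<psi> C'. \<psi> \<in> borel_measurable borel \<and> sampling_on 2 \<psi> \<and>
     (\<forall>t. \<bar>\<psi> t\<bar> * (1 + \<bar>t\<bar>) ^ M \<le> C) \<and> (\<forall>t. \<bar>\<psi> t\<bar> * (1 + \<bar>t\<bar>) ^ N \<le> C')"
      using samp meas by blast
  qed
qed

section \<open>Fourier inversion\<close>

lemma integral_lborel_prod:
  fixes f :: "'a::euclidean_space \<Rightarrow> real \<Rightarrow> complex"
  assumes int: "\<And>b. b \<in> Basis \<Longrightarrow> integrable lborel (f b)"
  shows "(LINT x|lborel. (\<Prod>b\<in>Basis. f b (x \<bullet> b))) = (\<Prod>b\<in>Basis. LINT t|lborel. f b t)"
    and "integrable lborel (\<lambda>x::'a. \<Prod>b\<in>Basis. f b (x \<bullet> b))"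
proof -
  have [measurable]: "\<And>b. b \<in> Basis \<Longrightarrow> f b \<in> borel_measurable borel"
    using borel_measurable_integrable[OF int] by simp
  interpret product_sigma_finite "\<lambda>_::'a. lborel :: real measure" ..
  let ?T = "\<lambda>x. \<Sum>b\<in>Basis. x b *\<^sub>R b :: 'a"
  have [measurable]: "?T \<in> borel_measurable (\<Pi>\<^sub>M b\<in>Basis. lborel)" by measurable
  have T: "?T x \<bullet> b = x b" if "b \<in> Basis" for x b
    using that by (simp add: inner_sum_left inner_Basis if_distrib sum.delta cong: if_cong)
  have eq: "(\<Prod>b\<in>Basis. f b (?T x \<bullet> b)) = (\<Prod>b\<in>Basis. f b (x b))" for x
    by (intro prod.cong) (simp_all add: T)
  have [measurable]: "(\<lambda>x::'a. \<Prod>b\<in>Basis. f b (x \<bullet> b)) \<in> borel_measurable borel" by measurable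
  show "(LINT x|lborel. (\<Prod>b\<in>Basis. f b (x \<bullet> b))) = (\<Prod>b\<in>Basis. LINT t|lborel. f b t)"
    by (subst lborel_eq, subst integral_distr) (simp_all only: eq product_integral_prod int finite_Basis, measurable)
  show "integrable lborel (\<lambda>x::'a. \<Prod>b\<in>Basis. f b (x \<bullet> b))"
    by (subst lborel_eq, subst integrable_distr_eq) (simp_all only: eq product_integrable_prod int finite_Basis, measurable)
qed

lemma integral_lborel_affine:
  fixes f :: "'a::euclidean_space \<Rightarrow> complex"
  assumes [measurable]: "f \<in> borel_measurable borel" and "0 < e"
  shows "(LINT y|lborel. f y) = complex_of_real (e ^ DIM('a)) * (LINT z|lborel. f (x + e *\<^sub>R z))"
proof -
  have "(LINT y|lborel. f y) = (LINT y|density (distr lborel borel (\<lambda>z. x + e *\<^sub>R z)) (\<lambda>_. \<bar>e\<bar> ^ DIM('a)). f y)"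
    using assms by (subst lborel_affine[of e x]) (auto simp: ennreal_power)
  also have "\<dots> = (LINT y|distr lborel borel (\<lambda>z. x + e *\<^sub>R z). (\<bar>e\<bar> ^ DIM('a)) *\<^sub>R f y)"
    using assms by (subst integral_density) auto
  also have "\<dots> = (LINT z|lborel. (\<bar>e\<bar> ^ DIM('a)) *\<^sub>R f (x + e *\<^sub>R z))"
    by (subst integral_distr) auto
  finally show ?thesis using assms by (simp add: scaleR_conv_of_real)
qed

lemma integral_std_normal_density_cis:
  "(LINT x|lborel. complex_of_real (std_normal_density x) * cis (t * x)) = complex_of_real (exp (- t\<^sup>2 / 2))"
    and integrable_std_normal_density_cis: "integrable lborel (\<lambda>x. complex_of_real (std_normal_density x) * cis (t * x))"
proof -
  have "char std_normal_distribution t = (LINT x|lborel. std_normal_density x *\<^sub>R iexp (t * x))"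
    unfolding char_def by (subst integral_density) (auto simp: normal_density_nonneg)
  then show "(LINT x|lborel. complex_of_real (std_normal_density x) * cis (t * x)) = complex_of_real (exp (- t\<^sup>2 / 2))"
    by (simp add: char_std_normal_distribution scaleR_conv_of_real cis_conv_exp)
  have "integrable lborel (\<lambda>x. std_normal_density x)" using integrable_normal_density[of 1 0] by simp
  then show "integrable lborel (\<lambda>x. complex_of_real (std_normal_density x) * cis (t * x))"
    by (rule Bochner_Integration.integrable_bound) (auto simp: norm_mult)
qed

text \<open>The standard normal density; its product form reduces the Fourier transform to one
  dimension.\<close>

definition gauss :: "'a::euclidean_space \<Rightarrow> real" where
  "gauss x = (\<Prod>b\<in>Basis. std_normal_density (x \<bullet> b))"

lemma borel_measurable_gauss [measurable]: "gauss \<in> borel_measurable borel"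
  unfolding gauss_def by measurable

lemma norm_sq_Basis: "(norm (x::'a::euclidean_space))\<^sup>2 = (\<Sum>b\<in>Basis. (x \<bullet> b)\<^sup>2)"
  by (subst power2_norm_eq_inner, subst euclidean_inner) (simp add: power2_eq_square)

lemma gauss_eq: "gauss (x::'a::euclidean_space) = gauss (0::'a) * exp (- (norm x)\<^sup>2 / 2)"
proof -
  have "gauss x = (\<Prod>b\<in>Basis. 1 / sqrt (2 * pi) * exp (- (x \<bullet> b)\<^sup>2 / 2))"
    by (simp add: gauss_def std_normal_density_def)
  also have "\<dots> = (\<Prod>b\<in>(Basis::'a set). 1 / sqrt (2 * pi)) * exp (\<Sum>b\<in>(Basis::'a set). - (x \<bullet> b)\<^sup>2 / 2)"
    by (simp only: prod.distrib exp_sum finite_Basis)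
  also have "(\<Sum>b\<in>(Basis::'a set). - (x \<bullet> b)\<^sup>2 / 2) = - (norm x)\<^sup>2 / 2"
    by (simp add: norm_sq_Basis sum_divide_distrib sum_negf)
  finally show ?thesis by (simp add: gauss_def std_normal_density_def)
qed

lemma gauss_pos: "0 < gauss x"
  unfolding gauss_def by (intro prod_pos) (simp add: normal_density_pos)

lemma gauss_le: "gauss (x::'a::euclidean_space) \<le> gauss (0::'a)"
proof -
  have "gauss (0::'a) * exp (- (norm x)\<^sup>2 / 2) \<le> gauss (0::'a) * 1"
    by (intro mult_left_mono) (auto simp: gauss_pos less_imp_le)
  then show ?thesis by (subst gauss_eq) simp
qed

lemma fourier_gauss:
  fixes y :: "'a::euclidean_space"
  shows "(LINT x|lborel. complex_of_real (gauss x) * cis (y \<bullet> x)) = complex_of_real (exp (- (norm y)\<^sup>2 / 2))"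
    and integrable_gauss_cis: "integrable lborel (\<lambda>x. complex_of_real (gauss x) * cis (y \<bullet> x))"
proof -
  have cis_prod: "cis (\<Sum>b\<in>B. f b) = (\<Prod>b\<in>B. cis (f b))" if "finite B" for f and B :: "'a set"
    using that by (induction B) (auto simp: cis_mult[symmetric])
  have eq: "complex_of_real (gauss x) * cis (y \<bullet> x) = (\<Prod>b\<in>Basis. complex_of_real (std_normal_density (x \<bullet> b)) * cis ((y \<bullet> b) * (x \<bullet> b)))" for x
    by (simp add: gauss_def euclidean_inner[of y x] cis_prod prod.distrib)
  show "integrable lborel (\<lambda>x. complex_of_real (gauss x) * cis (y \<bullet> x))"
    unfolding eq by (intro integral_lborel_prod integrable_std_normal_density_cis)
  have "(LINT x|lborel. complex_of_real (gauss x) * cis (y \<bullet> x)) =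
      (\<Prod>b\<in>Basis. LINT t|lborel. complex_of_real (std_normal_density t) * cis ((y \<bullet> b) * t))"
    unfolding eq by (intro integral_lborel_prod integrable_std_normal_density_cis)
  also have "\<dots> = (\<Prod>b\<in>Basis. complex_of_real (exp (- (y \<bullet> b)\<^sup>2 / 2)))"
    by (simp only: integral_std_normal_density_cis)
  also have "\<dots> = complex_of_real (exp (\<Sum>b\<in>Basis. - (y \<bullet> b)\<^sup>2 / 2))"
    by (simp only: exp_sum finite_Basis of_real_prod)
  also have "(\<Sum>b\<in>Basis. - (y \<bullet> b)\<^sup>2 / 2) = - (norm y)\<^sup>2 / 2"
    by (simp add: norm_sq_Basis sum_divide_distrib sum_negf)
  finally show "(LINT x|lborel. complex_of_real (gauss x) * cis (y \<bullet> x)) = complex_of_real (exp (- (norm y)\<^sup>2 / 2))" .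
qed

lemma integrable_gauss: "integrable lborel (gauss :: 'a::euclidean_space \<Rightarrow> real)"
proof -
  have "integrable lborel (\<lambda>x::'a. norm (complex_of_real (gauss x) * cis (0 \<bullet> x)))"
    by (intro integrable_norm integrable_gauss_cis)
  then show ?thesis by (simp add: abs_of_pos[OF gauss_pos])
qed

lemma integral_gauss: "(LINT x|lborel. gauss (x::'a::euclidean_space)) = 1"
proof -
  have "complex_of_real (LINT x|lborel. gauss (x::'a)) = (LINT x|lborel. complex_of_real (gauss (x::'a)) * cis (0 \<bullet> x))"
    by simp
  also have "\<dots> = 1" by (subst fourier_gauss) simp
  finally show ?thesis by simp
qed

text \<open>The inversion integral is damped by \<open>gauss (e \<xi>)\<close>, so that Fubini's
  theorem turns it into a Gaussian average of \<open>\<phi>\<close> at scale \<open>e\<close> around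
  \<open>x\<close>; then \<open>e\<close> tends to 0. An unnamed constant is enough because the
  sampling formula is linear.\<close>

theorem fourier_inversion:
  fixes \<phi> :: "'a::euclidean_space \<Rightarrow> complex"
  assumes cont: "continuous_on UNIV \<phi>" and int: "integrable lborel \<phi>" and bdd: "\<And>x. norm (\<phi> x) \<le> B"
  defines "F \<equiv> \<lambda>\<xi>. LINT x|lborel. cis (- (x \<bullet> \<xi>)) * \<phi> x"
  assumes supp: "\<And>\<xi>. r < norm \<xi> \<Longrightarrow> F \<xi> = 0"
  shows "\<exists>c. \<forall>x. \<phi> x = c * (LINT \<xi>|lborel. cis (x \<bullet> \<xi>) * F \<xi>)" and "integrable lborel F"
proof -
  have [measurable]: "\<phi> \<in> borel_measurable borel" using cont by (rule borel_measurable_continuous_onI)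
  have [measurable]: "(\<lambda>(x::'a, \<xi>). cis (- (x \<bullet> \<xi>)) * \<phi> x) \<in> borel_measurable (borel \<Otimes>\<^sub>M borel)" by measurable
  have Fm [measurable]: "F \<in> borel_measurable borel"
    unfolding F_def by (rule lborel.borel_measurable_lebesgue_integral) measurable
  define K where "K = (LINT x|lborel. norm (\<phi> x))"
  have FK: "norm (F \<xi>) \<le> K" for \<xi>
    unfolding F_def K_def by (rule order_trans[OF integral_norm_bound]) (simp add: norm_mult)
  show intF: "integrable lborel F"
  proof (rule Bochner_Integration.integrable_bound[where f="\<lambda>\<xi>::'a. K * indicator (cball 0 r) \<xi>"])
    show "integrable lborel (\<lambda>\<xi>. K * indicator (cball 0 r :: 'a set) \<xi>)"
      by (intro integrable_mult_right integrable_real_indicator) (auto simp: emeasure_lborel_cball_finite[simplified])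
    show "AE \<xi> in lborel. norm (F \<xi>) \<le> norm (K * indicator (cball 0 r) \<xi>)"
    proof (intro AE_I2)
      fix \<xi>
      have "0 \<le> K" unfolding K_def by simp
      then show "norm (F \<xi>) \<le> norm (K * indicator (cball 0 r) \<xi>)"
        using FK[of \<xi>] supp[of \<xi>] by (cases "norm \<xi> \<le> r") (auto simp: indicator_def)
    qed
  qed measurable
  define E where "E z = exp (- (norm (z::'a))\<^sup>2 / 2)" for z
  have [measurable]: "E \<in> borel_measurable borel" unfolding E_def by measurable
  have E_eq: "E z = gauss z / gauss (0::'a)" for z
    using gauss_pos[of "0::'a"] by (subst gauss_eq) (simp add: E_def)
  have intE: "integrable lborel E" unfolding E_eq by (intro integrable_divide integrable_gauss)
  have IE: "(LINT z|lborel. E z) = 1 / gauss (0::'a)" unfolding E_eq by (simp add: integral_gauss)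
  have key: "(LINT \<xi>|lborel. cis (x \<bullet> \<xi>) * F \<xi> * gauss (e *\<^sub>R \<xi>)) = (LINT z|lborel. \<phi> (x + e *\<^sub>R z) * E z)"
    if e: "0 < e" for x e
  proof -
    have inner: "(LINT \<xi>|lborel. cis (w \<bullet> \<xi>) * gauss (e *\<^sub>R \<xi>)) = E ((1 / e) *\<^sub>R w) / e ^ DIM('a)" for w :: 'a
    proof -
      have "complex_of_real (E ((1 / e) *\<^sub>R w)) = (LINT \<xi>|lborel. complex_of_real (gauss \<xi>) * cis (((1 / e) *\<^sub>R w) \<bullet> \<xi>))"
        unfolding E_def by (rule fourier_gauss(1)[symmetric])
      also have "\<dots> = e ^ DIM('a) * (LINT \<xi>|lborel. complex_of_real (gauss (0 + e *\<^sub>R \<xi>)) * cis (((1 / e) *\<^sub>R w) \<bullet> (0 + e *\<^sub>R \<xi>)))"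
        using e by (intro integral_lborel_affine) auto
      finally show ?thesis using e by (simp add: mult.commute field_simps)
    qed
    have "(LINT \<xi>|lborel. cis (x \<bullet> \<xi>) * F \<xi> * gauss (e *\<^sub>R \<xi>)) =
        (LINT \<xi>|lborel. (LINT y|lborel. \<phi> y * (cis ((x - y) \<bullet> \<xi>) * gauss (e *\<^sub>R \<xi>))))"
    proof (intro Bochner_Integration.integral_cong refl)
      fix \<xi>
      have "cis (x \<bullet> \<xi>) * F \<xi> * gauss (e *\<^sub>R \<xi>) = (LINT y|lborel. (cis (x \<bullet> \<xi>) * gauss (e *\<^sub>R \<xi>)) * (cis (- (y \<bullet> \<xi>)) * \<phi> y))"
        by (simp add: F_def)
      also have "\<dots> = (LINT y|lborel. \<phi> y * (cis ((x - y) \<bullet> \<xi>) * gauss (e *\<^sub>R \<xi>)))"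
      proof (intro Bochner_Integration.integral_cong refl)
        fix y
        have "cis ((x - y) \<bullet> \<xi>) = cis (x \<bullet> \<xi>) * cis (- (y \<bullet> \<xi>))" by (simp add: cis_mult inner_diff_left)
        then show "(cis (x \<bullet> \<xi>) * gauss (e *\<^sub>R \<xi>)) * (cis (- (y \<bullet> \<xi>)) * \<phi> y) = \<phi> y * (cis ((x - y) \<bullet> \<xi>) * gauss (e *\<^sub>R \<xi>))"
          by simp
      qed
      finally show "cis (x \<bullet> \<xi>) * F \<xi> * gauss (e *\<^sub>R \<xi>) = (LINT y|lborel. \<phi> y * (cis ((x - y) \<bullet> \<xi>) * gauss (e *\<^sub>R \<xi>)))" .
    qed
    also have "\<dots> = (LINT y|lborel. (LINT \<xi>|lborel. \<phi> y * (cis ((x - y) \<bullet> \<xi>) * gauss (e *\<^sub>R \<xi>))))"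
    proof (rule lborel_pair.Fubini_integral)
      have ge: "integrable lborel (\<lambda>\<xi>::'a. gauss (e *\<^sub>R \<xi>))"
      proof -
        have "integrable lborel (\<lambda>\<xi>::'a. complex_of_real (gauss (0 + e *\<^sub>R \<xi>)))"
        \<comment> \<open>The Bochner integral of a nonintegrable function is 0, whereas the change
          of variables ties this one to the nonzero integral of \<open>gauss\<close>.\<close>
        proof (rule ccontr)
          assume "\<not> ?thesis"
          then have "(LINT \<xi>|lborel. complex_of_real (gauss (0 + e *\<^sub>R (\<xi>::'a)))) = 0" by (rule not_integrable_integral_eq)
          moreover have "(LINT \<xi>|lborel. complex_of_real (gauss (\<xi>::'a))) = e ^ DIM('a) * (LINT \<xi>|lborel. complex_of_real (gauss (0 + e *\<^sub>R (\<xi>::'a))))"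
            using e by (intro integral_lborel_affine) auto
          ultimately show False by (simp add: integral_gauss)
        qed
        then have "integrable lborel (\<lambda>\<xi>::'a. Re (complex_of_real (gauss (0 + e *\<^sub>R \<xi>))))" by (rule integrable_Re)
        then show ?thesis by simp
      qed
      show "integrable (lborel \<Otimes>\<^sub>M lborel) (\<lambda>(y, \<xi>). \<phi> y * (cis ((x - y) \<bullet> \<xi>) * complex_of_real (gauss (e *\<^sub>R \<xi>))))"
      proof (rule lborel_pair.Fubini_integrable)
        show "integrable lborel (\<lambda>y. LINT \<xi>|lborel. norm (case (y, \<xi>) of (y, \<xi>) \<Rightarrow> \<phi> y * (cis ((x - y) \<bullet> \<xi>) * complex_of_real (gauss (e *\<^sub>R \<xi>)))))"
          using int gauss_pos by (simp add: norm_mult less_imp_le)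
        show "AE y in lborel. integrable lborel (\<lambda>\<xi>. case (y, \<xi>) of (y, \<xi>) \<Rightarrow> \<phi> y * (cis ((x - y) \<bullet> \<xi>) * complex_of_real (gauss (e *\<^sub>R \<xi>))))"
        proof (intro AE_I2)
          fix y
          have "integrable lborel (\<lambda>\<xi>. cis ((x - y) \<bullet> \<xi>) * complex_of_real (gauss (e *\<^sub>R \<xi>)))"
            by (rule Bochner_Integration.integrable_bound[OF ge]) (auto simp: norm_mult)
          then show "integrable lborel (\<lambda>\<xi>. case (y, \<xi>) of (y, \<xi>) \<Rightarrow> \<phi> y * (cis ((x - y) \<bullet> \<xi>) * complex_of_real (gauss (e *\<^sub>R \<xi>))))"
            by simp
        qed
      qed measurable
    qed
    also have "\<dots> = (LINT y|lborel. \<phi> y * (E ((1 / e) *\<^sub>R (x - y)) / e ^ DIM('a)))"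
      by (simp only: integral_mult_right_zero inner)
    also have "\<dots> = e ^ DIM('a) * (LINT z|lborel. \<phi> (x + e *\<^sub>R z) * (E ((1 / e) *\<^sub>R (x - (x + e *\<^sub>R z))) / e ^ DIM('a)))"
      using e by (intro integral_lborel_affine) auto
    also have "\<dots> = (LINT z|lborel. e ^ DIM('a) * (\<phi> (x + e *\<^sub>R z) * (E ((1 / e) *\<^sub>R (x - (x + e *\<^sub>R z))) / e ^ DIM('a))))"
      by simp
    also have "\<dots> = (LINT z|lborel. \<phi> (x + e *\<^sub>R z) * E z)"
      using e by (intro Bochner_Integration.integral_cong) (auto simp: E_def)
    finally show ?thesis .
  qed
  define \<epsilon> where "\<epsilon> j = inverse (real (Suc j))" for j
  have \<epsilon>: "0 < \<epsilon> j" "\<epsilon> \<longlonglongrightarrow> 0" for j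
    using LIMSEQ_inverse_real_of_nat by (auto simp: \<epsilon>_def[abs_def])
  \<comment> \<open>One factor \<open>gauss 0\<close> is the limit of the damping, the other comes
    from the integral of \<open>E\<close>.\<close>
  have "\<phi> x = (gauss (0::'a))\<^sup>2 * (LINT \<xi>|lborel. cis (x \<bullet> \<xi>) * F \<xi>)" for x
  proof -
    have cg: "continuous_on UNIV (gauss :: 'a \<Rightarrow> real)"
      by (subst gauss_eq[abs_def]) (auto intro!: continuous_intros)
    have "(\<lambda>j. LINT \<xi>|lborel. cis (x \<bullet> \<xi>) * F \<xi> * gauss (\<epsilon> j *\<^sub>R \<xi>)) \<longlonglongrightarrow> (LINT \<xi>|lborel. cis (x \<bullet> \<xi>) * F \<xi> * gauss (0::'a))"
    proof (rule integral_dominated_convergence[where w="\<lambda>\<xi>. norm (F \<xi>) * gauss (0::'a)"])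
      show "AE \<xi> in lborel. (\<lambda>j. cis (x \<bullet> \<xi>) * F \<xi> * gauss (\<epsilon> j *\<^sub>R \<xi>)) \<longlonglongrightarrow> cis (x \<bullet> \<xi>) * F \<xi> * gauss (0::'a)"
      proof (intro AE_I2 tendsto_intros)
        fix \<xi> :: 'a
        have "(\<lambda>j. \<epsilon> j *\<^sub>R \<xi>) \<longlonglongrightarrow> 0 *\<^sub>R \<xi>" by (intro tendsto_intros \<epsilon>)
        then show "(\<lambda>j. gauss (\<epsilon> j *\<^sub>R \<xi>)) \<longlonglongrightarrow> gauss (0::'a)"
          using continuous_on_tendsto_compose[OF cg, of _ 0] by simp
      qed
      show "AE \<xi> in lborel. norm (cis (x \<bullet> \<xi>) * F \<xi> * gauss (\<epsilon> j *\<^sub>R \<xi>)) \<le> norm (F \<xi>) * gauss (0::'a)" for j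
        using gauss_le by (auto simp: norm_mult abs_of_pos[OF gauss_pos] intro!: AE_I2 mult_left_mono)
    qed (use intF in \<open>auto intro!: integrable_mult_left integrable_norm\<close>)
    moreover have "(\<lambda>j. LINT z|lborel. \<phi> (x + \<epsilon> j *\<^sub>R z) * E z) \<longlonglongrightarrow> (LINT z|lborel. \<phi> x * E z)"
    proof (rule integral_dominated_convergence[where w="\<lambda>z. B * E z"])
      show "AE z in lborel. (\<lambda>j. \<phi> (x + \<epsilon> j *\<^sub>R z) * E z) \<longlonglongrightarrow> \<phi> x * E z"
      proof (intro AE_I2 tendsto_intros)
        fix z :: 'a
        have "(\<lambda>j. x + \<epsilon> j *\<^sub>R z) \<longlonglongrightarrow> x + 0 *\<^sub>R z" by (intro tendsto_intros \<epsilon>)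
        then show "(\<lambda>j. \<phi> (x + \<epsilon> j *\<^sub>R z)) \<longlonglongrightarrow> \<phi> x"
          using continuous_on_tendsto_compose[OF cont, of _ x] by simp
      qed
      show "AE z in lborel. norm (\<phi> (x + \<epsilon> j *\<^sub>R z) * E z) \<le> B * E z" for j
        using bdd by (auto simp: norm_mult E_def intro!: AE_I2 mult_right_mono)
    qed (use intE in auto)
    ultimately have "(LINT \<xi>|lborel. cis (x \<bullet> \<xi>) * F \<xi> * gauss (0::'a)) = (LINT z|lborel. \<phi> x * E z)"
      using \<epsilon> by (simp add: key LIMSEQ_unique)
    also have "\<dots> = \<phi> x / gauss (0::'a)" by (simp add: IE)
    finally have "(LINT \<xi>|lborel. cis (x \<bullet> \<xi>) * F \<xi>) * gauss (0::'a) = \<phi> x / gauss (0::'a)"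
      by (simp only: integral_mult_left_zero)
    then show ?thesis using gauss_pos[of "0::'a"] by (simp add: divide_simps power2_eq_square mult_ac)
  qed
  then show "\<exists>c. \<forall>x. \<phi> x = c * (LINT \<xi>|lborel. cis (x \<bullet> \<xi>) * F \<xi>)" by blast
qed

section \<open>Sampling of band-limited Schwartz functions\<close>

lemma sum_int_mono:
  fixes a :: "int \<Rightarrow> real"
  assumes "\<And>m. 0 \<le> a m" "L \<le> L'"
  shows "(\<Sum>m\<in>{- int L..int L}. a m) \<le> (\<Sum>m\<in>{- int L'..int L'}. a m)"
  using assms by (intro sum_mono2) auto

lemma norm_int_sum_diff_le:
  fixes c :: "int \<Rightarrow> complex" and a :: "int \<Rightarrow> real"
  assumes "\<And>m. norm (c m) \<le> a m" "L \<le> L'"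
  shows "norm ((\<Sum>m\<in>{- int L'..int L'}. c m) - (\<Sum>m\<in>{- int L..int L}. c m)) \<le>
    (\<Sum>m\<in>{- int L'..int L'}. a m) - (\<Sum>m\<in>{- int L..int L}. a m)"
proof -
  have sub: "{- int L..int L} \<subseteq> {- int L'..int L'}" using assms by auto
  have "(\<Sum>m\<in>{- int L'..int L'}. c m) - (\<Sum>m\<in>{- int L..int L}. c m) = (\<Sum>m\<in>{- int L'..int L'} - {- int L..int L}. c m)"
    using sub by (simp add: sum_diff)
  also have "norm \<dots> \<le> (\<Sum>m\<in>{- int L'..int L'} - {- int L..int L}. a m)"
    by (rule order_trans[OF norm_sum]) (intro sum_mono assms)
  also have "\<dots> = (\<Sum>m\<in>{- int L'..int L'}. a m) - (\<Sum>m\<in>{- int L..int L}. a m)"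
    using sub by (simp add: sum_diff)
  finally show ?thesis .
qed

text \<open>The comparison test for symmetric partial sums: they form a Cauchy sequence because
  those of the majorant do.\<close>

lemma int_series_convergent:
  fixes c :: "int \<Rightarrow> complex" and a :: "int \<Rightarrow> real"
  assumes c: "\<And>m. norm (c m) \<le> a m" and A: "(\<lambda>L. \<Sum>m\<in>{- int L..int L}. a m) \<longlonglongrightarrow> A"
  shows "\<exists>l. (\<lambda>L. \<Sum>m\<in>{- int L..int L}. c m) \<longlonglongrightarrow> l"
proof -
  let ?a = "\<lambda>L::nat. \<Sum>m\<in>{- int L..int L}. a m" and ?c = "\<lambda>L::nat. \<Sum>m\<in>{- int L..int L}. c m"
  have le: "norm (?c L' - ?c L) \<le> norm (?a L' - ?a L)" for L L'
  proof (cases "L \<le> L'")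
    case True
    show ?thesis using norm_int_sum_diff_le[of c a L L'] c True by (simp add: abs_if)
  next
    case False
    then show ?thesis using norm_int_sum_diff_le[of c a L' L] c by (simp add: norm_minus_commute abs_if)
  qed
  have "Cauchy ?a" using A by (simp add: LIMSEQ_imp_Cauchy)
  then have "Cauchy ?c"
    unfolding Cauchy_iff by (meson le le_less_trans)
  then show ?thesis by (simp add: Cauchy_convergent_iff convergent_def)
qed

text \<open>The right-hand side involves the majorant only. Convergence is therefore uniform in all
  parameters on which \<open>a\<close> does not depend, as differentiation and the Schwartz
  seminorms require.\<close>

lemma int_series_tail_le:
  fixes c :: "int \<Rightarrow> complex" and a :: "int \<Rightarrow> real"
  assumes c: "\<And>m. norm (c m) \<le> a m" and A: "(\<lambda>L. \<Sum>m\<in>{- int L..int L}. a m) \<longlonglongrightarrow> A"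
    and l: "(\<lambda>L. \<Sum>m\<in>{- int L..int L}. c m) \<longlonglongrightarrow> l"
  shows "norm (l - (\<Sum>m\<in>{- int L..int L}. c m)) \<le> A - (\<Sum>m\<in>{- int L..int L}. a m)"
proof (rule tendsto_le[OF sequentially_bot])
  show "(\<lambda>L'. norm ((\<Sum>m\<in>{- int L'..int L'}. c m) - (\<Sum>m\<in>{- int L..int L}. c m))) \<longlonglongrightarrow>
      norm (l - (\<Sum>m\<in>{- int L..int L}. c m))"
    by (intro tendsto_intros l)
  show "(\<lambda>L'. (\<Sum>m\<in>{- int L'..int L'}. a m) - (\<Sum>m\<in>{- int L..int L}. a m)) \<longlonglongrightarrow> A - (\<Sum>m\<in>{- int L..int L}. a m)"
    by (intro tendsto_intros A)
  show "\<forall>\<^sub>F L' in sequentially. norm ((\<Sum>m\<in>{- int L'..int L'}. c m) - (\<Sum>m\<in>{- int L..int L}. c m)) \<le>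
      (\<Sum>m\<in>{- int L'..int L'}. a m) - (\<Sum>m\<in>{- int L..int L}. a m)"
    using eventually_ge_at_top[of L] by eventually_elim (intro norm_int_sum_diff_le c)
qed

text \<open>The subtracted term carries the induction: it decreases in each step by at least the two
  summands that are added.\<close>

lemma sum_inverse_square_le: "(\<Sum>m\<in>{- int L..int L}. 1 / (1 + \<bar>real_of_int m\<bar>)\<^sup>2) \<le> 3 - 2 / (real L + 1)"
proof (induction L)
  case (Suc L)
  have set_eq: "{- int (Suc L)..int (Suc L)} = insert (int (Suc L)) (insert (- int (Suc L)) {- int L..int L})" by auto
  have "(\<Sum>m\<in>{- int (Suc L)..int (Suc L)}. 1 / (1 + \<bar>real_of_int m\<bar>)\<^sup>2) =
      (\<Sum>m\<in>{- int L..int L}. 1 / (1 + \<bar>real_of_int m\<bar>)\<^sup>2) + 2 / (real L + 2)\<^sup>2"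
    unfolding set_eq by (subst sum.insert, simp, simp)+ (simp add: algebra_simps)
  moreover have "2 / (real L + 2)\<^sup>2 \<le> 2 / (real L + 1) - 2 / (real (Suc L) + 1)"
  proof -
    have "2 / (real L + 2)\<^sup>2 \<le> 2 / ((real L + 1) * (real L + 2))"
      by (intro divide_left_mono) (auto simp: power2_eq_square intro!: mult_right_mono)
    also have "\<dots> = 2 / (real L + 1) - 2 / (real (Suc L) + 1)" by (simp add: field_simps)
    finally show ?thesis .
  qed
  ultimately show ?case using Suc by simp
qed simp

lemma int_series_weight_convergent:
  fixes a :: "int \<Rightarrow> real"
  assumes a: "\<And>m. 0 \<le> a m" "\<And>m. a m \<le> K / (1 + \<bar>real_of_int m\<bar>)\<^sup>2"
  shows "\<exists>A. (\<lambda>L. \<Sum>m\<in>{- int L..int L}. a m) \<longlonglongrightarrow> A"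
proof -
  have K: "0 \<le> K" using a(1)[of 0] a(2)[of 0] by simp
  have "(\<Sum>m\<in>{- int L..int L}. a m) \<le> K * 3" for L
  proof -
    have "(\<Sum>m\<in>{- int L..int L}. a m) \<le> (\<Sum>m\<in>{- int L..int L}. K * (1 / (1 + \<bar>real_of_int m\<bar>)\<^sup>2))"
      using a by (intro sum_mono) simp
    also have "\<dots> = K * (\<Sum>m\<in>{- int L..int L}. 1 / (1 + \<bar>real_of_int m\<bar>)\<^sup>2)" by (simp add: sum_distrib_left)
    also have "\<dots> \<le> K * 3"
      using K sum_inverse_square_le[of L] by (intro mult_left_mono) (auto intro: order_trans)
    finally show ?thesis .
  qed
  moreover have "incseq (\<lambda>L. \<Sum>m\<in>{- int L..int L}. a m)"
    using a by (intro incseq_SucI sum_int_mono) auto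
  ultimately show ?thesis using incseq_convergent[of _ "K * 3"] by blast
qed

text \<open>\<open>1 + |m| <= (1 + |t|) (1 + |t - m|)\<close> trades growth in \<open>m\<close> for
  kernel decay at \<open>t - m\<close> and a power of \<open>1 + |t|\<close>. The two extra powers
  leave a summable majorant in \<open>m\<close>.\<close>

lemma kernel_weight_le:
  fixes \<psi> :: "real \<Rightarrow> real"
  assumes \<psi>: "\<And>t. \<bar>\<psi> t\<bar> * (1 + \<bar>t\<bar>) ^ (N + 2) \<le> C"
  shows "\<bar>\<psi> (t - m)\<bar> * (1 + \<bar>m\<bar>) ^ N \<le> C * (1 + \<bar>t\<bar>) ^ (N + 2) / (1 + \<bar>m\<bar>)\<^sup>2"
proof -
  have "0 \<le> \<bar>t\<bar> * \<bar>t - m\<bar>" by simp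
  then have "1 + \<bar>m\<bar> \<le> 1 + \<bar>t\<bar> + \<bar>t - m\<bar> + \<bar>t\<bar> * \<bar>t - m\<bar>" by linarith
  also have "\<dots> = (1 + \<bar>t\<bar>) * (1 + \<bar>t - m\<bar>)" by (simp add: algebra_simps)
  finally have "(1 + \<bar>m\<bar>) ^ (N + 2) \<le> ((1 + \<bar>t\<bar>) * (1 + \<bar>t - m\<bar>)) ^ (N + 2)" by (intro power_mono) auto
  then have "\<bar>\<psi> (t - m)\<bar> * (1 + \<bar>m\<bar>) ^ (N + 2) \<le> \<bar>\<psi> (t - m)\<bar> * ((1 + \<bar>t\<bar>) * (1 + \<bar>t - m\<bar>)) ^ (N + 2)"
    by (intro mult_left_mono) auto
  also have "\<dots> = (\<bar>\<psi> (t - m)\<bar> * (1 + \<bar>t - m\<bar>) ^ (N + 2)) * (1 + \<bar>t\<bar>) ^ (N + 2)"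
    by (simp only: power_mult_distrib mult_ac)
  also have "\<dots> \<le> C * (1 + \<bar>t\<bar>) ^ (N + 2)" by (intro mult_right_mono \<psi>) auto
  finally have "(\<bar>\<psi> (t - m)\<bar> * (1 + \<bar>m\<bar>) ^ N) * (1 + \<bar>m\<bar>)\<^sup>2 \<le> C * (1 + \<bar>t\<bar>) ^ (N + 2)"
    by (simp only: power_add mult.assoc)
  moreover have "0 < (1 + \<bar>m\<bar>)\<^sup>2" by (intro zero_less_power) (simp add: add_pos_nonneg)
  ultimately show ?thesis by (simp add: pos_le_divide_eq)
qed

text \<open>The shift \<open>\<sigma>\<close> is arbitrary so that the lattice can move along with
  the point: the coefficients then stay constant under translation in direction \<open>i\<close>.
  This is used for derivatives and for functions of \<open>X - \<kappa> y\<close>.\<close>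

definition samp_fun :: "(real \<Rightarrow> real) \<Rightarrow> (real^'n \<Rightarrow> complex) \<Rightarrow> bool" where
  "samp_fun \<psi> g \<longleftrightarrow> (\<forall>z i \<sigma>. (\<lambda>L. \<Sum>m\<in>{- int L..int L}.
     complex_of_real (\<psi> (z $ i - \<sigma> - of_int m)) * g (upd_coord z i (of_int m + \<sigma>))) \<longlonglongrightarrow> g z)"

lemma upd_coord_eq: "upd_coord z i s = z + (s - z $ i) *\<^sub>R axis i 1"
  by (auto simp: vec_eq_iff axis_def)

text \<open>The formula for exponentials is applied in the coordinate \<open>i\<close> under the
  integral against \<open>F\<close>. A coordinate of a frequency is at most its norm, so the band 2
  is enough, and \<open>K * norm (F \<xi>)\<close> dominates the partial sums.\<close>

lemma samp_fun_band_limited: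
  fixes g :: "real^'n \<Rightarrow> complex"
  assumes \<psi>: "sampling_on 2 \<psi>" and F: "integrable lborel F" "\<And>\<xi>. 2 < norm \<xi> \<Longrightarrow> F \<xi> = 0"
    and g: "\<And>x. g x = c * (LINT \<xi>|lborel. cis (x \<bullet> \<xi>) * F \<xi>)"
  shows "samp_fun \<psi> g"
  unfolding samp_fun_def
proof (intro allI)
  fix z :: "real^'n" and i \<sigma>
  let ?t = "z $ i - \<sigma>"
  have [measurable]: "F \<in> borel_measurable borel" using F(1) by simp
  obtain K where K: "\<And>x L. \<bar>x\<bar> \<le> 2 \<Longrightarrow> norm (spart \<psi> L ?t x) \<le> K"
    and lim: "\<And>x. \<bar>x\<bar> \<le> 2 \<Longrightarrow> (\<lambda>L. spart \<psi> L ?t x) \<longlonglongrightarrow> cis (?t * x)"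
    using \<psi> unfolding sampling_on_def by meson
  have K0: "0 \<le> K" using K[of 0 0] by (auto intro: order_trans[OF norm_ge_zero])
  have small: "\<bar>\<xi> $ i\<bar> \<le> 2" if "norm \<xi> \<le> 2" for \<xi> :: "real^'n"
    using component_le_norm_cart[of \<xi> i] that by simp
  have int: "integrable lborel (\<lambda>\<xi>. cis (x \<bullet> \<xi>) * F \<xi>)" for x
    by (rule Bochner_Integration.integrable_bound[OF F(1)]) (auto simp: norm_mult)
  have eq: "(\<Sum>m\<in>{- int L..int L}. complex_of_real (\<psi> (?t - of_int m)) * g (upd_coord z i (of_int m + \<sigma>))) =
      c * (LINT \<xi>|lborel. cis (z \<bullet> \<xi> - ?t * \<xi> $ i) * spart \<psi> L ?t (\<xi> $ i) * F \<xi>)" for L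
  proof -
    have "(LINT \<xi>|lborel. cis (z \<bullet> \<xi> - ?t * \<xi> $ i) * spart \<psi> L ?t (\<xi> $ i) * F \<xi>) =
      (LINT \<xi>|lborel. (\<Sum>m\<in>{- int L..int L}. complex_of_real (\<psi> (?t - of_int m)) * (cis (upd_coord z i (of_int m + \<sigma>) \<bullet> \<xi>) * F \<xi>)))"
    proof (intro Bochner_Integration.integral_cong refl)
      fix \<xi> :: "real^'n"
      have "cis (z \<bullet> \<xi> - ?t * \<xi> $ i) * cis (of_int m * \<xi> $ i) = cis (upd_coord z i (of_int m + \<sigma>) \<bullet> \<xi>)" for m :: int
        by (simp add: upd_coord_eq cis_mult inner_add_left inner_axis' algebra_simps)
      then show "cis (z \<bullet> \<xi> - ?t * \<xi> $ i) * spart \<psi> L ?t (\<xi> $ i) * F \<xi> =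
        (\<Sum>m\<in>{- int L..int L}. complex_of_real (\<psi> (?t - of_int m)) * (cis (upd_coord z i (of_int m + \<sigma>) \<bullet> \<xi>) * F \<xi>))"
        by (simp only: spart_def sum_distrib_left sum_distrib_right mult.left_commute[of "cis (z \<bullet> \<xi> - ?t * \<xi> $ i)"] mult.assoc)
    qed
    also have "\<dots> = (\<Sum>m\<in>{- int L..int L}. complex_of_real (\<psi> (?t - of_int m)) * (LINT \<xi>|lborel. cis (upd_coord z i (of_int m + \<sigma>) \<bullet> \<xi>) * F \<xi>))"
      using int by (subst Bochner_Integration.integral_sum) (auto intro!: integrable_mult_right)
    finally show ?thesis by (simp add: g sum_distrib_left mult.left_commute)
  qed
  have "(\<lambda>L. LINT \<xi>|lborel. cis (z \<bullet> \<xi> - ?t * \<xi> $ i) * spart \<psi> L ?t (\<xi> $ i) * F \<xi>) \<longlonglongrightarrow> (LINT \<xi>|lborel. cis (z \<bullet> \<xi>) * F \<xi>)"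
  proof (rule integral_dominated_convergence[where w="\<lambda>\<xi>. K * norm (F \<xi>)"])
    show "AE \<xi> in lborel. (\<lambda>L. cis (z \<bullet> \<xi> - ?t * \<xi> $ i) * spart \<psi> L ?t (\<xi> $ i) * F \<xi>) \<longlonglongrightarrow> cis (z \<bullet> \<xi>) * F \<xi>"
    proof (intro AE_I2)
      fix \<xi> :: "real^'n"
      show "(\<lambda>L. cis (z \<bullet> \<xi> - ?t * \<xi> $ i) * spart \<psi> L ?t (\<xi> $ i) * F \<xi>) \<longlonglongrightarrow> cis (z \<bullet> \<xi>) * F \<xi>"
      proof (cases "norm \<xi> \<le> 2")
        case True
        have "(\<lambda>L. cis (z \<bullet> \<xi> - ?t * \<xi> $ i) * spart \<psi> L ?t (\<xi> $ i) * F \<xi>) \<longlonglongrightarrow> cis (z \<bullet> \<xi> - ?t * \<xi> $ i) * cis (?t * \<xi> $ i) * F \<xi>"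
          by (intro tendsto_intros lim small True)
        then show ?thesis by (simp add: cis_mult)
      qed (use F in simp)
    qed
    show "AE \<xi> in lborel. norm (cis (z \<bullet> \<xi> - ?t * \<xi> $ i) * spart \<psi> L ?t (\<xi> $ i) * F \<xi>) \<le> K * norm (F \<xi>)" for L
    proof (intro AE_I2)
      fix \<xi> :: "real^'n"
      show "norm (cis (z \<bullet> \<xi> - ?t * \<xi> $ i) * spart \<psi> L ?t (\<xi> $ i) * F \<xi>) \<le> K * norm (F \<xi>)"
        using F(2)[of \<xi>] K small by (cases "norm \<xi> \<le> 2") (auto simp: norm_mult intro: mult_right_mono)
    qed
    show "(\<lambda>\<xi>. cis (z \<bullet> \<xi> - ?t * \<xi> $ i) * spart \<psi> L ?t (\<xi> $ i) * F \<xi>) \<in> borel_measurable lborel" for L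
      unfolding spart_def by measurable
  qed (use F in \<open>auto intro!: integrable_mult_right integrable_norm\<close>)
  then show "(\<lambda>L. \<Sum>m\<in>{- int L..int L}. complex_of_real (\<psi> (?t - of_int m)) * g (upd_coord z i (of_int m + \<sigma>))) \<longlonglongrightarrow> g z"
    unfolding eq g[of z] by (intro tendsto_intros)
qed

text \<open>Termwise differentiation along the line through \<open>z\<close> in direction
  \<open>j\<close>: the differentiated series has the majorant \<open>\<bar>w m\<bar> * B\<close> at
  every point of the line, so it converges uniformly.\<close>

lemma samp_fun_derivative:
  fixes g :: "real^'n \<Rightarrow> complex"
  assumes \<psi>: "\<And>t. \<bar>\<psi> t\<bar> * (1 + \<bar>t\<bar>) ^ 2 \<le> C" and s: "samp_fun \<psi> g"
    and diff: "\<And>x. g differentiable (at x)"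
    and B: "\<And>x. norm (frechet_derivative g (at x) (axis j 1)) \<le> B"
  shows "samp_fun \<psi> (\<lambda>x. frechet_derivative g (at x) (axis j 1))"
  unfolding samp_fun_def
proof (intro allI)
  fix z :: "real^'n" and i \<sigma>
  define D where "D x = frechet_derivative g (at x) (axis j 1)" for x
  define w where "w m = \<psi> (z $ i - \<sigma> - of_int m)" for m :: int
  define p where "p m = upd_coord z i (of_int m + \<sigma>)" for m :: int
  have B0: "0 \<le> B" using B[of 0] by (auto intro: order_trans[OF norm_ge_zero])
  have lin: "frechet_derivative g (at x) (h *\<^sub>R axis j 1) = h *\<^sub>R D x" for x h
    using linear_frechet_derivative[OF diff[of x]] by (simp add: D_def linear_cmul)
  have der: "((\<lambda>s. g (x + s *\<^sub>R axis j 1)) has_derivative (\<lambda>h. h *\<^sub>R D (x + s *\<^sub>R axis j 1))) (at s)" for x s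
  proof -
    have "(g has_derivative frechet_derivative g (at (x + s *\<^sub>R axis j 1))) (at (x + s *\<^sub>R axis j 1))"
      using diff frechet_derivative_works by blast
    moreover have "((\<lambda>s. x + s *\<^sub>R axis j 1) has_derivative (\<lambda>h. h *\<^sub>R axis j 1)) (at s)"
      by (auto intro!: derivative_eq_intros)
    ultimately show ?thesis using has_derivative_compose by (fastforce simp: lin)
  qed
  have "\<exists>A. (\<lambda>L. \<Sum>m\<in>{- int L..int L}. \<bar>w m\<bar> * B) \<longlonglongrightarrow> A"
  proof (rule int_series_weight_convergent)
    fix m :: int
    have "\<bar>w m\<bar> \<le> C * (1 + \<bar>z $ i - \<sigma>\<bar>)\<^sup>2 / (1 + \<bar>real_of_int m\<bar>)\<^sup>2"
      using kernel_weight_le[of \<psi> 0 C "z $ i - \<sigma>" "of_int m"] \<psi>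
      unfolding w_def by (simp only: add_0 power_0 mult_1_right)
    then have "\<bar>w m\<bar> * B \<le> (C * (1 + \<bar>z $ i - \<sigma>\<bar>)\<^sup>2 / (1 + \<bar>real_of_int m\<bar>)\<^sup>2) * B"
      using B0 by (rule mult_right_mono)
    then show "\<bar>w m\<bar> * B \<le> (C * (1 + \<bar>z $ i - \<sigma>\<bar>)\<^sup>2 * B) / (1 + \<bar>real_of_int m\<bar>)\<^sup>2" by simp
  qed (use B0 in auto)
  then obtain A where A: "(\<lambda>L. \<Sum>m\<in>{- int L..int L}. \<bar>w m\<bar> * B) \<longlonglongrightarrow> A" by blast
  let ?S = "\<lambda>L s. \<Sum>m\<in>{- int L..int L}. complex_of_real (w m) * D (p m + s *\<^sub>R axis j 1)"
  have wB: "norm (complex_of_real (w m) * D x) \<le> \<bar>w m\<bar> * B" for m x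
    using B by (auto simp: norm_mult D_def intro: mult_left_mono)
  have "\<exists>d. \<forall>s. (\<lambda>L. ?S L s) \<longlonglongrightarrow> d s"
    by (intro choice allI int_series_convergent[OF wB A])
  then obtain d where d: "\<And>s. (\<lambda>L. ?S L s) \<longlonglongrightarrow> d s" by blast
  have tail: "norm (d s - ?S L s) \<le> A - (\<Sum>m\<in>{- int L..int L}. \<bar>w m\<bar> * B)" for s L
    by (rule int_series_tail_le[OF wB A d])
  have lim: "(\<lambda>L. \<Sum>m\<in>{- int L..int L}. complex_of_real (w m) * g (p m + t *\<^sub>R axis j 1)) \<longlonglongrightarrow> g (z + t *\<^sub>R axis j 1)" for t
  proof -
    have "(\<lambda>L. \<Sum>m\<in>{- int L..int L}. complex_of_real (\<psi> ((z + t *\<^sub>R axis j 1) $ i - \<sigma>' - of_int m)) *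
       g (upd_coord (z + t *\<^sub>R axis j 1) i (of_int m + \<sigma>'))) \<longlonglongrightarrow> g (z + t *\<^sub>R axis j 1)" for \<sigma>'
      using s unfolding samp_fun_def by blast
    \<comment> \<open>When the line runs in the sampled direction the lattice moves too, so the
      coefficients \<open>w m\<close> do not depend on \<open>t\<close>.\<close>
    from this[of "if j = i then \<sigma> + t else \<sigma>"] show ?thesis
    proof (rule back_subst[of "\<lambda>f. f \<longlonglongrightarrow> _"], intro ext sum.cong refl)
      fix m :: int
      have "(z + t *\<^sub>R axis j 1) $ i - (if j = i then \<sigma> + t else \<sigma>) - of_int m = z $ i - \<sigma> - of_int m"
        by (simp add: axis_def)
      moreover have "upd_coord (z + t *\<^sub>R axis j 1) i (of_int m + (if j = i then \<sigma> + t else \<sigma>)) = p m + t *\<^sub>R axis j 1"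
        by (auto simp: p_def vec_eq_iff axis_def)
      ultimately show "complex_of_real (\<psi> ((z + t *\<^sub>R axis j 1) $ i - (if j = i then \<sigma> + t else \<sigma>) - of_int m)) *
         g (upd_coord (z + t *\<^sub>R axis j 1) i (of_int m + (if j = i then \<sigma> + t else \<sigma>))) =
         complex_of_real (w m) * g (p m + t *\<^sub>R axis j 1)"
        by (simp only: w_def)
    qed
  qed
  have "\<exists>G. \<forall>t\<in>UNIV. (\<lambda>L. \<Sum>m\<in>{- int L..int L}. complex_of_real (w m) * g (p m + t *\<^sub>R axis j 1)) \<longlonglongrightarrow> G t \<and>
      (G has_derivative (\<lambda>h. h *\<^sub>R d t)) (at t within UNIV)"
  proof (rule has_derivative_sequence[where ?x0.0=0 and f'="\<lambda>L t h. h *\<^sub>R ?S L t", OF convex_UNIV])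
    show "((\<lambda>t. \<Sum>m\<in>{- int L..int L}. complex_of_real (w m) * g (p m + t *\<^sub>R axis j 1)) has_derivative (\<lambda>h. h *\<^sub>R ?S L t)) (at t within UNIV)" for L t
    proof -
      have "((\<lambda>t. \<Sum>m\<in>{- int L..int L}. complex_of_real (w m) * g (p m + t *\<^sub>R axis j 1)) has_derivative
        (\<lambda>h. \<Sum>m\<in>{- int L..int L}. complex_of_real (w m) * (h *\<^sub>R D (p m + t *\<^sub>R axis j 1)))) (at t)"
        by (intro has_derivative_sum has_derivative_mult_right der)
      then show ?thesis by (simp add: scaleR_sum_right)
    qed
    show "(\<lambda>L. \<Sum>m\<in>{- int L..int L}. complex_of_real (w m) * g (p m + 0 *\<^sub>R axis j 1)) \<longlonglongrightarrow> g (z + 0 *\<^sub>R axis j 1)"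
      by (rule lim)
    fix e :: real assume e: "0 < e"
    have "\<forall>\<^sub>F L in sequentially. A - (\<Sum>m\<in>{- int L..int L}. \<bar>w m\<bar> * B) < e"
      using order_tendstoD(2)[OF tendsto_diff[OF tendsto_const A, of A], of e] e by simp
    then show "\<forall>\<^sub>F L in sequentially. \<forall>t\<in>UNIV. \<forall>h. norm (h *\<^sub>R ?S L t - h *\<^sub>R d t) \<le> e * norm h"
    proof eventually_elim
      case (elim L)
      show ?case
      proof (intro ballI allI)
        fix t h :: real
        have "norm (h *\<^sub>R ?S L t - h *\<^sub>R d t) = \<bar>h\<bar> * norm (d t - ?S L t)"
          by (simp add: norm_minus_commute flip: scaleR_diff_right)
        also have "\<dots> \<le> \<bar>h\<bar> * e" using tail[of t L] elim by (intro mult_left_mono) auto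
        finally show "norm (h *\<^sub>R ?S L t - h *\<^sub>R d t) \<le> e * norm h" by (simp add: mult.commute)
      qed
    qed
  qed simp
  then obtain G where G: "\<And>t. (\<lambda>L. \<Sum>m\<in>{- int L..int L}. complex_of_real (w m) * g (p m + t *\<^sub>R axis j 1)) \<longlonglongrightarrow> G t"
    "\<And>t. (G has_derivative (\<lambda>h. h *\<^sub>R d t)) (at t)" by auto
  have "G = (\<lambda>t. g (z + t *\<^sub>R axis j 1))"
    using LIMSEQ_unique[OF G(1) lim] by blast
  then have "(\<lambda>h. h *\<^sub>R d 0) = (\<lambda>h. h *\<^sub>R D (z + 0 *\<^sub>R axis j 1))"
    using has_derivative_unique[OF G(2)[of 0]] der[of z 0] by auto
  then have "d 0 = D z" by (metis add.right_neutral scaleR_one scaleR_zero_left)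
  then show "(\<lambda>L. \<Sum>m\<in>{- int L..int L}. complex_of_real (\<psi> (z $ i - \<sigma> - of_int m)) *
     frechet_derivative g (at (upd_coord z i (of_int m + \<sigma>))) (axis j 1)) \<longlonglongrightarrow> frechet_derivative g (at z) (axis j 1)"
    using d[of 0] by (simp add: w_def p_def D_def)
qed

section \<open>Bounds and integrability of Schwartz functions\<close>

lemma schwartz_bound:
  assumes "g \<in> schwartz"
  obtains B where "\<And>x. (1 + norm x) ^ N * norm (partials js g x) \<le> B"
proof -
  have "bounded (range (\<lambda>x. (1 + norm x) ^ N * norm (partials js g x)))"
    using assms by (simp add: schwartz_def)
  then obtain B where "\<And>x. norm ((1 + norm x) ^ N * norm (partials js g x)) \<le> B"
    by (auto simp: bounded_iff)
  then show ?thesis using that[of B] by (metis abs_le_D1 real_norm_def)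
qed

lemma schwartz_bound':
  assumes "g \<in> schwartz"
  obtains B where "\<And>x. norm (partials js g x) \<le> B"
  using schwartz_bound[OF assms, of 0 js] by auto

lemma schwartz_differentiable: "g \<in> schwartz \<Longrightarrow> partials js g differentiable (at x)"
  by (simp add: schwartz_def)

lemma schwartz_integrable:
  fixes g :: "real^'n \<Rightarrow> complex"
  assumes "g \<in> schwartz"
  shows "continuous_on UNIV g" and "integrable lborel g"
proof -
  show cont: "continuous_on UNIV g"
    using schwartz_differentiable[OF assms, of "[]"]
    by (auto intro!: continuous_at_imp_continuous_on differentiable_imp_continuous_within)
  let ?n = "DIM(real^'n)"
  let ?h = "\<lambda>x::real^'n. \<Prod>b\<in>Basis. ((1 + \<bar>x \<bullet> b\<bar>) powr (- 2))"
  obtain B where B: "\<And>x. (1 + norm x) ^ (2 * ?n) * norm (g x) \<le> B"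
    using schwartz_bound[OF assms, of "2 * ?n" "[]"] by auto
  have B0: "0 \<le> B" using B[of 0] by (auto intro: order_trans[OF norm_ge_zero])
  have le: "norm (g x) \<le> B * ?h x" for x
  proof -
    have "(\<Prod>b\<in>Basis. (1 + \<bar>x \<bullet> b\<bar>)\<^sup>2) \<le> (\<Prod>b\<in>(Basis::(real^'n) set). (1 + norm x)\<^sup>2)"
      by (intro prod_mono conjI power_mono add_left_mono Basis_le_norm) auto
    also have "\<dots> = (1 + norm x) ^ (2 * ?n)" by (simp add: power_mult)
    finally have p: "(\<Prod>b\<in>Basis. (1 + \<bar>x \<bullet> b\<bar>)\<^sup>2) * norm (g x) \<le> B"
      using B[of x] by (meson mult_right_mono norm_ge_zero order_trans)
    have pos: "0 < (\<Prod>b\<in>Basis. (1 + \<bar>x \<bullet> b\<bar>)\<^sup>2)"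
      by (intro prod_pos zero_less_power) (simp add: add_pos_nonneg)
    have "?h x = (\<Prod>b\<in>Basis. 1 / (1 + \<bar>x \<bullet> b\<bar>)\<^sup>2)"
      by (intro prod.cong) (auto simp: powr_minus_divide powr_realpow add_pos_nonneg)
    also have "\<dots> = 1 / (\<Prod>b\<in>Basis. (1 + \<bar>x \<bullet> b\<bar>)\<^sup>2)" by (simp add: prod_dividef)
    finally show ?thesis using p pos by (simp add: pos_le_divide_eq mult.commute)
  qed
  have "(\<integral>\<^sup>+x. ennreal (norm (g x)) \<partial>lborel) \<le> (\<integral>\<^sup>+x. ennreal B * (\<Prod>b\<in>Basis. ennreal ((1 + \<bar>(x :: real^'n) \<bullet> b\<bar>) powr (- 2))) \<partial>lborel)"
    using le B0 by (intro nn_integral_mono) (auto simp: prod_ennreal ennreal_mult[symmetric] prod_nonneg)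
  also have "\<dots> = ennreal B * (\<Prod>b\<in>(Basis::(real^'n) set). \<integral>\<^sup>+t. ennreal ((1 + \<bar>t\<bar>) powr (- 2)) \<partial>lborel)"
    using nn_integral_lborel_prod[of "\<lambda>(_::real^'n) t. ennreal ((1 + \<bar>t\<bar>) powr (- 2))"]
    by (subst nn_integral_cmult) auto
  also have "\<dots> \<le> ennreal B * (\<Prod>b\<in>(Basis::(real^'n) set). 2)"
    by (intro mult_left_mono prod_mono_ennreal nn_integral_decay_le) auto
  also have "\<dots> < \<infinity>" by (simp add: ennreal_mult_less_top power_less_top_ennreal)
  finally show "integrable lborel g"
    using borel_measurable_continuous_onI[OF cont] by (simp add: integrable_iff_bounded)
qed

lemma samp_fun_partials:
  fixes g :: "real^'n \<Rightarrow> complex"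
  assumes \<psi>: "sampling_on 2 \<psi>" "\<And>t. \<bar>\<psi> t\<bar> * (1 + \<bar>t\<bar>) ^ 2 \<le> C"
    and g: "g \<in> schwartz" "\<And>\<xi>. 2 < norm \<xi> \<Longrightarrow> fourier g \<xi> = 0"
  shows "samp_fun \<psi> (partials js g)"
proof (induction js)
  case Nil
  obtain B where B: "\<And>x. norm (g x) \<le> B" using schwartz_bound'[OF g(1), of "[]"] by auto
  have F0: "(LINT x|lborel. cis (- (x \<bullet> \<xi>)) * g x) = 0" if "2 < norm \<xi>" for \<xi>
    using g(2)[OF that] by (auto simp: fourier_def)
  note inv = fourier_inversion[OF schwartz_integrable[OF g(1)] B F0]
  obtain c where c: "\<forall>x. g x = c * (LINT \<xi>|lborel. cis (x \<bullet> \<xi>) * (LINT x|lborel. cis (- (x \<bullet> \<xi>)) * g x))"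
    using inv(1) by (rule exE)
  show ?case
    unfolding partials.simps by (rule samp_fun_band_limited[OF \<psi>(1) inv(2) F0 c[rule_format]])
next
  case (Cons j js)
  obtain B where B: "\<And>x. norm (partials (j # js) g x) \<le> B" using schwartz_bound'[OF g(1)] by blast
  show ?case
    unfolding partials.simps
    by (rule samp_fun_derivative[OF \<psi>(2) Cons.IH schwartz_differentiable[OF g(1)]]) (use B in simp)
qed

section \<open>Sampling of mollified tempered distributions\<close>

lemma partials_affine:
  fixes f :: "real^'n \<Rightarrow> complex"
  assumes f: "f \<in> schwartz"
  shows "partials js (\<lambda>y. f (X + c *\<^sub>R y)) = (\<lambda>y. complex_of_real (c ^ length js) * partials js f (X + c *\<^sub>R y))"
    and "partials js (\<lambda>y. f (X + c *\<^sub>R y)) differentiable (at x)"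
proof -
  have der: "((\<lambda>y. complex_of_real (c ^ length js) * partials js f (X + c *\<^sub>R y)) has_derivative
      (\<lambda>h. complex_of_real (c ^ length js) * (c *\<^sub>R frechet_derivative (partials js f) (at (X + c *\<^sub>R x)) h))) (at x)" for js x
  proof -
    have "(partials js f has_derivative frechet_derivative (partials js f) (at (X + c *\<^sub>R x))) (at (X + c *\<^sub>R x))"
      using schwartz_differentiable[OF f] frechet_derivative_works by blast
    moreover have "((\<lambda>y. X + c *\<^sub>R y) has_derivative (\<lambda>h. c *\<^sub>R h)) (at x)"
      by (auto intro!: derivative_eq_intros)
    ultimately have "((\<lambda>y. partials js f (X + c *\<^sub>R y)) has_derivative (\<lambda>h. frechet_derivative (partials js f) (at (X + c *\<^sub>R x)) (c *\<^sub>R h))) (at x)"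
      by (rule has_derivative_compose[rotated])
    then have "((\<lambda>y. partials js f (X + c *\<^sub>R y)) has_derivative (\<lambda>h. c *\<^sub>R frechet_derivative (partials js f) (at (X + c *\<^sub>R x)) h)) (at x)"
      using linear_frechet_derivative[OF schwartz_differentiable[OF f, of js "X + c *\<^sub>R x"]] by (simp add: linear_cmul)
    then show ?thesis by (rule has_derivative_mult_right)
  qed
  have eq: "partials js (\<lambda>y. f (X + c *\<^sub>R y)) = (\<lambda>y. complex_of_real (c ^ length js) * partials js f (X + c *\<^sub>R y))" for js
  proof (induction js)
    case (Cons j js)
    have "frechet_derivative (\<lambda>y. complex_of_real (c ^ length js) * partials js f (X + c *\<^sub>R y)) (at x) (axis j 1) =
        complex_of_real (c ^ length js) * (c *\<^sub>R frechet_derivative (partials js f) (at (X + c *\<^sub>R x)) (axis j 1))" for x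
      using frechet_derivative_at[OF der[of js x], symmetric] by simp
    then show ?case unfolding partials.simps Cons by (simp only:) (simp add: scaleR_conv_of_real mult_ac)
  qed simp
  show "partials js (\<lambda>y. f (X + c *\<^sub>R y)) = (\<lambda>y. complex_of_real (c ^ length js) * partials js f (X + c *\<^sub>R y))"
    by (rule eq)
  show "partials js (\<lambda>y. f (X + c *\<^sub>R y)) differentiable (at x)"
    unfolding eq using der differentiableI by blast
qed

text \<open>Allows a weight in \<open>y\<close> to be absorbed by the decay of a function of
  \<open>X + c y\<close>, at a polynomial price in \<open>X\<close>.\<close>

lemma one_plus_norm_le:
  fixes X y :: "'a::real_normed_vector"
  assumes "1 \<le> \<bar>c\<bar>"
  shows "1 + norm y \<le> (1 + norm X) * (1 + norm (X + c *\<^sub>R y))"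
proof -
  have "norm y \<le> norm (c *\<^sub>R y)" using assms by (simp add: mult_le_cancel_right1)
  also have "\<dots> \<le> norm (X + c *\<^sub>R y) + norm X" by (metis add_diff_cancel_left' norm_triangle_ineq4)
  also have "\<dots> \<le> norm X + norm (X + c *\<^sub>R y) + norm X * norm (X + c *\<^sub>R y)" by simp
  finally show ?thesis by (simp add: algebra_simps)
qed

lemma schwartz_affine_bound:
  fixes f :: "real^'n \<Rightarrow> complex"
  assumes "1 \<le> \<bar>c\<bar>" and B: "\<And>x. (1 + norm x) ^ N * norm (partials js f x) \<le> B"
  shows "(1 + norm y) ^ N * norm (partials js f (X + c *\<^sub>R y)) \<le> (1 + norm X) ^ N * B"
proof -
  have "(1 + norm y) ^ N * norm (partials js f (X + c *\<^sub>R y)) \<le>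
      ((1 + norm X) * (1 + norm (X + c *\<^sub>R y))) ^ N * norm (partials js f (X + c *\<^sub>R y))"
    using one_plus_norm_le[OF assms(1), of y X] by (intro mult_right_mono power_mono) auto
  also have "\<dots> = (1 + norm X) ^ N * ((1 + norm (X + c *\<^sub>R y)) ^ N * norm (partials js f (X + c *\<^sub>R y)))"
    by (simp add: power_mult_distrib)
  also have "\<dots> \<le> (1 + norm X) ^ N * B" by (intro mult_left_mono B) auto
  finally show ?thesis .
qed

lemma schwartz_affine:
  fixes f :: "real^'n \<Rightarrow> complex"
  assumes f: "f \<in> schwartz" and c: "1 \<le> \<bar>c\<bar>"
  shows "(\<lambda>y. f (X + c *\<^sub>R y)) \<in> schwartz"
  unfolding schwartz_def mem_Collect_eq
proof (intro conjI allI)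
  fix N js
  obtain B where B: "\<And>x. (1 + norm x) ^ N * norm (partials js f x) \<le> B"
    using schwartz_bound[OF f] by blast
  have "(1 + norm y) ^ N * norm (partials js (\<lambda>y. f (X + c *\<^sub>R y)) y) \<le> \<bar>c\<bar> ^ length js * ((1 + norm X) ^ N * B)" for y
  proof -
    have "(1 + norm y) ^ N * norm (partials js (\<lambda>y. f (X + c *\<^sub>R y)) y) =
        \<bar>c\<bar> ^ length js * ((1 + norm y) ^ N * norm (partials js f (X + c *\<^sub>R y)))"
      by (simp add: partials_affine(1)[OF f] norm_mult norm_power power_abs mult_ac)
    also have "\<dots> \<le> \<bar>c\<bar> ^ length js * ((1 + norm X) ^ N * B)"
      by (intro mult_left_mono schwartz_affine_bound[OF c B]) auto
    finally show ?thesis .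
  qed
  then show "bounded (range (\<lambda>x. (1 + norm x) ^ N * norm (partials js (\<lambda>y. f (X + c *\<^sub>R y)) x)))"
    by (intro boundedI) auto
qed (rule partials_affine(2)[OF f])

lemma partials_lincomb:
  fixes f h :: "real^'n \<Rightarrow> complex"
  assumes f: "f \<in> schwartz" and h: "h \<in> schwartz"
  shows "partials js (\<lambda>x. a * f x + b * h x) = (\<lambda>x. a * partials js f x + b * partials js h x)"
    and "partials js (\<lambda>x. a * f x + b * h x) differentiable (at x)"
proof -
  have der: "((\<lambda>x. a * partials js f x + b * partials js h x) has_derivative
      (\<lambda>v. a * frechet_derivative (partials js f) (at x) v + b * frechet_derivative (partials js h) (at x) v)) (at x)" for js x
    using schwartz_differentiable[OF f] schwartz_differentiable[OF h] frechet_derivative_works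
    by (intro has_derivative_add has_derivative_mult_right) blast+
  have eq: "partials js (\<lambda>x. a * f x + b * h x) = (\<lambda>x. a * partials js f x + b * partials js h x)" for js
  proof (induction js)
    case (Cons j js)
    show ?case
      using frechet_derivative_at[OF der[of js], symmetric] by (simp add: Cons)
  qed simp
  show "partials js (\<lambda>x. a * f x + b * h x) = (\<lambda>x. a * partials js f x + b * partials js h x)"
    by (rule eq)
  show "partials js (\<lambda>x. a * f x + b * h x) differentiable (at x)"
    unfolding eq using der differentiableI by blast
qed

lemma schwartz_lincomb:
  fixes f h :: "real^'n \<Rightarrow> complex"
  assumes f: "f \<in> schwartz" and h: "h \<in> schwartz"
  shows "(\<lambda>x. a * f x + b * h x) \<in> schwartz"
  unfolding schwartz_def mem_Collect_eq
proof (intro conjI allI)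
  fix N js
  obtain B1 where B1: "\<And>x. (1 + norm x) ^ N * norm (partials js f x) \<le> B1"
    using schwartz_bound[OF f] by blast
  obtain B2 where B2: "\<And>x. (1 + norm x) ^ N * norm (partials js h x) \<le> B2"
    using schwartz_bound[OF h] by blast
  have "(1 + norm x) ^ N * norm (partials js (\<lambda>x. a * f x + b * h x) x) \<le> norm a * B1 + norm b * B2" for x
  proof -
    have "(1 + norm x) ^ N * norm (partials js (\<lambda>x. a * f x + b * h x) x) \<le>
        (1 + norm x) ^ N * (norm a * norm (partials js f x) + norm b * norm (partials js h x))"
      unfolding partials_lincomb(1)[OF f h]
      by (intro mult_left_mono order_trans[OF norm_triangle_ineq]) (auto simp: norm_mult)
    also have "\<dots> = norm a * ((1 + norm x) ^ N * norm (partials js f x)) + norm b * ((1 + norm x) ^ N * norm (partials js h x))"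
      by (simp add: algebra_simps)
    also have "\<dots> \<le> norm a * B1 + norm b * B2" by (intro add_mono mult_left_mono B1 B2) auto
    finally show ?thesis .
  qed
  then show "bounded (range (\<lambda>x. (1 + norm x) ^ N * norm (partials js (\<lambda>x. a * f x + b * h x) x)))"
    by (intro boundedI) auto
qed (rule partials_lincomb(2)[OF f h])

lemma tempered_linear:
  "T \<in> tempered_distributions \<Longrightarrow> f \<in> schwartz \<Longrightarrow> g \<in> schwartz \<Longrightarrow> T (\<lambda>x. a * f x + b * g x) = a * T f + b * T g"
  by (simp add: tempered_distributions_def)

text \<open>The three claims share one induction because differentiating the enlarged sum, or
  applying \<open>T\<close> to it, requires the previous sum to be a Schwartz function.\<close>

lemma schwartz_sum:
  fixes f :: "real^'n \<Rightarrow> complex"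
  assumes "finite F" and f: "f \<in> schwartz" and g: "\<And>m. g m \<in> schwartz"
  shows "(\<lambda>y. f y + (\<Sum>m\<in>F. c m * g m y)) \<in> schwartz \<and>
    (\<forall>js. partials js (\<lambda>y. f y + (\<Sum>m\<in>F. c m * g m y)) = (\<lambda>y. partials js f y + (\<Sum>m\<in>F. c m * partials js (g m) y))) \<and>
    (\<forall>T\<in>tempered_distributions. T (\<lambda>y. f y + (\<Sum>m\<in>F. c m * g m y)) = T f + (\<Sum>m\<in>F. c m * T (g m)))"
  using assms(1)
proof induction
  case (insert m F)
  let ?R = "\<lambda>y. f y + (\<Sum>m\<in>F. c m * g m y)"
  from insert.IH have R: "?R \<in> schwartz" by blast
  have eq: "(\<lambda>y. f y + (\<Sum>m\<in>insert m F. c m * g m y)) = (\<lambda>y. 1 * ?R y + c m * g m y)"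
    using insert.hyps by (simp add: fun_eq_iff)
  show ?case
    unfolding eq
  proof (intro conjI allI ballI)
    show "(\<lambda>y. 1 * ?R y + c m * g m y) \<in> schwartz" by (rule schwartz_lincomb[OF R g])
    show "partials js (\<lambda>y. 1 * ?R y + c m * g m y) = (\<lambda>y. partials js f y + (\<Sum>m\<in>insert m F. c m * partials js (g m) y))" for js
      using insert by (simp only: partials_lincomb(1)[OF R g]) (simp add: fun_eq_iff)
    show "T (\<lambda>y. 1 * ?R y + c m * g m y) = T f + (\<Sum>m\<in>insert m F. c m * T (g m))" if "T \<in> tempered_distributions" for T
      using insert that by (simp only: tempered_linear[OF that R g]) simp
  qed
qed (use f in simp)

text \<open>A supremum of reals is meaningful only for a bounded nonempty set; the hypothesis bounds
  it. The absolute value is for use with a continuity constant of unknown sign.\<close>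

lemma schwartz_seminorm_le:
  fixes f :: "real^'n \<Rightarrow> complex"
  assumes "\<And>js x. length js \<le> N \<Longrightarrow> (1 + norm x) ^ N * norm (partials js f x) \<le> b"
  shows "\<bar>schwartz_seminorm N f\<bar> \<le> b"
proof -
  let ?S = "(\<lambda>(js, x). (1 + norm x) ^ N * norm (partials js f x)) ` ({js. length js \<le> N} \<times> UNIV)"
  have ne: "([], 0) \<in> {js. length js \<le> N} \<times> UNIV" by simp
  have le: "z \<le> b" if "z \<in> ?S" for z using that assms by auto
  have "Sup ?S \<le> b" by (rule cSup_least) (use ne le in blast)+
  moreover have "0 \<le> Sup ?S"
  proof (rule order_trans)
    show "0 \<le> (case ([], 0) of (js, x) \<Rightarrow> (1 + norm x) ^ N * norm (partials js f x))" by simp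
    show "(case ([], 0) of (js, x) \<Rightarrow> (1 + norm x) ^ N * norm (partials js f x)) \<le> Sup ?S"
    proof (rule cSup_upper)
      show "bdd_above ?S" by (rule bdd_aboveI) (rule le)
    qed (use ne in blast)
  qed
  ultimately show ?thesis by (simp add: schwartz_seminorm_def)
qed

text \<open>The sampling formula converges in the Schwartz topology, so that a tempered distribution can be applied
  term by term; \<open>N\<close> is the order of the distribution.\<close>

lemma samp_fun_tempered:
  fixes g :: "real^'n \<Rightarrow> complex"
  assumes T: "T \<in> tempered_distributions"
    and ord: "\<And>f. f \<in> schwartz \<Longrightarrow> norm (T f) \<le> K * schwartz_seminorm N f"
    and g: "g \<in> schwartz" and \<kappa>: "1 \<le> \<kappa>"
    and \<psi>: "\<And>t. \<bar>\<psi> t\<bar> * (1 + \<bar>t\<bar>) ^ (N + 2) \<le> C"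
    and samp: "\<And>js. samp_fun \<psi> (partials js g)"
  shows "samp_fun \<psi> (\<lambda>X. T (\<lambda>y. g (X + (- \<kappa>) *\<^sub>R y)))"
  unfolding samp_fun_def
proof (intro allI)
  fix X :: "real^'n" and i \<sigma>
  define u where "u X = T (\<lambda>y. g (X + (- \<kappa>) *\<^sub>R y))" for X
  define w where "w m = \<psi> (X $ i - \<sigma> - of_int m)" for m :: int
  define p where "p m = upd_coord X i (of_int m + \<sigma>)" for m :: int
  have c1: "1 \<le> \<bar>- \<kappa>\<bar>" using \<kappa> by simp
  have "\<forall>js. \<exists>B. \<forall>x. (1 + norm x) ^ N * norm (partials js g x) \<le> B"
    using schwartz_bound[OF g] by metis
  then obtain Bf where Bf: "\<And>js x. (1 + norm x) ^ N * norm (partials js g x) \<le> Bf js" by metis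
  have Bf0: "0 \<le> Bf js" for js using Bf[of 0 js] by (rule order_trans[rotated]) simp
  have fin: "finite {js :: 'n list. length js \<le> N}"
    using finite_lists_length_le[of "UNIV :: 'n set" N] by simp
  define B where "B = (\<Sum>js\<in>{js :: 'n list. length js \<le> N}. Bf js)"
  have B0: "0 \<le> B" unfolding B_def by (intro sum_nonneg Bf0)
  have B: "(1 + norm x) ^ N * norm (partials js g x) \<le> B" if "length js \<le> N" for js x
  proof -
    have "Bf js \<le> B" unfolding B_def using that fin Bf0 by (intro member_le_sum) auto
    then show ?thesis using Bf[of x js] by simp
  qed
  \<comment> \<open>Up to \<open>\<kappa>^N\<close> this dominates the \<open>m\<close>-th term in
    the seminorm of order \<open>N\<close>, uniformly in \<open>y\<close> and in the derivative.
    Translation by \<open>p m\<close> costs a power of \<open>1 + norm (p m)\<close>, which the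
    decay of \<open>\<psi>\<close> absorbs.\<close>
  define a where "a m = \<bar>w m\<bar> * ((1 + norm (p m)) ^ N * B)" for m
  have "\<exists>A. (\<lambda>L. \<Sum>m\<in>{- int L..int L}. a m) \<longlonglongrightarrow> A"
  proof (rule int_series_weight_convergent)
    fix m :: int
    show "0 \<le> a m" using B0 by (simp add: a_def)
    let ?E = "1 + 2 * norm X + \<bar>\<sigma>\<bar>"
    have "norm (p m) \<le> norm X + \<bar>of_int m + \<sigma> - X $ i\<bar>"
      unfolding p_def upd_coord_eq by (rule order_trans[OF norm_triangle_ineq]) (simp add: norm_eq_sqrt_inner[of "axis i 1"] inner_axis_axis)
    also have "\<dots> \<le> 2 * norm X + \<bar>\<sigma>\<bar> + \<bar>real_of_int m\<bar>"
      using component_le_norm_cart[of X i] by linarith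
    also have "1 + \<dots> \<le> ?E * (1 + \<bar>real_of_int m\<bar>)"
    proof -
      have "0 \<le> (2 * norm X + \<bar>\<sigma>\<bar>) * \<bar>real_of_int m\<bar>" by simp
      then show ?thesis by (simp add: algebra_simps)
    qed
    finally have "(1 + norm (p m)) ^ N \<le> (?E * (1 + \<bar>real_of_int m\<bar>)) ^ N" by (intro power_mono) auto
    then have "a m \<le> \<bar>w m\<bar> * ((?E * (1 + \<bar>real_of_int m\<bar>)) ^ N * B)"
      unfolding a_def using B0 by (intro mult_left_mono mult_right_mono) auto
    also have "\<dots> = (\<bar>w m\<bar> * (1 + \<bar>real_of_int m\<bar>) ^ N) * (?E ^ N * B)"
      by (simp only: power_mult_distrib mult_ac)
    also have "\<dots> \<le> (C * (1 + \<bar>X $ i - \<sigma>\<bar>) ^ (N + 2) / (1 + \<bar>real_of_int m\<bar>)\<^sup>2) * (?E ^ N * B)"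
      unfolding w_def using B0 \<psi> by (intro mult_right_mono kernel_weight_le) auto
    finally show "a m \<le> (C * (1 + \<bar>X $ i - \<sigma>\<bar>) ^ (N + 2) * (?E ^ N * B)) / (1 + \<bar>real_of_int m\<bar>)\<^sup>2"
      by simp
  qed
  then obtain A where A: "(\<lambda>L. \<Sum>m\<in>{- int L..int L}. a m) \<longlonglongrightarrow> A" by blast
  let ?G = "\<lambda>X y. g (X + (- \<kappa>) *\<^sub>R y)"
  \<comment> \<open>The remainder of the sampling formula as a Schwartz function of
    \<open>y\<close>. Its image under \<open>T\<close> is the error of the formula for
    \<open>u\<close>, so it suffices that the seminorm tends to 0.\<close>
  let ?R = "\<lambda>L y. ?G X y + (\<Sum>m\<in>{- int L..int L}. (- complex_of_real (w m)) * ?G (p m) y)"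
  note GS = schwartz_affine[OF g c1]
  have S: "?R L \<in> schwartz \<and>
      (\<forall>js. partials js (?R L) = (\<lambda>y. partials js (?G X) y + (\<Sum>m\<in>{- int L..int L}. (- complex_of_real (w m)) * partials js (?G (p m)) y))) \<and>
      (\<forall>T\<in>tempered_distributions. T (?R L) = T (?G X) + (\<Sum>m\<in>{- int L..int L}. (- complex_of_real (w m)) * T (?G (p m))))" for L
    by (rule schwartz_sum[of _ "?G X" "\<lambda>m. ?G (p m)" "\<lambda>m. - complex_of_real (w m)"]) (rule finite_atLeastAtMost_int GS)+
  have semi: "\<bar>schwartz_seminorm N (?R L)\<bar> \<le> \<kappa> ^ N * (A - (\<Sum>m\<in>{- int L..int L}. a m))" for L
  proof (rule schwartz_seminorm_le)
    fix js :: "'n list" and y :: "real^'n"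
    assume js: "length js \<le> N"
    let ?D = "partials js g"
    let ?c = "\<lambda>m. complex_of_real ((1 + norm y) ^ N) * (complex_of_real (w m) * ?D (p m + (- \<kappa>) *\<^sub>R y))"
    have nN: "norm (complex_of_real ((1 + norm y) ^ N)) = (1 + norm y) ^ N"
      by (simp only: norm_of_real) simp
    have n\<kappa>: "norm (complex_of_real ((- \<kappa>) ^ length js)) = \<kappa> ^ length js"
      using \<kappa> by (simp only: norm_of_real power_abs) simp
    have ca: "norm (?c m) \<le> a m" for m
    proof -
      have "norm (?c m) = \<bar>w m\<bar> * ((1 + norm y) ^ N * norm (?D (p m + (- \<kappa>) *\<^sub>R y)))"
        by (simp only: norm_mult nN mult.left_commute[of "(1 + norm y) ^ N"]) simp
      also have "\<dots> \<le> a m"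
        unfolding a_def by (intro mult_left_mono schwartz_affine_bound[OF c1 B[OF js]]) auto
      finally show ?thesis .
    qed
    have lim: "(\<lambda>L. \<Sum>m\<in>{- int L..int L}. ?c m) \<longlonglongrightarrow> complex_of_real ((1 + norm y) ^ N) * ?D (X + (- \<kappa>) *\<^sub>R y)"
    proof -
      let ?z = "X + (- \<kappa>) *\<^sub>R y"
      \<comment> \<open>The lattice is shifted with \<open>y\<close>, which keeps the coefficients
        equal to \<open>w m\<close> for all \<open>y\<close>.\<close>
      have "(\<lambda>L. \<Sum>m\<in>{- int L..int L}. complex_of_real (\<psi> (?z $ i - (\<sigma> - \<kappa> * y $ i) - of_int m)) *
          ?D (upd_coord ?z i (of_int m + (\<sigma> - \<kappa> * y $ i)))) \<longlonglongrightarrow> ?D ?z"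
        using samp unfolding samp_fun_def by blast
      moreover have "?z $ i - (\<sigma> - \<kappa> * y $ i) - of_int m = X $ i - \<sigma> - of_int m" for m :: int by simp
      moreover have "upd_coord ?z i (of_int m + (\<sigma> - \<kappa> * y $ i)) = p m + (- \<kappa>) *\<^sub>R y" for m :: int
        by (auto simp: p_def vec_eq_iff)
      ultimately have "(\<lambda>L. \<Sum>m\<in>{- int L..int L}. complex_of_real (w m) * ?D (p m + (- \<kappa>) *\<^sub>R y)) \<longlonglongrightarrow> ?D ?z"
        by (simp only: w_def)
      then show ?thesis by (simp only: sum_distrib_left[symmetric]) (intro tendsto_intros)
    qed
    have "partials js (?R L) y = complex_of_real ((- \<kappa>) ^ length js) *
        (?D (X + (- \<kappa>) *\<^sub>R y) - (\<Sum>m\<in>{- int L..int L}. complex_of_real (w m) * ?D (p m + (- \<kappa>) *\<^sub>R y)))"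
    proof -
      have "partials js (?R L) y = partials js (?G X) y + (\<Sum>m\<in>{- int L..int L}. (- complex_of_real (w m)) * partials js (?G (p m)) y)"
        using conjunct1[OF conjunct2[OF S[of L]]] by (simp only:)
      then show ?thesis
        by (simp only: partials_affine(1)[OF g]) (simp add: sum_negf sum_distrib_left right_diff_distrib mult_ac)
    qed
    then have "(1 + norm y) ^ N * norm (partials js (?R L) y) =
        \<kappa> ^ length js * norm (complex_of_real ((1 + norm y) ^ N) * ?D (X + (- \<kappa>) *\<^sub>R y) - (\<Sum>m\<in>{- int L..int L}. ?c m))"
      by (simp only: sum_distrib_left[symmetric] right_diff_distrib[symmetric] norm_mult n\<kappa> nN mult.left_commute[of "(1 + norm y) ^ N"])
    also have "\<dots> \<le> \<kappa> ^ N * (A - (\<Sum>m\<in>{- int L..int L}. a m))"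
      using \<kappa> js by (intro mult_mono int_series_tail_le[OF ca A lim] power_increasing) auto
    finally show "(1 + norm y) ^ N * norm (partials js (?R L) y) \<le> \<kappa> ^ N * (A - (\<Sum>m\<in>{- int L..int L}. a m))" .
  qed
  have err: "norm (u X - (\<Sum>m\<in>{- int L..int L}. complex_of_real (w m) * u (p m))) \<le> \<bar>K\<bar> * (\<kappa> ^ N * (A - (\<Sum>m\<in>{- int L..int L}. a m)))" for L
  proof -
    have TR: "T (?R L) = u X - (\<Sum>m\<in>{- int L..int L}. complex_of_real (w m) * u (p m))"
    proof -
      have "T (?R L) = T (?G X) + (\<Sum>m\<in>{- int L..int L}. (- complex_of_real (w m)) * T (?G (p m)))"
        by (rule bspec[OF conjunct2[OF conjunct2[OF S[of L]]] T])
      also have "\<dots> = u X - (\<Sum>m\<in>{- int L..int L}. complex_of_real (w m) * u (p m))"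
        by (simp only: u_def mult_minus_left sum_negf add_uminus_conv_diff)
      finally show ?thesis .
    qed
    have "norm (T (?R L)) \<le> K * schwartz_seminorm N (?R L)" by (rule ord[OF conjunct1[OF S]])
    also have "K * schwartz_seminorm N (?R L) \<le> \<bar>K\<bar> * \<bar>schwartz_seminorm N (?R L)\<bar>"
      unfolding abs_mult[symmetric] by (rule abs_ge_self)
    also have "\<dots> \<le> \<bar>K\<bar> * (\<kappa> ^ N * (A - (\<Sum>m\<in>{- int L..int L}. a m)))"
      by (intro mult_left_mono semi) auto
    finally show ?thesis by (simp only: TR)
  qed
  have "(\<lambda>L. A - (\<Sum>m\<in>{- int L..int L}. a m)) \<longlonglongrightarrow> A - A"
    by (rule tendsto_diff[OF tendsto_const A])
  then have "(\<lambda>L. \<bar>K\<bar> * (\<kappa> ^ N * (A - (\<Sum>m\<in>{- int L..int L}. a m)))) \<longlonglongrightarrow> 0"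
    unfolding diff_self by (rule tendsto_mult_right_zero[OF tendsto_mult_right_zero])
  then have "(\<lambda>L. u X - (\<Sum>m\<in>{- int L..int L}. complex_of_real (w m) * u (p m))) \<longlonglongrightarrow> 0"
    by (rule Lim_null_comparison[OF always_eventually[OF allI[OF err]]])
  then have "(\<lambda>L. u X - (u X - (\<Sum>m\<in>{- int L..int L}. complex_of_real (w m) * u (p m)))) \<longlonglongrightarrow> u X - 0"
    by (intro tendsto_diff tendsto_const)
  then show "(\<lambda>L. \<Sum>m\<in>{- int L..int L}. complex_of_real (\<psi> (X $ i - \<sigma> - of_int m)) *
      T (\<lambda>y. g (upd_coord X i (of_int m + \<sigma>) + (- \<kappa>) *\<^sub>R y))) \<longlonglongrightarrow> T (\<lambda>y. g (X + (- \<kappa>) *\<^sub>R y))"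
    by (simp add: u_def w_def p_def)
qed

text \<open>Measurability follows from the sampling formula, one coordinate at a time.\<close>

lemma samp_fun_measurable:
  fixes u :: "real^'n \<Rightarrow> complex"
  assumes [measurable]: "\<psi> \<in> borel_measurable borel" and u: "samp_fun \<psi> u"
  shows "u \<in> borel_measurable borel"
proof -
  have "\<forall>z. (\<lambda>x. u (\<chi> j. if j \<in> S then x $ j else z $ j)) \<in> borel_measurable borel" if "finite S" for S :: "'n set"
    using that
  proof induction
    case (insert i S)
    show ?case
    proof
      fix z
      \<comment> \<open>Coordinates in \<open>S\<close> are taken from \<open>x\<close> and frozen
        elsewhere. Sampling in coordinate \<open>i\<close> freezes it at integers and leaves
        \<open>x $ i\<close> only in the measurable coefficients.\<close>
      let ?mix = "\<lambda>S x z. (\<chi> j. if j \<in> S then x $ j else z $ j) :: real^'n"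
      have "(\<lambda>L. \<Sum>m\<in>{- int L..int L}. complex_of_real (\<psi> (x $ i - of_int m)) * u (?mix S x (upd_coord z i (of_int m)))) \<longlonglongrightarrow> u (?mix (insert i S) x z)" for x
      proof -
        have "(\<lambda>L. \<Sum>m\<in>{- int L..int L}. complex_of_real (\<psi> (?mix (insert i S) x z $ i - 0 - of_int m)) * u (upd_coord (?mix (insert i S) x z) i (of_int m + 0))) \<longlonglongrightarrow> u (?mix (insert i S) x z)"
          using u unfolding samp_fun_def by blast
        moreover have "upd_coord (?mix (insert i S) x z) i (of_int m + 0) = ?mix S x (upd_coord z i (of_int m))" for m :: int
          using insert.hyps by (auto simp: vec_eq_iff)
        ultimately show ?thesis by simp
      qed
      moreover have "(\<lambda>x. \<Sum>m\<in>{- int L..int L}. complex_of_real (\<psi> (x $ i - of_int m)) * u (?mix S x (upd_coord z i (of_int m)))) \<in> borel_measurable borel" for L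
      proof -
        have [measurable]: "(\<lambda>x. u (?mix S x (upd_coord z i (of_int m)))) \<in> borel_measurable borel" for m :: int
          using insert.IH by blast
        show ?thesis by measurable
      qed
      ultimately show "(\<lambda>x. u (?mix (insert i S) x z)) \<in> borel_measurable borel"
        by (rule borel_measurable_LIMSEQ_metric[rotated])
    qed
  qed simp
  from this[of UNIV] show ?thesis by simp
qed

text \<open>As \<open>e <= 1\<close>, the \<open>e\<close>-th power may be taken inside the sum term
  by term, and the kernel decay \<open>M'\<close> becomes \<open>M' * e\<close>, which is at least
  \<open>M\<close>. The bound is the same for all partial sums and so passes to the limit.
  \<open>u\<close> lives at unit scale; the factor \<open>2^k\<close> restores the
  frequency.\<close>

lemma samp_fun_imp_sampled:
  fixes u :: "real^'n \<Rightarrow> complex"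
  assumes u: "samp_fun \<psi> u" and \<psi>: "\<And>t. \<bar>\<psi> t\<bar> * (1 + \<bar>t\<bar>) ^ M' \<le> C"
    and e: "0 < e" "e \<le> 1" and M: "M \<le> real M' * e"
  shows "sampled (ennreal (C powr e)) M k i (\<lambda>x. epow (ennreal (norm (u (2 ^ k *\<^sub>R x)))) e)"
  unfolding sampled_def
proof (intro allI)
  fix x :: "real^'n" and s
  let ?X = "2 ^ k *\<^sub>R x"
  let ?y = "\<lambda>m::int. upd_coord x i ((of_int m + s) / 2 ^ k)"
  let ?h = "\<lambda>x. epow (ennreal (norm (u (2 ^ k *\<^sub>R x)))) e"
  define W where "W m = ennreal ((1 + \<bar>2 ^ k * x $ i - (of_int m + s)\<bar>) powr (- M)) * ?h (?y m)" for m :: int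
  let ?f = "\<lambda>m::int. complex_of_real (\<psi> (?X $ i - s - of_int m)) * u (2 ^ k *\<^sub>R ?y m)"
  have y: "2 ^ k *\<^sub>R ?y m = upd_coord ?X i (of_int m + s)" for m
    by (auto simp: vec_eq_iff)
  have C0: "0 \<le> C" using \<psi>[of 0] by (rule order_trans[rotated]) simp
  have term_le: "epow (ennreal (norm (?f m))) e \<le> ennreal (C powr e) * W m" for m
  proof -
    let ?t = "?X $ i - s - of_int m"
    have "\<bar>\<psi> ?t\<bar> powr e \<le> C powr e * (1 + \<bar>?t\<bar>) powr (- M)"
    proof -
      have pos: "0 < 1 + \<bar>?t\<bar>" by simp
      have "\<bar>\<psi> ?t\<bar> \<le> C * (1 + \<bar>?t\<bar>) powr (- real M')"
        using \<psi>[of ?t] by (simp add: powr_minus_divide powr_realpow pos_le_divide_eq)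
      then have "\<bar>\<psi> ?t\<bar> powr e \<le> (C * (1 + \<bar>?t\<bar>) powr (- real M')) powr e"
        using e by (intro powr_mono2) auto
      also have "\<dots> = C powr e * (1 + \<bar>?t\<bar>) powr (- (real M' * e))"
        using C0 by (simp add: powr_mult powr_powr)
      also have "\<dots> \<le> C powr e * (1 + \<bar>?t\<bar>) powr (- M)"
        using M by (intro mult_left_mono powr_mono) auto
      finally show ?thesis .
    qed
    moreover have "?t = 2 ^ k * x $ i - (of_int m + s)" by simp
    ultimately have \<psi>e: "\<bar>\<psi> ?t\<bar> powr e \<le> C powr e * (1 + \<bar>2 ^ k * x $ i - (of_int m + s)\<bar>) powr (- M)"
      by (simp only:)
    have "epow (ennreal (norm (?f m))) e = ennreal (\<bar>\<psi> ?t\<bar> powr e) * ?h (?y m)"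
      by (simp add: norm_mult ennreal_mult epow_mult epow_ennreal)
    also have "\<dots> \<le> ennreal (C powr e * (1 + \<bar>2 ^ k * x $ i - (of_int m + s)\<bar>) powr (- M)) * ?h (?y m)"
      using \<psi>e by (intro mult_right_mono ennreal_leI) auto
    finally show ?thesis by (simp add: W_def ennreal_mult mult.assoc)
  qed
  have part: "ennreal (norm (\<Sum>m\<in>{- int L..int L}. ?f m)) \<le> epow (ennreal (C powr e) * csum W) (1 / e)" for L
  proof -
    have "ennreal (norm (\<Sum>m\<in>{- int L..int L}. ?f m)) \<le> csum (\<lambda>m. ennreal (norm (?f m)) * indicator {- int L..int L} m)"
    proof -
      have "csum (\<lambda>m. ennreal (norm (?f m)) * indicator {- int L..int L} m) = (\<Sum>m\<in>{- int L..int L}. ennreal (norm (?f m)))"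
        by (subst nn_integral_count_space'[where A="{- int L..int L}"]) (auto split: split_indicator)
      then show ?thesis by (simp only: sum_ennreal norm_ge_zero) (intro ennreal_leI norm_sum)
    qed
    also have "\<dots> \<le> csum (\<lambda>m. ennreal (norm (?f m)))"
      by (intro nn_integral_mono) (auto split: split_indicator)
    finally have "epow (ennreal (norm (\<Sum>m\<in>{- int L..int L}. ?f m))) e \<le> epow (csum (\<lambda>m. ennreal (norm (?f m)))) e"
      using e by (intro epow_mono) auto
    also have "\<dots> \<le> csum (\<lambda>m. epow (ennreal (norm (?f m))) e)" using e by (rule epow_csum_le)
    also have "\<dots> \<le> csum (\<lambda>m. ennreal (C powr e) * W m)" by (intro nn_integral_mono term_le)
    also have "\<dots> = ennreal (C powr e) * csum W" by (simp add: nn_integral_cmult)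
    finally have "epow (epow (ennreal (norm (\<Sum>m\<in>{- int L..int L}. ?f m))) e) (1 / e) \<le> epow (ennreal (C powr e) * csum W) (1 / e)"
      using e by (intro epow_mono) auto
    then show ?thesis using e by (simp add: epow_epow)
  qed
  have "(\<lambda>L. \<Sum>m\<in>{- int L..int L}. ?f m) \<longlonglongrightarrow> u ?X"
    using u unfolding samp_fun_def y by blast
  then have "(\<lambda>L. ennreal (norm (\<Sum>m\<in>{- int L..int L}. ?f m))) \<longlonglongrightarrow> ennreal (norm (u ?X))"
    by (intro tendsto_ennrealI tendsto_norm)
  then have "ennreal (norm (u ?X)) \<le> epow (ennreal (C powr e) * csum W) (1 / e)"
    by (rule LIMSEQ_le_const2) (use part in blast)
  then have "?h x \<le> epow (epow (ennreal (C powr e) * csum W) (1 / e)) e"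
    using e by (intro epow_mono) auto
  then show "?h x \<le> ennreal (C powr e) * csum (\<lambda>m::int. ennreal ((1 + \<bar>2 ^ k * x $ i - (of_int m + s)\<bar>) powr (- M)) * ?h (?y m))"
    using e by (simp add: epow_epow W_def)
qed

section \<open>The embedding\<close>

lemma samp_fun_cmult:
  assumes "samp_fun \<psi> u"
  shows "samp_fun \<psi> (\<lambda>x. a * u x)"
  unfolding samp_fun_def
proof (intro allI)
  fix z i \<sigma>
  have "(\<lambda>L. \<Sum>m\<in>{- int L..int L}. complex_of_real (\<psi> (z $ i - \<sigma> - of_int m)) * u (upd_coord z i (of_int m + \<sigma>))) \<longlonglongrightarrow> u z"
    using assms unfolding samp_fun_def by blast
  then have "(\<lambda>L. a * (\<Sum>m\<in>{- int L..int L}. complex_of_real (\<psi> (z $ i - \<sigma> - of_int m)) * u (upd_coord z i (of_int m + \<sigma>)))) \<longlonglongrightarrow> a * u z"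
    by (rule tendsto_mult_left)
  then show "(\<lambda>L. \<Sum>m\<in>{- int L..int L}. complex_of_real (\<psi> (z $ i - \<sigma> - of_int m)) * (a * u (upd_coord z i (of_int m + \<sigma>)))) \<longlonglongrightarrow> a * u z"
    by (simp only: sum_distrib_left mult.left_commute[of a])
qed

text \<open>In the variable \<open>X = 2^k x\<close> the mollifier is \<open>\<Phi>\<close> or
  \<open>\<phi>\<close> itself, with spectrum in the ball of radius 2 for every \<open>k\<close>, so
  the constant is uniform in \<open>k\<close>. The order of \<open>T\<close> influences the choice
  of \<open>\<psi>\<close> but not \<open>C\<close>.\<close>

lemma convol_dyadic_sampled:
  fixes \<Phi> \<phi> :: "real^'n \<Rightarrow> complex"
  assumes adm: "admissible \<Phi> \<phi>" and e: "0 < e" "e \<le> 1" and M: "M \<le> real M' * e" and M': "2 \<le> M'"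
    and kern: "\<And>N::nat. \<exists>\<psi> C'. \<psi> \<in> borel_measurable borel \<and> sampling_on 2 \<psi> \<and>
     (\<forall>t. \<bar>\<psi> t\<bar> * (1 + \<bar>t\<bar>) ^ M' \<le> C) \<and> (\<forall>t. \<bar>\<psi> t\<bar> * (1 + \<bar>t\<bar>) ^ N \<le> C')"
    and T: "T \<in> tempered_distributions"
  shows "sampled (ennreal (C powr e)) M k i (\<lambda>x. epow (ennreal (norm (convol (dyadic \<Phi> \<phi> k) T x))) e)"
    and "convol (dyadic \<Phi> \<phi> k) T \<in> borel_measurable borel"
proof -
  define g where "g = (if k = 0 then \<Phi> else \<phi>)"
  have g: "g \<in> schwartz" using adm by (simp add: g_def admissible_def)
  have supp: "fourier g \<xi> = 0" if "2 < norm \<xi>" for \<xi>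
  proof (rule ccontr)
    assume "fourier g \<xi> \<noteq> 0"
    then have "\<xi> \<in> closure {\<xi>. fourier g \<xi> \<noteq> 0}" by (intro subsetD[OF closure_subset]) simp
    moreover have "closure {\<xi>. fourier g \<xi> \<noteq> 0} \<subseteq> {\<xi>. norm \<xi> \<le> 2}"
      using adm unfolding admissible_def g_def by auto
    ultimately show False using that by auto
  qed
  obtain N K where ord: "\<And>f. f \<in> schwartz \<Longrightarrow> norm (T f) \<le> K * schwartz_seminorm N f"
  proof -
    have "\<exists>N K. \<forall>f\<in>schwartz. norm (T f) \<le> K * schwartz_seminorm N f"
      using T unfolding tempered_distributions_def by (elim CollectE conjE)
    then show ?thesis using that by blast
  qed
  obtain \<psi> C' where \<psi>: "\<psi> \<in> borel_measurable borel" "sampling_on 2 \<psi>"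
      "\<And>t. \<bar>\<psi> t\<bar> * (1 + \<bar>t\<bar>) ^ M' \<le> C" "\<And>t. \<bar>\<psi> t\<bar> * (1 + \<bar>t\<bar>) ^ (N + 2) \<le> C'"
    using kern[of "N + 2"] by blast
  have \<psi>2: "\<bar>\<psi> t\<bar> * (1 + \<bar>t\<bar>) ^ 2 \<le> C" for t
  proof -
    have "\<bar>\<psi> t\<bar> * (1 + \<bar>t\<bar>) ^ 2 \<le> \<bar>\<psi> t\<bar> * (1 + \<bar>t\<bar>) ^ M'"
      using M' by (intro mult_left_mono power_increasing) auto
    then show ?thesis using \<psi>(3)[of t] by simp
  qed
  define a :: complex where "a = 2 ^ (k * CARD('n))"
  define u where "u X = a * T (\<lambda>y. g (X + (- (2 ^ k)) *\<^sub>R y))" for X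
  have samp: "samp_fun \<psi> u"
    unfolding u_def
    by (intro samp_fun_cmult samp_fun_tempered[OF T ord g _ \<psi>(4)] samp_fun_partials[OF \<psi>(2) \<psi>2 g supp]) simp_all
  have conv: "convol (dyadic \<Phi> \<phi> k) T x = u (2 ^ k *\<^sub>R x)" for x
  proof -
    let ?G = "\<lambda>y. g (2 ^ k *\<^sub>R x + (- (2 ^ k)) *\<^sub>R y)"
    have G: "?G \<in> schwartz" by (rule schwartz_affine[OF g]) simp
    \<comment> \<open>Written with two summands to match the form of linearity in
      \<open>tempered_distributions\<close>.\<close>
    have "(\<lambda>y. dyadic \<Phi> \<phi> k (x - y)) = (\<lambda>y. a * ?G y + 0 * ?G y)"
      by (auto simp: dyadic_def a_def g_def fun_eq_iff scaleR_diff_right)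
    then have "convol (dyadic \<Phi> \<phi> k) T x = T (\<lambda>y. a * ?G y + 0 * ?G y)"
      unfolding convol_def by (simp only:)
    also have "\<dots> = u (2 ^ k *\<^sub>R x)" by (subst tempered_linear[OF T G G]) (simp add: u_def)
    finally show ?thesis .
  qed
  show "sampled (ennreal (C powr e)) M k i (\<lambda>x. epow (ennreal (norm (convol (dyadic \<Phi> \<phi> k) T x))) e)"
    unfolding conv by (rule samp_fun_imp_sampled[OF samp \<psi>(3) e M])
  have [measurable]: "u \<in> borel_measurable borel" by (rule samp_fun_measurable[OF \<psi>(1) samp])
  show "convol (dyadic \<Phi> \<phi> k) T \<in> borel_measurable borel"
    unfolding conv[abs_def] by measurable
qed

lemma lq_norm_le_cln:
  assumes "0 < e" "ennreal e \<le> \<theta>"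
  shows "lq_norm \<theta> f \<le> cln e f"
proof (cases \<theta>)
  case (real t)
  then have "e \<le> t" using assms by simp
  then show ?thesis using real assms cln_antimono[of e t f] by (simp add: Lp_norm_eq_lpn)
next
  case top
  then show ?thesis using lq_norm_infinity[of f] cln_ge[of e f] assms by (auto intro: SUP_least)
qed

lemma small_exponent_exists:
  fixes b :: "'n::finite \<Rightarrow> real"
  assumes "\<And>i. 0 < b i" "0 < \<theta>"
  obtains e where "0 < e" "e \<le> 1" "ennreal e \<le> \<theta>" "\<And>i. e \<le> b i"
proof -
  obtain c where c: "0 < c" "ennreal c \<le> \<theta>"
  proof (cases \<theta>)
    case (real t)
    then show ?thesis using assms(2) by (intro that[of t]) (auto simp: ennreal_less_zero_iff)
  next
    case top
    then show ?thesis by (intro that[of 1]) auto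
  qed
  define e where "e = min (min 1 c) (Min (range b))"
  have "0 < Min (range b)" using assms by (subst Min_gr_iff) auto
  then have "0 < e" using c by (simp add: e_def)
  moreover have "ennreal e \<le> \<theta>"
    by (rule order_trans[OF _ c(2)]) (simp add: e_def ennreal_leI)
  moreover have "e \<le> b i" for i
    by (simp add: e_def min.coboundedI2)
  ultimately show ?thesis by (intro that) (auto simp: e_def)
qed

text \<open>The disjunction on \<open>\<delta>\<close> merges the two parts of the theorem: its
  second case is the strict inequality of (i), its first is ensured by the choice of the exponent in
  (ii).\<close>

lemma besov_embeds_triebelI:
  fixes \<Phi> \<phi> :: "'n::{finite,linorder} point \<Rightarrow> complex"
    and p q r \<alpha>1 \<alpha>2 :: "'n \<Rightarrow> real" and n :: 'n
  assumes adm: "admissible \<Phi> \<phi>" and n: "n = Max UNIV"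
    and qp: "\<And>i. 0 < q i \<and> q i < p i" and r: "\<And>i. 0 < r i" and \<theta>: "0 < \<theta>"
    and a1: "\<And>i. \<alpha>1 i > - 1 / p i" and a2: "\<And>i. \<alpha>2 i > - 1 / q i"
    and a12: "\<And>i. \<alpha>1 i \<le> \<alpha>2 i"
    and \<delta>: "0 < \<delta>" "\<delta> \<le> r n" "\<delta> \<le> p n \<or> \<alpha>1 n < \<alpha>2 n"
    and s: "s1 - (\<Sum>i\<in>UNIV. 1 / p i) - (\<Sum>i\<in>UNIV. \<alpha>1 i) = s2 - (\<Sum>i\<in>UNIV. 1 / q i) - (\<Sum>i\<in>UNIV. \<alpha>2 i)"
  shows "besov_embeds_triebel \<Phi> \<phi> r q \<alpha>2 s2 (ennreal \<delta>) p \<alpha>1 s1 \<theta>"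
proof -
  have a2': "0 < \<alpha>2 i + 1 / q i" for i using a2[of i] by simp
  \<comment> \<open>The first two bounds on \<open>e\<close> make the rescaled exponents at least 1;
    the third gives \<open>e * (\<alpha>2 i + 1 / q i) <= 1/2\<close>, safely below 1.\<close>
  have bpos: "0 < min (q i) (min (r i) (1 / (2 * (\<alpha>2 i + 1 / q i))))" for i
  proof -
    have "0 < 1 / (2 * (\<alpha>2 i + 1 / q i))" using a2'[of i] by (intro divide_pos_pos mult_pos_pos) auto
    then show ?thesis using qp[of i] r[of i] by simp
  qed
  obtain e where e: "0 < e" "e \<le> 1" "ennreal e \<le> \<theta>"
    and eb: "\<And>i. e \<le> min (q i) (min (r i) (1 / (2 * (\<alpha>2 i + 1 / q i))))"
  proof (rule small_exponent_exists[of "\<lambda>i. min (q i) (min (r i) (1 / (2 * (\<alpha>2 i + 1 / q i))))", OF bpos \<theta>])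
    fix e assume "0 < e" "e \<le> 1" "ennreal e \<le> \<theta>"
      "\<And>i. e \<le> min (q i) (min (r i) (1 / (2 * (\<alpha>2 i + 1 / q i))))"
    then show ?thesis by (rule that)
  qed
  have e_small: "e * (\<alpha>2 i + 1 / q i) < 1" for i
  proof -
    have "e * (\<alpha>2 i + 1 / q i) \<le> 1 / (2 * (\<alpha>2 i + 1 / q i)) * (\<alpha>2 i + 1 / q i)"
      using eb[of i] a2'[of i] by (intro mult_right_mono) auto
    also have "\<dots> = 1 / 2" using a2'[of i] by simp
    finally show ?thesis by (rule le_less_trans) simp
  qed
  define P Q R A1 A2 where "P i = p i / e" and "Q i = q i / e" and "R i = r i / e"
    and "A1 i = \<alpha>1 i * e" and "A2 i = \<alpha>2 i * e" for i
  note defs = P_def Q_def R_def A1_def A2_def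
  define mm where "mm i = (A1 i + 1 / P i) + (1 - 1 / Q i - A2 i) + 1" for i
  define M where "M = max 2 (Max (range mm))"
  have mm: "mm i \<le> M" for i by (simp add: M_def max.coboundedI2)
  interpret mixed_exponents P Q R A1 A2 M
  proof
    fix i
    show "1 \<le> Q i" "1 \<le> R i" using eb[of i] e by (auto simp: defs)
    show "Q i < P i" using qp[of i] e by (simp add: defs divide_strict_right_mono)
    have "0 < e * (\<alpha>1 i + 1 / p i)" using a1[of i] e by (intro mult_pos_pos) auto
    then show "0 < A1 i + 1 / P i" by (simp add: defs algebra_simps)
    show "0 < 1 - 1 / Q i - A2 i" using e_small[of i] by (simp add: defs algebra_simps)
    show "(A1 i + 1 / P i) + (1 - 1 / Q i - A2 i) + 1 \<le> M" using mm[of i] by (simp add: mm_def)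
  qed (simp add: M_def)
  \<comment> \<open>Only the \<open>e\<close>-th power of the kernel reaches the functions
    \<open>h k\<close>, so its decay rate has to be at least \<open>M / e\<close>. The bound 2
    serves termwise differentiation.\<close>
  obtain M' :: nat where M': "2 \<le> M'" "M \<le> real M' * e"
  proof -
    obtain m :: nat where "M / e \<le> real m" using real_arch_simple by blast
    then have "M \<le> real m * e" using e by (simp add: pos_divide_le_eq)
    also have "\<dots> \<le> real (max 2 m) * e" using e by (intro mult_right_mono) auto
    finally show ?thesis by (intro that[of "max 2 m"]) auto
  qed
  obtain C\<psi> where C\<psi>: "\<And>N::nat. \<exists>\<psi> C'. \<psi> \<in> borel_measurable borel \<and> sampling_on 2 \<psi> \<and>
     (\<forall>t. \<bar>\<psi> t\<bar> * (1 + \<bar>t\<bar>) ^ M' \<le> C\<psi>) \<and> (\<forall>t. \<bar>\<psi> t\<bar> * (1 + \<bar>t\<bar>) ^ N \<le> C')"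
    using sampling_kernel_exists[of M'] by blast
  define C0 where "C0 = ennreal (C\<psi> powr e)"
  define xs where "xs = sorted_list_of_set (UNIV :: 'n set)"
  define js where "js = butlast xs"
  have xs: "xs \<noteq> []" "distinct xs" "sorted xs" "set xs = UNIV" by (simp_all add: xs_def)
  \<comment> \<open>The list is processed from the innermost norm outwards, so \<open>n\<close>,
    where the sum over the frequencies is treated, belongs to the outermost one.\<close>
  have last: "last xs = n"
  proof -
    have "i \<le> last xs" for i
    proof -
      obtain j where j: "j < length xs" "xs ! j = i" using xs by (metis UNIV_I in_set_conv_nth)
      then show ?thesis using xs by (auto simp: last_conv_nth intro!: sorted_nth_mono)
    qed
    then show ?thesis unfolding n by (intro Max_eqI[symmetric]) auto
  qed
  have js: "xs = js @ [n]"
    unfolding js_def last[symmetric] by (rule append_butlast_last_id[OF xs(1), symmetric])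
  have sum_xs: "(\<Sum>i\<leftarrow>js @ [n]. f i) = (\<Sum>i\<in>UNIV. f i)" for f :: "'n \<Rightarrow> real"
    using sum_list_distinct_conv_sum_set[OF xs(2), of f] xs(4) by (simp only: js)
  have sum_scaled: "s * e - (\<Sum>i\<in>UNIV. 1 / (x i / e) + b i * e) = e * (s - (\<Sum>i\<in>UNIV. 1 / x i) - (\<Sum>i\<in>UNIV. b i))"
    for s and x b :: "'n \<Rightarrow> real"
    by (simp add: sum.distrib sum_distrib_left right_diff_distrib mult.commute)
  have "\<exists>C. C \<noteq> top \<and> (\<forall>h :: nat \<Rightarrow> 'n point \<Rightarrow> ennreal. (\<forall>k. h k \<in> borel_measurable borel) \<longrightarrow>
      (\<forall>k. \<forall>i\<in>set (js @ [n]). sampled C0 M k i (h k)) \<longrightarrow>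
      (\<forall>x. ihz P A1 R (js @ [n]) (\<lambda>x. csum (\<lambda>k. tp (k * (s1 * e)) * h k x)) x \<le>
        C * cln (\<delta> / e) (\<lambda>k. tp (k * (s2 * e)) * ihz Q A2 R (js @ [n]) (h k) x)))"
  proof (rule ihz_sum_bound)
    show "0 < \<delta> / e" "\<delta> / e \<le> R n" "\<delta> / e \<le> P n \<or> A1 n < A2 n" "A1 n \<le> A2 n"
      using \<delta> e a12[of n] by (auto simp: defs divide_right_mono)
    show "C0 \<noteq> top" by (simp add: C0_def)
    show "distinct (js @ [n])" using xs(2) by (simp only: js)
    show "A1 i \<le> A2 i" for i using a12[of i] e by (simp add: defs)
    show "s1 * e - (\<Sum>i\<leftarrow>js @ [n]. 1 / P i + A1 i) = s2 * e - (\<Sum>i\<leftarrow>js @ [n]. 1 / Q i + A2 i)"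
      unfolding sum_xs defs sum_scaled s ..
  qed
  then obtain C where C: "C \<noteq> top" "\<And>h x. (\<And>k::nat. h k \<in> borel_measurable borel) \<Longrightarrow>
      (\<And>k i. sampled C0 M k i (h k)) \<Longrightarrow>
      ihz P A1 R xs (\<lambda>x. csum (\<lambda>k. tp (k * (s1 * e)) * h k x)) x \<le>
        C * cln (\<delta> / e) (\<lambda>k. tp (k * (s2 * e)) * ihz Q A2 R xs (h k) x)"
    unfolding js by blast
  have p0: "0 < p i" for i using qp[of i] by simp
  have q0: "0 < q i" for i using qp[of i] by simp
  have main: "triebel_norm \<Phi> \<phi> (\<lambda>i. ennreal (p i)) \<alpha>1 (\<lambda>i. ennreal (r i)) s1 \<theta> T \<le>
      epow C (1 / e) * besov_norm \<Phi> \<phi> (\<lambda>i. ennreal (q i)) \<alpha>2 (\<lambda>i. ennreal (r i)) s2 (ennreal \<delta>) T"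
    if T: "T \<in> tempered_distributions" for T
  proof -
    define v where "v k x = ennreal (norm (convol (dyadic \<Phi> \<phi> k) T x))" for k x
    define h where "h k x = epow (v k x) e" for k x
    note conv = convol_dyadic_sampled[OF adm e(1,2) M'(2,1) C\<psi> T]
    have [measurable]: "convol (dyadic \<Phi> \<phi> k) T \<in> borel_measurable borel" for k by (rule conv)
    have h: "h k \<in> borel_measurable borel" for k unfolding h_def v_def by measurable
    have samp: "sampled C0 M k i (h k)" for k i
      unfolding h_def v_def C0_def by (rule conv)
    \<comment> \<open>Since \<open>e <= \<theta>\<close>, the inner \<open>\<theta>\<close>-norm is
      replaced by the larger \<open>e\<close>-norm, whose \<open>e\<close>-th power is a plain
      sum.\<close>
    have tri: "triebel_norm \<Phi> \<phi> (\<lambda>i. ennreal (p i)) \<alpha>1 (\<lambda>i. ennreal (r i)) s1 \<theta> T \<le>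
        ihz p \<alpha>1 r xs (\<lambda>x. cln e (\<lambda>k. tp (k * s1) * v k x)) 0"
      unfolding triebel_norm_def mixed_herz_norm_def iterated_herz_eq_ihz[OF p0 r] xs_def
      by (rule ihz_mono[OF p0 r]) (simp add: v_def tp_def lq_norm_le_cln[OF e(1,3)])
    have bes: "besov_norm \<Phi> \<phi> (\<lambda>i. ennreal (q i)) \<alpha>2 (\<lambda>i. ennreal (r i)) s2 (ennreal \<delta>) T =
        cln \<delta> (\<lambda>k. tp (k * s2) * ihz q \<alpha>2 r xs (v k) 0)"
      unfolding besov_norm_def mixed_herz_norm_def iterated_herz_eq_ihz[OF q0 r] xs_def Lp_norm_eq_lpn[OF \<delta>(1)]
      by (simp add: v_def[abs_def] tp_def)
    have "epow (ihz p \<alpha>1 r xs (\<lambda>x. cln e (\<lambda>k. tp (k * s1) * v k x)) 0) e =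
        ihz P A1 R xs (\<lambda>x. csum (\<lambda>k. tp (k * (s1 * e)) * h k x)) 0"
      unfolding ihz_rescale[OF p0 r e(1)] defs[abs_def] epow_lpn[OF e(1)]
      by (simp add: epow_mult epow_tp h_def mult.assoc)
    also have "\<dots> \<le> C * cln (\<delta> / e) (\<lambda>k. tp (k * (s2 * e)) * ihz Q A2 R xs (h k) 0)"
      by (rule C(2)[OF h samp])
    also have "cln (\<delta> / e) (\<lambda>k. tp (k * (s2 * e)) * ihz Q A2 R xs (h k) 0) =
        epow (cln \<delta> (\<lambda>k. tp (k * s2) * ihz q \<alpha>2 r xs (v k) 0)) e"
      unfolding lpn_rescale[OF \<delta>(1) e(1)] epow_mult ihz_rescale[OF q0 r e(1)] defs[abs_def]
      by (simp add: epow_tp h_def[abs_def] mult.assoc)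
    also have "C * epow (cln \<delta> (\<lambda>k. tp (k * s2) * ihz q \<alpha>2 r xs (v k) 0)) e =
        epow (epow C (1 / e) * cln \<delta> (\<lambda>k. tp (k * s2) * ihz q \<alpha>2 r xs (v k) 0)) e"
      using e by (simp add: epow_mult epow_epow)
    finally have "ihz p \<alpha>1 r xs (\<lambda>x. cln e (\<lambda>k. tp (k * s1) * v k x)) 0 \<le>
        epow C (1 / e) * cln \<delta> (\<lambda>k. tp (k * s2) * ihz q \<alpha>2 r xs (v k) 0)"
      by (simp only: epow_le_iff[OF e(1)])
    with tri show ?thesis unfolding bes by (rule order_trans)
  qed
  have fin: "epow C (1 / e) = ennreal (enn2real (epow C (1 / e)))"
    using C(1) by (simp add: less_top[symmetric])
  show ?thesis
    unfolding besov_embeds_triebel_def embeds_def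
  proof (intro conjI exI[of _ "enn2real (epow C (1 / e))"] ballI subsetI)
    fix T
    assume T: "T \<in> besov_space \<Phi> \<phi> (\<lambda>i. ennreal (q i)) \<alpha>2 (\<lambda>i. ennreal (r i)) s2 (ennreal \<delta>)"
    then have temp: "T \<in> tempered_distributions"
      and bfin: "besov_norm \<Phi> \<phi> (\<lambda>i. ennreal (q i)) \<alpha>2 (\<lambda>i. ennreal (r i)) s2 (ennreal \<delta>) T < \<infinity>"
      by (auto simp: besov_space_def)
    show "triebel_norm \<Phi> \<phi> (\<lambda>i. ennreal (p i)) \<alpha>1 (\<lambda>i. ennreal (r i)) s1 \<theta> T \<le>
      ennreal (enn2real (epow C (1 / e))) * besov_norm \<Phi> \<phi> (\<lambda>i. ennreal (q i)) \<alpha>2 (\<lambda>i. ennreal (r i)) s2 (ennreal \<delta>) T"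
      using main[OF temp] fin by simp
    have "epow C (1 / e) * besov_norm \<Phi> \<phi> (\<lambda>i. ennreal (q i)) \<alpha>2 (\<lambda>i. ennreal (r i)) s2 (ennreal \<delta>) T < \<infinity>"
      by (subst fin) (use bfin in \<open>simp add: ennreal_mult_less_top\<close>)
    then show "T \<in> triebel_space \<Phi> \<phi> (\<lambda>i. ennreal (p i)) \<alpha>1 (\<lambda>i. ennreal (r i)) s1 \<theta>"
      using main[OF temp] temp by (auto simp: triebel_space_def intro: le_less_trans)
  qed
qed

theorem theorem6p24:
  fixes \<Phi> \<phi> :: "'n::{finite,linorder} point \<Rightarrow> complex"
    and s1 s2 :: real
    and p q r \<alpha>1 \<alpha>2 :: "'n \<Rightarrow> real"
    and \<theta> :: ennreal
    and n :: 'n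
  assumes "admissible \<Phi> \<phi>"
    and "n = Max UNIV"
    and "\<forall>i. 0 < q i \<and> q i < p i"
    and "\<forall>i. 0 < r i"
    and "0 < \<theta>"
    and "\<forall>i. \<alpha>1 i > - 1 / p i"
    and "\<forall>i. \<alpha>2 i > - 1 / q i"
    and "\<forall>i. i < n \<longrightarrow> \<alpha>2 i \<ge> \<alpha>1 i"
    and "s1 - (\<Sum>i\<in>UNIV. 1 / p i) - (\<Sum>i\<in>UNIV. \<alpha>1 i) = s2 - (\<Sum>i\<in>UNIV. 1 / q i) - (\<Sum>i\<in>UNIV. \<alpha>2 i)"
  shows "(\<alpha>2 n > \<alpha>1 n \<longrightarrow>
            besov_embeds_triebel \<Phi> \<phi> r q \<alpha>2 s2 (ennreal (r n)) p \<alpha>1 s1 \<theta>) \<and>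
         (\<alpha>2 n = \<alpha>1 n \<longrightarrow>
            besov_embeds_triebel \<Phi> \<phi> r q \<alpha>2 s2 (ennreal (if r n \<le> p n then r n else p n)) p \<alpha>1 s1 \<theta>)"
proof -
  have le: "\<alpha>1 i \<le> \<alpha>2 i" if "\<alpha>1 n \<le> \<alpha>2 n" for i
  proof (cases "i = n")
    case False
    have "i \<le> n" unfolding assms(2) by simp
    then show ?thesis using assms(8) False by simp
  qed (use that in simp)
  have p: "0 < p i" for i using assms(3) by (meson less_trans)
  show ?thesis
  proof (intro conjI impI)
    assume "\<alpha>1 n < \<alpha>2 n"
    then show "besov_embeds_triebel \<Phi> \<phi> r q \<alpha>2 s2 (ennreal (r n)) p \<alpha>1 s1 \<theta>"
      using assms le by (intro besov_embeds_triebelI[where n=n]) auto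
  next
    assume "\<alpha>2 n = \<alpha>1 n"
    then show "besov_embeds_triebel \<Phi> \<phi> r q \<alpha>2 s2 (ennreal (if r n \<le> p n then r n else p n)) p \<alpha>1 s1 \<theta>"
      using assms le p by (intro besov_embeds_triebelI[where n=n]) auto
  qed
qed

end
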